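(* Let $X$ be a finite set and $G_r=(M_X,\mathrm{tr},A_r)$, $r=1,2$, be algebraic quantum graphs. Let $\mathcal{N}$ be a von Neumann algebra with a faithful trace $\tilde\tau$ and let $U=(u_{i,j})_{i,j=1}^{n^2}$ ($n=|X|$) be a bi-unitary with entries in $\mathcal{N}$ whose associated QNS correlation $$\Gamma(\epsilon_{i,i'}\otimes\epsilon_{j,j'})=\sum_{k,k',l,l'}\tilde\tau(u_{k,i}^*u_{k',i'}u_{l',j'}^*u_{l,j})\,\epsilon_{k,k'}\otimes\epsilon_{l,l'}$$ implements a qc-pseudo-isomorphism between the quantum pseudo-graphs $\tilde{\mathcal{U}}_{G_1}$ and $\tilde{\mathcal{U}}_{G_2}$. Assume that $U$ is the unitary implementation of a trace-preserving $*$-homomorphism $\rho:M_X\to M_X\otimes\mathcal{N}$. Then $U(A_1\otimes I)=(A_2\otimes I)U$, and hence $G_1\simeq_{\rm qc}G_2$.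
   Context: Algebraic quantum graphs. Let $n=|X|$, $M_X$ the complex $X\times X$ matrices, $\mathrm{tr}=\frac1n\mathrm{Tr}$. $L^2(M_X)$ is $M_X$ as a Hilbert space via $\Lambda:M_X\to L^2(M_X)$, $\langle\Lambda(a),\Lambda(b)\rangle=\mathrm{tr}(a^*b)$ (linear in the second variable); $M_X$ acts on it by $\pi(a)\Lambda(b)=\Lambda(ab)$ (and we write $a$ for $\pi(a)$). Let $m:L^2(M_X)\otimes L^2(M_X)\to L^2(M_X)$, $m(\Lambda(a)\otimes\Lambda(b))=\Lambda(ab)$, with Hilbert space adjoint $m^*$, and $\eta:\mathbb{C}\to L^2(M_X)$, $\eta(\lambda)=\lambda\Lambda(1)$. A quantum adjacency matrix is a self-adjoint linear map $A:L^2(M_X)\to L^2(M_X)$ with (1) $m(A\otimes A)m^*=A$; (2) $(\mathrm{id}\otimes\eta^*m)(1\otimes A\otimes1)(m^*\eta\otimes\mathrm{id})=A$; (3) $m(A\otimes1)m^*=0$. An algebraic quantum graph is a triple $G=(M_X,\mathrm{tr},A)$ with $A$ a quantum adjacency matrix. Fix a basis $f_1,\dots,f_{n^2}$ of $M_X$ such that $\{\Lambda(f_j)\}$ is an orthonormal basis of $L^2(M_X)$; use it to identify $L^2(M_X)$ with $\mathbb{C}^{n^2}$. If $\mathcal{N}$ acts on a Hilbert space $K$, the matrix $U=(u_{i,j})$ is viewed as the operator on $L^2(M_X)\otimes K$ with $U(\Lambda(f_i)\otimes\xi)=\sum_j\Lambda(f_j)\otimes u_{j,i}\xi$. $U$ is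 a bi-unitary if both $U$ and $U^{\rm t}=(u_{j,i})_{i,j}$ are unitary. Quantum commuting isomorphism: $\mathcal{O}(G_1,G_2)$ is the universal unital C*-algebra with generators $p_{i,j}$, $i,j=1,\dots,n^2$, and relations making $\rho_0:M_X\to M_X\otimes\mathcal{O}(G_1,G_2)$, $\rho_0(f_i)=\sum_jf_j\otimes p_{j,i}$, a unital $*$-homomorphism with $(A_2\otimes\mathrm{id})\circ\rho_0=\rho_0\circ A_1$ (the $A_r$ regarded as maps on $M_X$ via $\Lambda$) and $(\mathrm{tr}\otimes\mathrm{id})\circ\rho_0=\mathrm{tr}(\cdot)1$. $G_1\simeq_{\rm qc}G_2$ means that $\mathcal{O}(G_1,G_2)$ admits a tracial state. The space $\tilde{\mathcal{U}}_G$: let $S'=\mathrm{span}\{aAb:a,b\in M_X\}\subseteq\mathcal{B}(L^2(M_X))$. Let $\Psi:\mathcal{B}(L^2(M_X))\to M_X\otimes M_X$ be the linear bijection with $\Psi(\Theta_{\Lambda(x),\Lambda(y)})=x^*\otimes y$, where $\Theta_{\Lambda(x),\Lambda(y)}(\xi)=\langle\Lambda(x),\xi\rangle\Lambda(y)$. Let $\partial:L^2(M_X)\to L^2(M_X)$ be linear with $\partial(\Lambda(f_j^* ))=\Lambda(f_j)$. Then $\tilde{\mathcal{U}}_G=(\partial\otimes1)\big((\Lambda\otimes\Lambda)(\Psi(S'))\big)\subseteq L^2(M_X)\otimes L^2(M_X)$. (It is a quantum pseudo-graph: it is orthogonal to $\sum_i\Lambda(f_i)\otimes\Lambda(f_i)$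 and invariant under $\mathfrak{d}\circ\mathfrak{f}$, $\mathfrak{f}$ the flip and $\mathfrak{d}$ the conjugate-linear map fixing each $\Lambda(f_i)\otimes\Lambda(f_j)$.) Correlations: with $N=n^2$, a quantum channel $\Gamma:M_N\otimes M_N\to M_N\otimes M_N$ is a QNS correlation if $(\mathrm{Tr}\otimes\mathrm{id})\Gamma(\rho_1\otimes\rho_2)=0$ whenever $\mathrm{Tr}\rho_1=0$ and $(\mathrm{id}\otimes\mathrm{Tr})\Gamma(\rho_1\otimes\rho_2)=0$ whenever $\mathrm{Tr}\rho_2=0$; a QNS bicorrelation if moreover $\Gamma(I)=I$ and $\Gamma^*$ is a QNS correlation, where $\mathrm{Tr}(\Gamma^*(\omega)\rho^{\rm t})=\mathrm{Tr}(\omega\Gamma(\rho)^{\rm t})$; concurrent if $\Gamma(J)=J$, $J=\frac1N\sum_{i,j}\epsilon_{i,j}\otimes\epsilon_{i,j}$; quantum commuting if $\Gamma(\epsilon_{i,i'}\otimes\epsilon_{j,j'})=\sum\langle E_{i,i',k,k'}F_{j,j',l,l'}\xi,\xi\rangle\epsilon_{k,k'}\otimes\epsilon_{l,l'}$ for a unit vector $\xi$ in a Hilbert space $H$ and bistochastic operator matrices $E,F$ on $H$ with the entries of $E$ commuting with those of $F$ (bistochastic: $E=\sum\epsilon_{i,i'}\otimes\epsilon_{k,k'}\otimes E_{i,i',k,k'}\geq0$, $\sum_kE_{i,i',k,k}=\delta_{i,i'}I$, $\sum_iE_{i,i,k,k'}=\delta_{k,k'}I$). $\mathcal{Q}_{\rm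 qc}^{\rm bic}$: concurrent quantum commuting QNS bicorrelations. $\Gamma$ is a perfect strategy for $\mathcal{W}_1\to\mathcal{W}_2$ if, for positive $\omega$, $\omega=P_1\omega P_1$ implies $\Gamma(\omega)=P_2\Gamma(\omega)P_2$, $P_r$ the projection onto $\mathcal{W}_r$. The correlation $\Gamma$ associated with $U$ implements a qc-pseudo-isomorphism between $\mathcal{W}_1$ and $\mathcal{W}_2$ if $\Gamma\in\mathcal{Q}_{\rm qc}^{\rm bic}$, $\Gamma$ is a perfect strategy for $\mathcal{W}_1\to\mathcal{W}_2$, and $$\tilde\Gamma(\epsilon_{k,k'}\otimes\epsilon_{l,l'})=\sum_{i,i',j,j'}\tilde\tau(u_{l,j}^*u_{k,i}u_{k',i'}^*u_{l',j'})\,\epsilon_{i,i'}\otimes\epsilon_{j,j'}$$ is a perfect strategy for $\mathcal{W}_2\to\mathcal{W}_1$. $U$ is the unitary implementation of a $*$-homomorphism $\rho:M_X\to M_X\otimes\mathcal{N}$ if $U(\Lambda(b)\otimes\xi)=(\pi\otimes\mathrm{id})(\rho(b))(\Lambda(1)\otimes\xi)$ for all $b\in M_X$, $\xi\in K$. $\rho$ is trace-preserving if $(\mathrm{tr}\otimes\mathrm{id})(\rho(b))=\mathrm{tr}(b)I$ for all $b\in M_X$. *)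

theory Defs
  imports "HOL-Analysis.Analysis" "HOL-Library.Poly_Mapping"
begin

section \<open>Complex Hilbert spaces and von Neumann algebras\<close>

text \<open>
  Norm, topology and completeness are those of the underlying real Hilbert space; the complex
  inner product is linear in the second variable.
\<close>

class complex_hilbert = real_inner + complete_space +
  fixes scaleC :: "complex \<Rightarrow> 'a \<Rightarrow> 'a" (infixr \<open>*\<^sub>C\<close> 75)
    and cinner :: "'a \<Rightarrow> 'a \<Rightarrow> complex"
  assumes scaleC_add_right: "c *\<^sub>C (x + y) = c *\<^sub>C x + c *\<^sub>C y"
    and scaleC_add_left: "(c + d) *\<^sub>C x = c *\<^sub>C x + d *\<^sub>C x"
    and scaleC_scaleC: "c *\<^sub>C d *\<^sub>C x = (c * d) *\<^sub>C x"
    and scaleC_of_real: "complex_of_real r *\<^sub>C x = r *\<^sub>R x"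
    and cinner_commute: "cinner y x = cnj (cinner x y)"
    and cinner_add_right: "cinner x (y + z) = cinner x y + cinner x z"
    and cinner_scaleC_right: "cinner x (c *\<^sub>C y) = c * cinner x y"
    and inner_eq_Re_cinner: "inner x y = Re (cinner x y)"

instantiation complex :: complex_hilbert
begin
definition scaleC_complex :: "complex \<Rightarrow> complex \<Rightarrow> complex" where
  "scaleC_complex c x = c * x"
definition cinner_complex :: "complex \<Rightarrow> complex \<Rightarrow> complex" where
  "cinner_complex x y = cnj x * y"
instance
  by standard
     (auto simp: scaleC_complex_def cinner_complex_def algebra_simps scaleR_conv_of_real
        inner_complex_def)
end

text \<open>
  Bounded operators are the complex-linear elements of the library's type of bounded real-linear
  maps; sums and the operator norm are those of that type.
\<close>

type_synonym 'k operator = "'k \<Rightarrow>\<^sub>L 'k"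

definition bounded_ops :: "'k::complex_hilbert operator set" where
  "bounded_ops = {T. \<forall>c x. blinfun_apply T (c *\<^sub>C x) = c *\<^sub>C blinfun_apply T x}"

definition op_scale :: "complex \<Rightarrow> 'k::complex_hilbert operator \<Rightarrow> 'k operator" where
  "op_scale c T = Blinfun (\<lambda>x. c *\<^sub>C blinfun_apply T x)"

definition is_op_adj :: "'k::complex_hilbert operator \<Rightarrow> 'k operator \<Rightarrow> bool" where
  "is_op_adj S T \<longleftrightarrow>
     (\<forall>x y. cinner (blinfun_apply S x) y = cinner x (blinfun_apply T y))"

definition op_adj :: "'k::complex_hilbert operator \<Rightarrow> 'k operator" where
  "op_adj T = (THE S. is_op_adj S T)"

definition commutant :: "'k::complex_hilbert operator set \<Rightarrow> 'k operator set" where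
  "commutant M = {T \<in> bounded_ops. \<forall>S\<in>M. T o\<^sub>L S = S o\<^sub>L T}"

definition von_neumann_algebra :: "'k::complex_hilbert operator set \<Rightarrow> bool" where
  "von_neumann_algebra N \<longleftrightarrow>
     N \<subseteq> bounded_ops \<and>
     (\<forall>T\<in>N. \<exists>S\<in>N. is_op_adj S T) \<and>
     commutant (commutant N) = N"

text \<open>
  Only values on \<open>N\<close> matter. No normalisation is imposed: for the
  correlations below, trace preservation already forces \<open>\<tau> 1 = 1\<close>.
\<close>

definition faithful_trace ::
  "'k::complex_hilbert operator set \<Rightarrow> ('k operator \<Rightarrow> complex) \<Rightarrow> bool" where
  "faithful_trace N \<tau> \<longleftrightarrow>
     (\<forall>S\<in>N. \<forall>T\<in>N. \<tau> (S + T) = \<tau> S + \<tau> T) \<and>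
     (\<forall>c. \<forall>T\<in>N. \<tau> (op_scale c T) = c * \<tau> T) \<and>
     (\<forall>T\<in>N. \<tau> (op_adj T o\<^sub>L T) \<in> \<real>\<^sub>\<ge>\<^sub>0) \<and>
     (\<forall>S\<in>N. \<forall>T\<in>N. \<tau> (S o\<^sub>L T) = \<tau> (T o\<^sub>L S)) \<and>
     (\<forall>T\<in>N. \<tau> (op_adj T o\<^sub>L T) = 0 \<longrightarrow> T = 0)"


section \<open>The Hilbert space of square matrices\<close>

text \<open>
  \<open>L\<^sup>2(M\<^sub>X)\<close> is the space of complex matrices indexed by a finite type, \<open>\<Lambda>\<close> being
  the identity. Via the Kronecker product, \<open>L\<^sup>2(M\<^sub>X) \<otimes> L\<^sup>2(M\<^sub>Y)\<close> is
  \<open>L\<^sup>2\<close> of the matrices over \<open>'x \<times> 'y\<close> (the normalised traces match), and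
  the scalars are the matrices over \<open>unit\<close>.
\<close>

definition cscale :: "complex \<Rightarrow> complex^'n^'m \<Rightarrow> complex^'n^'m" (infixr \<open>*\<^sub>m\<close> 75) where
  "c *\<^sub>m a = (\<chi> i j. c * a$i$j)"

definition mat_adj :: "complex^'n^'m \<Rightarrow> complex^'m^'n" where
  "mat_adj a = (\<chi> i j. cnj (a$j$i))"

definition ntr :: "complex^'n^'n \<Rightarrow> complex" where
  "ntr a = trace a / of_nat CARD('n)"

definition l2 :: "complex^'n^'n \<Rightarrow> complex^'n^'n \<Rightarrow> complex" where
  "l2 a b = ntr (mat_adj a ** b)"

definition matunit :: "'m \<Rightarrow> 'n \<Rightarrow> complex^'n^'m" where
  "matunit i j = (\<chi> k l. if k = i \<and> l = j then 1 else 0)"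

definition kron :: "complex^'b^'a \<Rightarrow> complex^'d^'c \<Rightarrow> complex^('b \<times> 'd)^('a \<times> 'c)" where
  "kron a b = (\<chi> p q. a$fst p$fst q * b$snd p$snd q)"

abbreviation mat_linear :: "(complex^'n^'n \<Rightarrow> complex^'m^'m) \<Rightarrow> bool" where
  "mat_linear \<equiv> Vector_Spaces.linear cscale cscale"

definition tensor_map ::
  "(complex^'a^'a \<Rightarrow> complex^'c^'c) \<Rightarrow> (complex^'b^'b \<Rightarrow> complex^'d^'d) \<Rightarrow>
     complex^('a \<times> 'b)^('a \<times> 'b) \<Rightarrow> complex^('c \<times> 'd)^('c \<times> 'd)" where
  "tensor_map S T z =
     (\<Sum>a\<in>UNIV. \<Sum>a'\<in>UNIV. \<Sum>b\<in>UNIV. \<Sum>b'\<in>UNIV.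
        z$(a, b)$(a', b') *\<^sub>m kron (S (matunit a a')) (T (matunit b b')))"

definition hilbert_adj ::
  "(complex^'a^'a \<Rightarrow> complex^'b^'b) \<Rightarrow> complex^'b^'b \<Rightarrow> complex^'a^'a" where
  "hilbert_adj T = (THE S. \<forall>x y. l2 (S x) y = l2 x (T y))"

text \<open>The linear map with \<open>kron a b \<mapsto> a ** b\<close>.\<close>

definition mult_map :: "complex^('x::finite \<times> 'x)^('x \<times> 'x) \<Rightarrow> complex^'x^'x" where
  "mult_map z = (\<chi> i j. \<Sum>k\<in>UNIV. z$(i, k)$(k, j))"

definition unit_map :: "complex^unit^unit \<Rightarrow> complex^'x^'x" where
  "unit_map c = c$()$() *\<^sub>m mat 1"

text \<open>The canonical identifications \<open>H \<rightarrow> \<complex> \<otimes> H\<close>,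
  \<open>H \<otimes> \<complex> \<rightarrow> H\<close>
  and \<open>(H \<otimes> H) \<otimes> H \<rightarrow> H \<otimes> (H \<otimes> H)\<close>.\<close>

definition left_unitor :: "complex^'x^'x \<Rightarrow> complex^(unit \<times> 'x)^(unit \<times> 'x)" where
  "left_unitor a = (\<chi> p q. a$snd p$snd q)"

definition right_unitor :: "complex^('x \<times> unit)^('x \<times> unit) \<Rightarrow> complex^'x^'x" where
  "right_unitor z = (\<chi> i j. z$(i, ())$(j, ()))"

definition associator ::
  "complex^(('x::finite \<times> 'y::finite) \<times> 'z::finite)^(('x \<times> 'y) \<times> 'z) \<Rightarrow> complex^('x \<times> 'y \<times> 'z)^('x \<times> 'y \<times> 'z)" where
  "associator z =
     (\<chi> p q. z$((fst p, fst (snd p)), snd (snd p))$((fst q, fst (snd q)), snd (snd q)))"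


section \<open>Algebraic quantum graphs\<close>

text \<open>A quantum graph \<open>(M\<^sub>X, tr, A)\<close> is given by the index type \<open>'x\<close> and \<open>A\<close>.\<close>

definition quantum_adjacency :: "(complex^'x^'x \<Rightarrow> complex^'x^'x) \<Rightarrow> bool" where
  "quantum_adjacency A \<longleftrightarrow>
     mat_linear A \<and>
     (\<forall>a b. l2 (A a) b = l2 a (A b)) \<and>
     mult_map \<circ> tensor_map A A \<circ> hilbert_adj mult_map = A \<and>
     right_unitor \<circ> tensor_map id (hilbert_adj unit_map \<circ> mult_map)
       \<circ> associator \<circ> tensor_map (tensor_map id A) id
       \<circ> tensor_map (hilbert_adj mult_map \<circ> unit_map) id \<circ> left_unitor = A \<and>
     mult_map \<circ> tensor_map A id \<circ> hilbert_adj mult_map = (\<lambda>_. 0)"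

definition onb :: "('i::finite \<Rightarrow> complex^'x^'x) \<Rightarrow> bool" where
  "onb f \<longleftrightarrow>
     (\<forall>i j. l2 (f i) (f j) = (if i = j then 1 else 0)) \<and>
     (\<forall>b. \<exists>c. b = (\<Sum>i\<in>UNIV. c i *\<^sub>m f i))"

definition bimodule_span ::
  "(complex^'x^'x \<Rightarrow> complex^'x^'x) \<Rightarrow> (complex^'x^'x \<Rightarrow> complex^'x^'x) set" where
  "bimodule_span A =
     {T. \<exists>(r::nat) c a b. T = (\<lambda>\<xi>. \<Sum>s<r. c s *\<^sub>m (a s ** A (b s ** \<xi>)))}"

definition rank_one :: "complex^'x^'x \<Rightarrow> complex^'x^'x \<Rightarrow> complex^'x^'x \<Rightarrow> complex^'x^'x" where
  "rank_one x y \<xi> = l2 x \<xi> *\<^sub>m y"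

text \<open>The linear map with \<open>rank_one x y \<mapsto> kron (mat_adj x) y\<close>, evaluated through an
  arbitrary decomposition into rank-one operators (all of them give the same value).\<close>

definition Psi :: "(complex^'x^'x \<Rightarrow> complex^'x^'x) \<Rightarrow> complex^('x \<times> 'x)^('x \<times> 'x)" where
  "Psi T = (THE z. \<exists>(r::nat) x y.
     T = (\<lambda>\<xi>. \<Sum>s<r. rank_one (x s) (y s) \<xi>) \<and> z = (\<Sum>s<r. kron (mat_adj (x s)) (y s)))"

definition partial_map :: "('i \<Rightarrow> complex^'x^'x) \<Rightarrow> complex^'x^'x \<Rightarrow> complex^'x^'x" where
  "partial_map f = (THE D. mat_linear D \<and> (\<forall>j. D (mat_adj (f j)) = f j))"

definition U_tilde ::
  "('i \<Rightarrow> complex^'x^'x) \<Rightarrow> (complex^'x^'x \<Rightarrow> complex^'x^'x) \<Rightarrow>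
     (complex^('x \<times> 'x)^('x \<times> 'x)) set" where
  "U_tilde f A = tensor_map (partial_map f) id ` Psi ` bimodule_span A"

text \<open>Coordinates with respect to the orthonormal basis \<open>kron (f i) (f j)\<close>.\<close>

definition coords2 ::
  "('i::finite \<Rightarrow> complex^'x^'x) \<Rightarrow> complex^('x \<times> 'x)^('x \<times> 'x) \<Rightarrow> complex^('i \<times> 'i)" where
  "coords2 f z = (\<chi> p. l2 (kron (f (fst p)) (f (snd p))) z)"


section \<open>Operators on the tensor product with a Hilbert space\<close>

text \<open>
  \<open>L\<^sup>2(M\<^sub>X) \<otimes> K\<close> is the space of matrices with entries in \<open>K\<close>, and
  \<open>M\<^sub>X \<otimes> N\<close> the matrices with entries in \<open>N\<close>.
\<close>

definition tens_vec :: "complex^'x^'x \<Rightarrow> 'k::complex_hilbert \<Rightarrow> 'k^'x^'x" where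
  "tens_vec a \<xi> = (\<chi> x y. a$x$y *\<^sub>C \<xi>)"

text \<open>The \<open>K\<close>-valued coefficient of \<open>v\<close> at \<open>a\<close>, i.e.
  \<open>b \<otimes> \<xi> \<mapsto> l2 a b *\<^sub>C \<xi>\<close>.\<close>

definition coeff :: "complex^'x^'x \<Rightarrow> 'k::complex_hilbert^'x^'x \<Rightarrow> 'k" where
  "coeff a v = (\<Sum>x\<in>UNIV. \<Sum>y\<in>UNIV. (cnj (a$x$y) / of_nat CARD('x)) *\<^sub>C v$x$y)"

definition matrix_op ::
  "('i::finite \<Rightarrow> complex^'x^'x) \<Rightarrow> ('i \<Rightarrow> 'i \<Rightarrow> 'k::complex_hilbert operator) \<Rightarrow>
     'k^'x^'x \<Rightarrow> 'k^'x^'x" where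
  "matrix_op f u v =
     (\<Sum>i\<in>UNIV. \<Sum>j\<in>UNIV. tens_vec (f j) (blinfun_apply (u j i) (coeff (f i) v)))"

definition amplify ::
  "(complex^'x^'x \<Rightarrow> complex^'x^'x) \<Rightarrow> 'k::complex_hilbert^'x^'x \<Rightarrow> 'k^'x^'x" where
  "amplify A v = (\<Sum>x\<in>UNIV. \<Sum>y\<in>UNIV. tens_vec (A (matunit x y)) (v$x$y))"

definition unitary_entries :: "('i::finite \<Rightarrow> 'i \<Rightarrow> 'k::complex_hilbert operator) \<Rightarrow> bool" where
  "unitary_entries u \<longleftrightarrow>
     (\<forall>i j. (\<Sum>k\<in>UNIV. op_adj (u k i) o\<^sub>L u k j) = (if i = j then id_blinfun else 0)) \<and>
     (\<forall>i j. (\<Sum>k\<in>UNIV. u i k o\<^sub>L op_adj (u j k)) = (if i = j then id_blinfun else 0))"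

definition bi_unitary :: "('i::finite \<Rightarrow> 'i \<Rightarrow> 'k::complex_hilbert operator) \<Rightarrow> bool" where
  "bi_unitary u \<longleftrightarrow> unitary_entries u \<and> unitary_entries (\<lambda>i j. u j i)"

definition star_hom_into ::
  "'k::complex_hilbert operator set \<Rightarrow> (complex^'x^'x \<Rightarrow> ('k operator)^'x^'x) \<Rightarrow> bool" where
  "star_hom_into N \<rho> \<longleftrightarrow>
     (\<forall>a x y. \<rho> a $x$y \<in> N) \<and>
     (\<forall>a b. \<rho> (a + b) = \<rho> a + \<rho> b) \<and>
     (\<forall>c a x y. \<rho> (c *\<^sub>m a) $x$y = op_scale c (\<rho> a $x$y)) \<and>
     (\<forall>a b x y. \<rho> (a ** b) $x$y = (\<Sum>z\<in>UNIV. \<rho> a $x$z o\<^sub>L \<rho> b $z$y)) \<and>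
     (\<forall>a x y. \<rho> (mat_adj a) $x$y = op_adj (\<rho> a $y$x))"

definition trace_preserving ::
  "(complex^'x^'x \<Rightarrow> ('k::complex_hilbert operator)^'x^'x) \<Rightarrow> bool" where
  "trace_preserving \<rho> \<longleftrightarrow>
     (\<forall>b. (1 / of_nat CARD('x)) *\<^sub>R (\<Sum>x\<in>UNIV. \<rho> b $x$x) = op_scale (ntr b) id_blinfun)"

definition left_mult_op :: "('k::complex_hilbert operator)^'x^'x \<Rightarrow> 'k^'x^'x \<Rightarrow> 'k^'x^'x" where
  "left_mult_op T v = (\<chi> x y. \<Sum>z\<in>UNIV. blinfun_apply (T$x$z) (v$z$y))"

definition unitary_implementation ::
  "('i::finite \<Rightarrow> complex^'x^'x) \<Rightarrow> ('i \<Rightarrow> 'i \<Rightarrow> 'k::complex_hilbert operator) \<Rightarrow>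
     (complex^'x^'x \<Rightarrow> ('k operator)^'x^'x) \<Rightarrow> bool" where
  "unitary_implementation f u \<rho> \<longleftrightarrow>
     (\<forall>b \<xi>. matrix_op f u (tens_vec b \<xi>) = left_mult_op (\<rho> b) (tens_vec (mat 1) \<xi>))"


section \<open>QNS correlations\<close>

text \<open>
  \<open>M\<^sub>N\<close> is the space of matrices over \<open>'i\<close>, and \<open>M\<^sub>N \<otimes> M\<^sub>N\<close> that
  of matrices over \<open>'i \<times> 'i\<close>.
\<close>

type_synonym 'i bimat = "complex^('i \<times> 'i)^('i \<times> 'i)"

definition psd :: "complex^'n^'n \<Rightarrow> bool" where
  "psd \<omega> \<longleftrightarrow>
     (\<forall>v. (\<Sum>p\<in>UNIV. \<Sum>q\<in>UNIV. cnj (v$p) * \<omega>$p$q * v$q) \<in> \<real>\<^sub>\<ge>\<^sub>0)"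

text \<open>Positivity of the block matrix \<open>Z\<close>, an element of \<open>M\<^sub>k \<otimes> M\<^sub>n\<close>; the size \<open>k\<close>
  ranges over all natural numbers in the definition of complete positivity.\<close>

definition block_psd :: "nat \<Rightarrow> (nat \<Rightarrow> nat \<Rightarrow> complex^'n^'n) \<Rightarrow> bool" where
  "block_psd k Z \<longleftrightarrow>
     (\<forall>v :: nat \<Rightarrow> complex^'n.
        (\<Sum>a<k. \<Sum>b<k. \<Sum>p\<in>UNIV. \<Sum>q\<in>UNIV. cnj (v a$p) * Z a b$p$q * v b$q) \<in> \<real>\<^sub>\<ge>\<^sub>0)"

definition quantum_channel :: "(complex^'n^'n \<Rightarrow> complex^'n^'n) \<Rightarrow> bool" where
  "quantum_channel \<Gamma> \<longleftrightarrow>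
     mat_linear \<Gamma> \<and>
     (\<forall>k Z. block_psd k Z \<longrightarrow> block_psd k (\<lambda>a b. \<Gamma> (Z a b))) \<and>
     (\<forall>\<omega>. trace (\<Gamma> \<omega>) = trace \<omega>)"

definition trace_left :: "'i::finite bimat \<Rightarrow> complex^'i^'i" where
  "trace_left \<omega> = (\<chi> j j'. \<Sum>i\<in>UNIV. \<omega>$(i, j)$(i, j'))"

definition trace_right :: "'i::finite bimat \<Rightarrow> complex^'i^'i" where
  "trace_right \<omega> = (\<chi> i i'. \<Sum>j\<in>UNIV. \<omega>$(i, j)$(i', j))"

definition qns_correlation :: "('i::finite bimat \<Rightarrow> 'i bimat) \<Rightarrow> bool" where
  "qns_correlation \<Gamma> \<longleftrightarrow>
     quantum_channel \<Gamma> \<and>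
     (\<forall>\<rho>\<^sub>1 \<rho>\<^sub>2. trace \<rho>\<^sub>1 = 0 \<longrightarrow> trace_left (\<Gamma> (kron \<rho>\<^sub>1 \<rho>\<^sub>2)) = 0) \<and>
     (\<forall>\<rho>\<^sub>1 \<rho>\<^sub>2. trace \<rho>\<^sub>2 = 0 \<longrightarrow> trace_right (\<Gamma> (kron \<rho>\<^sub>1 \<rho>\<^sub>2)) = 0)"

definition channel_dual :: "('i::finite bimat \<Rightarrow> 'i bimat) \<Rightarrow> 'i bimat \<Rightarrow> 'i bimat" where
  "channel_dual \<Gamma> =
     (THE \<Delta>. \<forall>\<omega> \<rho>. trace (\<Delta> \<omega> ** transpose \<rho>) = trace (\<omega> ** transpose (\<Gamma> \<rho>)))"

definition qns_bicorrelation :: "('i::finite bimat \<Rightarrow> 'i bimat) \<Rightarrow> bool" where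
  "qns_bicorrelation \<Gamma> \<longleftrightarrow>
     qns_correlation \<Gamma> \<and> \<Gamma> (mat 1) = mat 1 \<and> qns_correlation (channel_dual \<Gamma>)"

definition J_state :: "'i::finite bimat" where
  "J_state = (1 / of_nat CARD('i)) *\<^sub>m
     (\<Sum>i\<in>UNIV. \<Sum>j\<in>UNIV. kron (matunit i j) (matunit i j))"

definition concurrent :: "('i::finite bimat \<Rightarrow> 'i bimat) \<Rightarrow> bool" where
  "concurrent \<Gamma> \<longleftrightarrow> \<Gamma> J_state = J_state"

text \<open>\<open>E i i' k k'\<close> is the coefficient of
  \<open>\<epsilon>\<^bsub>i,i'\<^esub> \<otimes> \<epsilon>\<^bsub>k,k'\<^esub>\<close>.\<close>

definition bistochastic ::
  "('i::finite \<Rightarrow> 'i \<Rightarrow> 'i \<Rightarrow> 'i \<Rightarrow> 'h::complex_hilbert operator) \<Rightarrow> bool" where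
  "bistochastic E \<longleftrightarrow>
     (\<forall>i i' k k'. E i i' k k' \<in> bounded_ops) \<and>
     (\<forall>v. (\<Sum>i\<in>UNIV. \<Sum>i'\<in>UNIV. \<Sum>k\<in>UNIV. \<Sum>k'\<in>UNIV.
        cinner (v i k) (blinfun_apply (E i i' k k') (v i' k'))) \<in> \<real>\<^sub>\<ge>\<^sub>0) \<and>
     (\<forall>i i'. (\<Sum>k\<in>UNIV. E i i' k k) = (if i = i' then id_blinfun else 0)) \<and>
     (\<forall>k k'. (\<Sum>i\<in>UNIV. E i i k k') = (if k = k' then id_blinfun else 0))"

text \<open>
  Existential quantification over Hilbert spaces is split off: the Hilbert space is the type \<open>'h\<close>.
  A theorem which assumes this predicate with \<open>'h\<close> free holds for every Hilbert space, i.e. under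
  the assumption that some Hilbert space carries such data. The vector functional
  of \<open>\<xi>\<close> is taken linear in the operator.
\<close>

definition quantum_commuting ::
  "'h::complex_hilbert itself \<Rightarrow> ('i::finite bimat \<Rightarrow> 'i bimat) \<Rightarrow> bool" where
  "quantum_commuting _ \<Gamma> \<longleftrightarrow>
     (\<exists>(\<xi>::'h) E F. norm \<xi> = 1 \<and> bistochastic E \<and> bistochastic F \<and>
        (\<forall>i i' k k' j j' l l'. E i i' k k' o\<^sub>L F j j' l l' = F j j' l l' o\<^sub>L E i i' k k') \<and>
        (\<forall>i i' j j'. \<Gamma> (kron (matunit i i') (matunit j j')) =
           (\<Sum>k\<in>UNIV. \<Sum>k'\<in>UNIV. \<Sum>l\<in>UNIV. \<Sum>l'\<in>UNIV.
              cinner \<xi> (blinfun_apply (E i i' k k' o\<^sub>L F j j' l l') \<xi>)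
                *\<^sub>m kron (matunit k k') (matunit l l'))))"

definition Q_qc_bic :: "'h::complex_hilbert itself \<Rightarrow> ('i::finite bimat \<Rightarrow> 'i bimat) set" where
  "Q_qc_bic h = {\<Gamma>. qns_bicorrelation \<Gamma> \<and> concurrent \<Gamma> \<and> quantum_commuting h \<Gamma>}"

definition proj_onto :: "(complex^'n) set \<Rightarrow> complex^'n^'n" where
  "proj_onto W = (THE P. mat_adj P = P \<and> P ** P = P \<and> range ((*v) P) = W)"

definition perfect_strategy ::
  "('i::finite bimat \<Rightarrow> 'i bimat) \<Rightarrow> (complex^('i \<times> 'i)) set \<Rightarrow> (complex^('i \<times> 'i)) set \<Rightarrow> bool"
  where
  "perfect_strategy \<Gamma> W\<^sub>1 W\<^sub>2 \<longleftrightarrow>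
     (\<forall>\<omega>. psd \<omega> \<longrightarrow> \<omega> = proj_onto W\<^sub>1 ** \<omega> ** proj_onto W\<^sub>1 \<longrightarrow>
        \<Gamma> \<omega> = proj_onto W\<^sub>2 ** \<Gamma> \<omega> ** proj_onto W\<^sub>2)"

definition lift_bimat :: "('i \<Rightarrow> 'i \<Rightarrow> 'i \<Rightarrow> 'i \<Rightarrow> 'i bimat) \<Rightarrow> 'i::finite bimat \<Rightarrow> 'i bimat" where
  "lift_bimat g \<omega> =
     (\<Sum>i\<in>UNIV. \<Sum>i'\<in>UNIV. \<Sum>j\<in>UNIV. \<Sum>j'\<in>UNIV. \<omega>$(i, j)$(i', j') *\<^sub>m g i i' j j')"

definition Gamma ::
  "('k::complex_hilbert operator \<Rightarrow> complex) \<Rightarrow> ('i::finite \<Rightarrow> 'i \<Rightarrow> 'k operator) \<Rightarrow>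
     'i bimat \<Rightarrow> 'i bimat" where
  "Gamma \<tau> u = lift_bimat (\<lambda>i i' j j'.
     \<Sum>k\<in>UNIV. \<Sum>k'\<in>UNIV. \<Sum>l\<in>UNIV. \<Sum>l'\<in>UNIV.
       \<tau> (op_adj (u k i) o\<^sub>L u k' i' o\<^sub>L op_adj (u l' j') o\<^sub>L u l j)
         *\<^sub>m kron (matunit k k') (matunit l l'))"

definition Gamma_tilde ::
  "('k::complex_hilbert operator \<Rightarrow> complex) \<Rightarrow> ('i::finite \<Rightarrow> 'i \<Rightarrow> 'k operator) \<Rightarrow>
     'i bimat \<Rightarrow> 'i bimat" where
  "Gamma_tilde \<tau> u = lift_bimat (\<lambda>k k' l l'.
     \<Sum>i\<in>UNIV. \<Sum>i'\<in>UNIV. \<Sum>j\<in>UNIV. \<Sum>j'\<in>UNIV.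
       \<tau> (op_adj (u l j) o\<^sub>L u k i o\<^sub>L op_adj (u k' i') o\<^sub>L u l' j')
         *\<^sub>m kron (matunit i i') (matunit j j'))"

definition implements_qc_pseudo_iso ::
  "'h::complex_hilbert itself \<Rightarrow> ('k::complex_hilbert operator \<Rightarrow> complex) \<Rightarrow>
     ('i::finite \<Rightarrow> 'i \<Rightarrow> 'k operator) \<Rightarrow>
     (complex^('i \<times> 'i)) set \<Rightarrow> (complex^('i \<times> 'i)) set \<Rightarrow> bool" where
  "implements_qc_pseudo_iso h \<tau> u W\<^sub>1 W\<^sub>2 \<longleftrightarrow>
     Gamma \<tau> u \<in> Q_qc_bic h \<and>
     perfect_strategy (Gamma \<tau> u) W\<^sub>1 W\<^sub>2 \<and>
     perfect_strategy (Gamma_tilde \<tau> u) W\<^sub>2 W\<^sub>1"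


section \<open>Universal unital C*-algebras\<close>

text \<open>
  The free unital *-algebra on \<open>'g\<close> is the monoid algebra over the complex numbers of the free
  monoid on the letters \<open>(g, False)\<close> for \<open>g\<close> and \<open>(g, True)\<close> for its adjoint; the monoid is
  written additively, as the library's convolution product requires.
\<close>

datatype 'a word = Word (letters: "'a list")

instantiation word :: (type) monoid_add
begin
definition zero_word :: "'a word" where "zero_word = Word []"
definition plus_word :: "'a word \<Rightarrow> 'a word \<Rightarrow> 'a word" where
  "plus_word v w = Word (letters v @ letters w)"
instance
  by standard (auto simp: zero_word_def plus_word_def)
end

type_synonym 'g free_alg = "('g \<times> bool) word \<Rightarrow>\<^sub>0 complex"

definition fconst :: "complex \<Rightarrow> 'g free_alg" where
  "fconst c = Poly_Mapping.single 0 c"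

definition fgen :: "'g \<Rightarrow> 'g free_alg" where
  "fgen g = Poly_Mapping.single (Word [(g, False)]) 1"

definition word_star :: "('g \<times> bool) word \<Rightarrow> ('g \<times> bool) word" where
  "word_star w = Word (rev (map (\<lambda>(g, s). (g, \<not> s)) (letters w)))"

definition fstar :: "'g free_alg \<Rightarrow> 'g free_alg" where
  "fstar a = (\<Sum>w\<in>Poly_Mapping.keys a.
     Poly_Mapping.single (word_star w) (cnj (Poly_Mapping.lookup a w)))"

definition cstar_seminorm :: "('g free_alg \<Rightarrow> real) \<Rightarrow> bool" where
  "cstar_seminorm q \<longleftrightarrow>
     (\<forall>a. 0 \<le> q a) \<and>
     (\<forall>a b. q (a + b) \<le> q a + q b) \<and>
     (\<forall>c a. q (fconst c * a) = cmod c * q a) \<and>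
     (\<forall>a b. q (a * b) \<le> q a * q b) \<and>
     (\<forall>a. q (fstar a * a) = (q a)\<^sup>2)"

text \<open>
  \<open>R\<close> is a set of relators, elements that are required to vanish. The universal C*-algebra is the
  separated completion of the free *-algebra under the largest C*-seminorm vanishing on \<open>R\<close>; it
  exists as soon as \<open>univ_norm R\<close> is finite on the generators. The points of the completion are
  classes of Cauchy sequences.
\<close>

definition univ_norm :: "'g free_alg set \<Rightarrow> 'g free_alg \<Rightarrow> ennreal" where
  "univ_norm R a = (SUP q\<in>{q. cstar_seminorm q \<and> (\<forall>r\<in>R. q r = 0)}. ennreal (q a))"

definition univ_Cauchy :: "'g free_alg set \<Rightarrow> (nat \<Rightarrow> 'g free_alg) \<Rightarrow> bool" where
  "univ_Cauchy R x \<longleftrightarrow>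
     (\<forall>e>0. \<exists>M. \<forall>m\<ge>M. \<forall>n\<ge>M. univ_norm R (x m - x n) < ennreal e)"

definition univ_class :: "'g free_alg set \<Rightarrow> (nat \<Rightarrow> 'g free_alg) \<Rightarrow> (nat \<Rightarrow> 'g free_alg) set" where
  "univ_class R x = {y. (\<lambda>n. univ_norm R (x n - y n)) \<longlonglongrightarrow> 0}"

record 'a star_alg =
  alg_carrier :: "'a set"
  alg_add :: "'a \<Rightarrow> 'a \<Rightarrow> 'a"
  alg_scale :: "complex \<Rightarrow> 'a \<Rightarrow> 'a"
  alg_mult :: "'a \<Rightarrow> 'a \<Rightarrow> 'a"
  alg_one :: 'a
  alg_star :: "'a \<Rightarrow> 'a"

definition universal_cstar :: "'g free_alg set \<Rightarrow> (nat \<Rightarrow> 'g free_alg) set star_alg" where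
  "universal_cstar R =
     \<lparr> alg_carrier = univ_class R ` {x. univ_Cauchy R x},
       alg_add = (\<lambda>X Y. \<Union>x\<in>X. \<Union>y\<in>Y. univ_class R (\<lambda>n. x n + y n)),
       alg_scale = (\<lambda>c X. \<Union>x\<in>X. univ_class R (\<lambda>n. fconst c * x n)),
       alg_mult = (\<lambda>X Y. \<Union>x\<in>X. \<Union>y\<in>Y. univ_class R (\<lambda>n. x n * y n)),
       alg_one = univ_class R (\<lambda>n. 1),
       alg_star = (\<lambda>X. \<Union>x\<in>X. univ_class R (\<lambda>n. fstar (x n))) \<rparr>"

text \<open>Positive functionals on C*-algebras are bounded, and have norm 1 iff they map 1 to 1.\<close>

definition tracial_state :: "'a star_alg \<Rightarrow> ('a \<Rightarrow> complex) \<Rightarrow> bool" where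
  "tracial_state B \<phi> \<longleftrightarrow>
     (\<forall>a\<in>alg_carrier B. \<forall>b\<in>alg_carrier B. \<phi> (alg_add B a b) = \<phi> a + \<phi> b) \<and>
     (\<forall>c. \<forall>a\<in>alg_carrier B. \<phi> (alg_scale B c a) = c * \<phi> a) \<and>
     (\<forall>a\<in>alg_carrier B. \<phi> (alg_mult B (alg_star B a) a) \<in> \<real>\<^sub>\<ge>\<^sub>0) \<and>
     \<phi> (alg_one B) = 1 \<and>
     (\<forall>a\<in>alg_carrier B. \<forall>b\<in>alg_carrier B. \<phi> (alg_mult B a b) = \<phi> (alg_mult B b a))"


section \<open>Quantum commuting isomorphism\<close>

text \<open>
  The generator \<open>p\<^bsub>j,i\<^esub>\<close> is \<open>fgen (j, i)\<close>. Elements of \<open>M\<^sub>X \<otimes> B\<close> are matrices with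
  entries in \<open>B\<close>; \<open>rho0 f\<close> is the linear extension of
  \<open>f\<^sub>i \<mapsto> (\<Sum>j. f\<^sub>j \<otimes> p\<^bsub>j,i\<^esub>)\<close>, the expansion of \<open>b\<close> in the orthonormal basis having
  coefficients \<open>l2 (f i) b\<close>.
\<close>

definition rho0 ::
  "('i::finite \<Rightarrow> complex^'x^'x) \<Rightarrow> complex^'x^'x \<Rightarrow> (('i \<times> 'i) free_alg)^'x^'x" where
  "rho0 f b = (\<chi> x y. \<Sum>i\<in>UNIV. \<Sum>j\<in>UNIV.
     fconst (l2 (f i) b) * (fconst (f j$x$y) * fgen (j, i)))"

definition map_left ::
  "(complex^'x^'x \<Rightarrow> complex^'x^'x) \<Rightarrow> ('g free_alg)^'x^'x \<Rightarrow> ('g free_alg)^'x^'x" where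
  "map_left A M = (\<chi> x y. \<Sum>z\<in>UNIV. \<Sum>w\<in>UNIV. fconst (A (matunit z w)$x$y) * M$z$w)"

text \<open>
  In order: \<open>rho0\<close> is multiplicative, *-preserving, unital, intertwines \<open>A\<^sub>1\<close> and \<open>A\<^sub>2\<close>, and
  preserves the trace. These relations give
  \<open>(\<Sum>j. p\<^bsub>j,i\<^esub>\<^sup>* p\<^bsub>j,i\<^esub>) = 1\<close>, so the universal C*-algebra exists.
\<close>

definition iso_relators ::
  "('i::finite \<Rightarrow> complex^'x^'x) \<Rightarrow> (complex^'x^'x \<Rightarrow> complex^'x^'x) \<Rightarrow>
     (complex^'x^'x \<Rightarrow> complex^'x^'x) \<Rightarrow> ('i \<times> 'i) free_alg set" where
  "iso_relators f A\<^sub>1 A\<^sub>2 =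
     {(rho0 f (a ** b) - rho0 f a ** rho0 f b)$x$y | a b x y. True} \<union>
     {rho0 f (mat_adj a)$x$y - fstar (rho0 f a$y$x) | a x y. True} \<union>
     {(rho0 f (mat 1) - mat 1)$x$y | x y. True} \<union>
     {(map_left A\<^sub>2 (rho0 f a) - rho0 f (A\<^sub>1 a))$x$y | a x y. True} \<union>
     {fconst (1 / of_nat CARD('x)) * trace (rho0 f a) - fconst (ntr a) | a. True}"

definition qc_isomorphic ::
  "('i::finite \<Rightarrow> complex^'x^'x) \<Rightarrow> (complex^'x^'x \<Rightarrow> complex^'x^'x) \<Rightarrow>
     (complex^'x^'x \<Rightarrow> complex^'x^'x) \<Rightarrow> bool" where
  "qc_isomorphic f A\<^sub>1 A\<^sub>2 \<longleftrightarrow> (\<exists>\<phi>. tracial_state (universal_cstar (iso_relators f A\<^sub>1 A\<^sub>2)) \<phi>)"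

end

theory Submission
  imports Defs
begin

text \<open>
  Write \<open>a\<^sub>r\<close> for the matrix of \<open>A\<^sub>r\<close> in the basis \<open>f\<close>. The intertwining relation says that
  \<open>Q = U (A\<^sub>1 \<otimes> 1) U\<^sup>*\<close>, a matrix with entries in \<open>N\<close>, is \<open>A\<^sub>2 \<otimes> 1\<close>. It is proved by comparing
  lengths in the Hilbert-Schmidt inner product of operators on \<open>L\<^sup>2(M\<^sub>X)\<close>, extended to matrices over
  \<open>N\<close> by the trace. Let \<open>S\<^sub>r\<close> be the bimodule span of \<open>A\<^sub>r\<close> and \<open>e\<close> the rank-one projection onto
  the vector \<open>1\<close>. Three facts carry the argument.

  \<^item> \<open>A\<^sub>r\<close> is the Hilbert-Schmidt orthogonal projection of \<open>e\<close> onto \<open>S\<^sub>r\<close>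
    (\<open>adjacency_projection\<close>). That \<open>e - A\<close> is orthogonal to every \<open>a A b\<close> reduces to the identity
    \<open>Tr (\<xi> \<mapsto> b A(a A \<xi>)) = tr (a A(b))\<close>, which is the axiom \<open>m(A \<otimes> A)m\<^sup>* = A\<close> for an \<open>A\<close> that
    preserves adjoints; adjoints are preserved because \<open>A\<close> is self-adjoint and satisfies the axiom
    with the two units \<open>\<eta>\<close>.

  \<^item> The correlations \<open>\<Gamma>\<close> and \<open>\<Gamma>~\<close> are given by numbers \<open>\<tau>(S\<^sub>p\<^sup>* S\<^sub>q)\<close>. For \<open>\<zeta>\<close> in the first
    pseudo-graph and \<open>\<eta>\<close> orthogonal to the second, \<open>\<langle>\<eta>, \<Gamma>(\<zeta>\<zeta>\<^sup>*)\<eta>\<rangle>\<close> is therefore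
    \<open>\<tau>(B\<^sup>* B)\<close> for a linear combination \<open>B\<close> of the \<open>S\<^sub>p\<close>; it vanishes for a perfect strategy, and \<open>B = 0\<close>
    since \<open>\<tau>\<close> is faithful (\<open>perfect_strategy_annihilates\<close>). Read in terms of operators, conjugation
    by \<open>U\<close> maps \<open>S\<^sub>1\<close> into \<open>S\<^sub>2 \<otimes> N\<close>, and conjugation by \<open>U\<^sup>*\<close> maps \<open>S\<^sub>2\<close> into \<open>S\<^sub>1 \<otimes> N\<close>.

  \<^item> \<open>U\<close> fixes the vectors \<open>1 \<otimes> \<xi>\<close>, so conjugation by \<open>U\<close> fixes \<open>e\<close>. Indeed \<open>1 - \<rho>(1)\<close> is a
    projection whose trace is \<open>0\<close>, whence \<open>\<rho>(1) = 1\<close> (\<open>hom_unital\<close>).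

  Consequently \<open>\<langle>Q, A\<^sub>2\<rangle> = \<langle>Q, e\<rangle> = \<langle>A\<^sub>1, e\<rangle> = \<parallel>A\<^sub>1\<parallel>\<^sup>2\<close>, and by traciality the same number is
  \<open>\<langle>A\<^sub>1, U\<^sup>* A\<^sub>2 U\<rangle> = \<langle>e, U\<^sup>* A\<^sub>2 U\<rangle> = \<langle>e, A\<^sub>2\<rangle> = \<parallel>A\<^sub>2\<parallel>\<^sup>2\<close>, up to the common factor \<open>\<tau>(1)\<close>.
  Bi-unitarity gives \<open>\<parallel>Q\<parallel> = \<parallel>A\<^sub>1\<parallel>\<close>, so \<open>\<parallel>Q - A\<^sub>2\<parallel>\<^sup>2 = 0\<close> (\<open>conjugation_eqI\<close>).

  For the isomorphism, sending the generator \<open>p\<^bsub>j,i\<^esub>\<close> to \<open>u\<^bsub>j,i\<^esub>\<close> represents the free *-algebra in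
  \<open>N\<close> and, by the intertwining relation, kills all relators. The operator norm of the representation is
  thus one of the seminorms that define the universal norm, so the representation extends to the completion,
  with values in the norm-closed algebra \<open>N\<close>, and composing it with \<open>\<tau>\<close> gives the tracial state
  (\<open>tracial_state_exists\<close>). It is normalised because \<open>\<Gamma>\<close> preserves traces (\<open>trace_one\<close>).
\<close>

section \<open>The Hilbert space of matrices\<close>

lemma cscale_nth [simp]: "(c *\<^sub>m a)$i$j = c * a$i$j"
  by (simp add: cscale_def)

lemma matunit_nth [simp]: "matunit i j$k$l = (if k = i \<and> l = j then 1 else 0)"
  by (simp add: matunit_def)

lemma kron_nth [simp]: "kron a b$p$q = a$fst p$fst q * b$snd p$snd q"
  by (simp add: kron_def)

lemma mat_adj_nth [simp]: "mat_adj a$i$j = cnj (a$j$i)"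
  by (simp add: mat_adj_def)

lemma sum_nth2 [simp]: "(sum g S :: complex^'n^'m)$i$j = (\<Sum>s\<in>S. g s$i$j)"
  by simp

lemma vector_space_cscale: "vector_space (cscale :: complex \<Rightarrow> complex^'n^'m \<Rightarrow> _)"
  by unfold_locales (simp_all add: vec_eq_iff algebra_simps)

lemma cscale_one [simp]: "1 *\<^sub>m a = a" and cscale_zero [simp]: "0 *\<^sub>m a = 0"
  and cscale_zero_right [simp]: "c *\<^sub>m 0 = 0"
  by (simp_all add: vec_eq_iff)

lemma cscale_cscale [simp]: "c *\<^sub>m d *\<^sub>m a = (c * d) *\<^sub>m a"
  by (simp add: vec_eq_iff)

lemma cscale_add_right: "c *\<^sub>m (a + b) = c *\<^sub>m a + c *\<^sub>m b"
  by (simp add: vec_eq_iff algebra_simps)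

lemma cscale_sum_right: "c *\<^sub>m sum g S = (\<Sum>s\<in>S. c *\<^sub>m g s)"
  by (simp add: vec_eq_iff sum_distrib_left)

lemma mat_linearI:
  assumes "\<And>a b. T (a + b) = T a + T b" "\<And>c a. T (c *\<^sub>m a) = c *\<^sub>m T a"
  shows "mat_linear T"
  using assms by (intro Vector_Spaces.linear.intro vector_space_cscale module_hom.intro
      module_hom_axioms.intro) (auto simp: module_iff_vector_space vector_space_cscale)

lemma mat_linear_add: "mat_linear T \<Longrightarrow> T (a + b) = T a + T b"
  by (simp add: Vector_Spaces.linear.axioms module_hom.add linear_iff_module_hom)

lemma mat_linear_scale: "mat_linear T \<Longrightarrow> T (c *\<^sub>m a) = c *\<^sub>m T a"
  by (simp add: module_hom.scale linear_iff_module_hom)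

lemma mat_linear_0: "mat_linear T \<Longrightarrow> T 0 = 0"
  by (simp add: module_hom.zero linear_iff_module_hom)

lemma mat_linear_sum: "mat_linear T \<Longrightarrow> T (sum g S) = (\<Sum>s\<in>S. T (g s))"
  by (simp add: module_hom.sum linear_iff_module_hom)

lemmas mat_lin = mat_linear_add mat_linear_scale mat_linear_0 mat_linear_sum

lemma mat_linear_id: "mat_linear id"
  by (rule mat_linearI) auto

lemma mat_linear_comp: "mat_linear S \<Longrightarrow> mat_linear T \<Longrightarrow> mat_linear (S \<circ> T)"
  by (rule mat_linearI) (simp_all add: mat_lin)

lemma matunit_expand: "a = (\<Sum>i\<in>UNIV. \<Sum>j\<in>UNIV. a$i$j *\<^sub>m matunit i j)"
proof -
  have "(\<Sum>i\<in>UNIV. \<Sum>j\<in>UNIV. a$i$j *\<^sub>m matunit i j)$k$l = a$k$l" for k l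
  proof -
    have "(\<Sum>i\<in>UNIV. \<Sum>j\<in>UNIV. a$i$j *\<^sub>m matunit i j)$k$l =
        (\<Sum>i\<in>UNIV. \<Sum>j\<in>UNIV. if k = i then (if l = j then a$i$j else 0) else 0)"
      by (auto intro!: sum.cong)
    also have "\<dots> = (\<Sum>i\<in>UNIV. if k = i then a$i$l else 0)"
      by (intro sum.cong refl) auto
    finally show ?thesis by simp
  qed
  then show ?thesis by (simp add: vec_eq_iff)
qed

subsection \<open>The inner product\<close>

lemma l2_altdef:
  "l2 (a::complex^'x^'x) b = (\<Sum>i\<in>UNIV. \<Sum>j\<in>UNIV. cnj (a$i$j) * b$i$j) / of_nat CARD('x)"
  by (simp add: l2_def ntr_def trace_def matrix_matrix_mult_def)
     (subst sum.swap, rule refl)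

lemma l2_add_left: "l2 (a + b) d = l2 a d + l2 b d"
  and l2_add_right: "l2 d (a + b) = l2 d a + l2 d b"
  and l2_scale_left: "l2 (c *\<^sub>m a) d = cnj c * l2 a d"
  and l2_scale_right: "l2 d (c *\<^sub>m a) = c * l2 d a"
  and l2_zero_left [simp]: "l2 0 d = 0" and l2_zero_right [simp]: "l2 d 0 = 0"
  and l2_diff_right: "l2 d (a - b) = l2 d a - l2 d b"
  by (simp_all add: l2_altdef sum.distrib sum_subtractf algebra_simps
      sum_distrib_left add_divide_distrib diff_divide_distrib)

lemma l2_sum_left: "l2 (sum g S) d = (\<Sum>s\<in>S. l2 (g s) d)"
  by (induct S rule: infinite_finite_induct) (simp_all add: l2_add_left)

lemma l2_sum_right: "l2 d (sum g S) = (\<Sum>s\<in>S. l2 d (g s))"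
  by (induct S rule: infinite_finite_induct) (simp_all add: l2_add_right)

lemmas l2_simps = l2_add_left l2_add_right l2_scale_left l2_scale_right l2_sum_left l2_sum_right

lemma cnj_l2: "cnj (l2 a b) = l2 b a"
  by (simp add: l2_altdef mult.commute)

lemma l2_matunit:
  "l2 (matunit i j :: complex^'x^'x) b = b$i$j / of_nat CARD('x)"
proof -
  have "(\<Sum>k\<in>UNIV. \<Sum>l\<in>UNIV. cnj (matunit i j$k$l) * b$k$l) =
      (\<Sum>k\<in>UNIV. \<Sum>l\<in>UNIV. if k = i then (if l = j then b$k$l else 0) else 0)"
    by (auto intro!: sum.cong)
  also have "\<dots> = (\<Sum>k\<in>UNIV. if k = i then b$k$j else 0)"
    by (intro sum.cong refl) auto
  finally show ?thesis by (simp add: l2_altdef)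
qed

lemma l2_nondegenerate:
  assumes "\<And>y. l2 y a = l2 y b" shows "a = b"
proof -
  have "a$i$j = b$i$j" for i j
    using assms[of "matunit i j"] by (simp add: l2_matunit)
  then show ?thesis by (simp add: vec_eq_iff)
qed

lemma hilbert_adj_eqI:
  assumes "\<And>x y. l2 (S x) y = l2 x (T y)"
  shows "hilbert_adj T = S"
  unfolding hilbert_adj_def
proof (rule the_equality)
  fix R assume R: "\<forall>x y. l2 (R x) y = l2 x (T y)"
  have "l2 y (R x) = l2 y (S x)" for x y
    using R assms by (metis cnj_l2)
  then show "R = S" using l2_nondegenerate by blast
qed (use assms in blast)

lemma mat_adj_mat_adj [simp]: "mat_adj (mat_adj a) = a"
  by (simp add: vec_eq_iff)

lemma mat_adj_scale: "mat_adj (c *\<^sub>m a) = cnj c *\<^sub>m mat_adj a"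
  by (simp add: vec_eq_iff)

lemma mat_adj_sum: "mat_adj (sum g S) = (\<Sum>s\<in>S. mat_adj (g s))"
  by (simp add: vec_eq_iff)

lemma mat_adj_mat [simp]: "mat_adj (mat 1) = mat 1"
  by (simp add: vec_eq_iff mat_def)

lemma mat_adj_matunit [simp]: "mat_adj (matunit i j) = matunit j i"
  by (auto simp add: vec_eq_iff)

lemma mat_adj_mult: "mat_adj (a ** b) = mat_adj b ** mat_adj a"
  by (simp add: vec_eq_iff matrix_matrix_mult_def mult.commute)

lemma ntr_mult_commute: "ntr (a ** b) = ntr (b ** (a::complex^'x^'x))"
  unfolding ntr_def by (subst trace_mul_sym) (rule refl)

lemma ntr_add: "ntr (a + b) = ntr a + ntr b"
  unfolding ntr_def trace_add by (rule add_divide_distrib)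

lemma ntr_scale: "ntr (c *\<^sub>m a) = c * ntr a"
  unfolding ntr_def trace_def by (simp only: cscale_nth sum_distrib_left[symmetric] times_divide_eq_right)

lemma ntr_sum: "ntr (sum g S) = (\<Sum>s\<in>S. ntr (g s))"
proof -
  have "ntr 0 = 0" using ntr_scale[of 0 0] by simp
  then show ?thesis
    by (induct S rule: infinite_finite_induct) (simp_all add: ntr_add)
qed

lemma l2_mult_left: "l2 a (b ** c) = l2 (mat_adj b ** a) c"
  unfolding l2_def mat_adj_mult mat_adj_mat_adj matrix_mul_assoc ..

lemma l2_mat_adj: "l2 (mat_adj a) (mat_adj b) = l2 b a"
  unfolding l2_def mat_adj_mat_adj by (rule ntr_mult_commute)

lemma cscale_mult_right: "a ** (c *\<^sub>m b) = c *\<^sub>m (a ** b)"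
  by (simp add: vec_eq_iff matrix_matrix_mult_def sum_distrib_left algebra_simps)

lemma mat_mult_sum_right: "(a::complex^'m^'k) ** sum h S = (\<Sum>s\<in>S. a ** h s)"
  by (simp add: vec_eq_iff matrix_matrix_mult_def sum_distrib_left) (auto intro: sum.swap)

subsection \<open>Orthonormal bases\<close>

lemma onb_inner: "onb f \<Longrightarrow> l2 (f i) (f j) = (if i = j then 1 else 0)"
  by (simp add: onb_def)

lemma onb_expand:
  assumes "onb f" shows "b = (\<Sum>i\<in>UNIV. l2 (f i) b *\<^sub>m f i)"
proof -
  have "\<exists>c. b = (\<Sum>i\<in>UNIV. c i *\<^sub>m f i)" using assms by (simp add: onb_def)
  then obtain c where c: "b = (\<Sum>i\<in>UNIV. c i *\<^sub>m f i)" ..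
  have "l2 (f i) b = c i" for i
    by (simp add: c l2_simps onb_inner[OF assms] if_distrib cong: if_cong)
  then show ?thesis using c by simp
qed

lemma onb_parseval:
  assumes "onb f" shows "l2 a b = (\<Sum>i\<in>UNIV. l2 a (f i) * l2 (f i) b)"
  by (subst onb_expand[OF assms, of b]) (simp add: l2_simps mult.commute)

text \<open>
  The trace of an operator on \<open>L\<^sup>2(M\<^sub>X)\<close> may be computed in any orthonormal basis. It is used to pass from \<open>f\<close>
  to matrix units, in which the axioms of a quantum adjacency matrix become explicit.
\<close>

lemma onb_trace_independent:
  assumes f: "onb f" and g: "onb g" and T: "mat_linear T"
  shows "(\<Sum>j\<in>UNIV. l2 (f j) (T (f j))) = (\<Sum>p\<in>UNIV. l2 (g p) (T (g p)))"
proof -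
  have "(\<Sum>j\<in>UNIV. l2 (f j) (T (f j))) =
      (\<Sum>j\<in>UNIV. \<Sum>p\<in>UNIV. l2 (f j) (g p) * l2 (g p) (T (f j)))"
    by (intro sum.cong refl onb_parseval[OF g])
  also have "\<dots> = (\<Sum>p\<in>UNIV. l2 (g p) (T (\<Sum>j\<in>UNIV. l2 (f j) (g p) *\<^sub>m f j)))"
    by (subst sum.swap) (simp add: mat_lin[OF T] l2_simps)
  also have "\<dots> = (\<Sum>p\<in>UNIV. l2 (g p) (T (g p)))"
    by (simp add: onb_expand[OF f, symmetric])
  finally show ?thesis .
qed

text \<open>
  The factor compensates the normalisation of the trace, which gives a matrix unit the norm
  \<open>1 / sqrt n\<close>.
\<close>

lemma onb_matunit:
  "onb (\<lambda>p. complex_of_real (sqrt CARD('x)) *\<^sub>m matunit (fst p) (snd p) :: complex^'x^'x)"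
  unfolding onb_def
proof (intro conjI allI)
  have s: "complex_of_real (sqrt CARD('x)) * complex_of_real (sqrt CARD('x)) = of_nat CARD('x)"
    by (simp flip: of_real_mult)
  have n: "of_nat CARD('x) \<noteq> (0::complex)" by simp
  fix p q :: "'x \<times> 'x"
  show "l2 (complex_of_real (sqrt CARD('x)) *\<^sub>m matunit (fst p) (snd p) :: complex^'x^'x)
      (complex_of_real (sqrt CARD('x)) *\<^sub>m matunit (fst q) (snd q)) = (if p = q then 1 else 0)"
    using s n by (auto simp: l2_simps l2_matunit prod_eq_iff simp del: of_real_mult)
next
  fix b :: "complex^'x^'x"
  have "b = (\<Sum>p\<in>UNIV. b$fst p$snd p *\<^sub>m matunit (fst p) (snd p))"
    by (subst matunit_expand[of b]) (simp add: sum.cartesian_product case_prod_beta)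
  also have "\<dots> = (\<Sum>p\<in>UNIV. (b$fst p$snd p / complex_of_real (sqrt CARD('x))) *\<^sub>m
      complex_of_real (sqrt CARD('x)) *\<^sub>m matunit (fst p) (snd p))"
    by simp
  finally show "\<exists>c. b = (\<Sum>p\<in>UNIV. c p *\<^sub>m
      complex_of_real (sqrt CARD('x)) *\<^sub>m matunit (fst p) (snd p))"
    by (rule exI[where x="\<lambda>p. b$fst p$snd p / complex_of_real (sqrt CARD('x))"])
qed

lemma onb_mat_adj: assumes "onb f" shows "onb (\<lambda>j. mat_adj (f j))"
  unfolding onb_def
proof (intro conjI allI)
  fix i j show "l2 (mat_adj (f i)) (mat_adj (f j)) = (if i = j then 1 else 0)"
    using onb_inner[OF assms] by (auto simp: l2_mat_adj)
next
  fix b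
  have "b = mat_adj (\<Sum>i\<in>UNIV. l2 (f i) (mat_adj b) *\<^sub>m f i)"
    by (simp flip: onb_expand[OF assms])
  then show "\<exists>c. b = (\<Sum>i\<in>UNIV. c i *\<^sub>m mat_adj (f i))"
    by (auto simp: mat_adj_sum mat_adj_scale)
qed

subsection \<open>Tensor products\<close>

lemma kron_add_right: "kron c (a + b) = kron c a + kron c b"
  and kron_scale_left: "kron (d *\<^sub>m a) c = d *\<^sub>m kron a c"
  and kron_scale_right: "kron c (d *\<^sub>m a) = d *\<^sub>m kron c a"
  and kron_sum_left: "kron (sum g S) c = (\<Sum>s\<in>S. kron (g s) c)"
  and kron_sum_right: "kron c (sum g S) = (\<Sum>s\<in>S. kron c (g s))"
  by (simp_all add: vec_eq_iff algebra_simps sum_distrib_left)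

lemma mat_linear_tensor_map: "mat_linear (tensor_map S T)"
  by (rule mat_linearI)
     (simp_all add: tensor_map_def sum.distrib cscale_sum_right vec_eq_iff algebra_simps sum_distrib_left)

lemma tensor_map_kron:
  assumes "mat_linear S" "mat_linear T"
  shows "tensor_map S T (kron a b) = kron (S a) (T b)"
proof -
  have "kron (S a) (T b) = kron (S (\<Sum>i\<in>UNIV. \<Sum>j\<in>UNIV. a$i$j *\<^sub>m matunit i j))
      (T (\<Sum>i\<in>UNIV. \<Sum>j\<in>UNIV. b$i$j *\<^sub>m matunit i j))"
    by (simp flip: matunit_expand)
  also have "\<dots> = tensor_map S T (kron a b)"
    by (simp only: mat_lin[OF assms(1)] mat_lin[OF assms(2)] kron_sum_left kron_scale_left)
       (simp add: kron_sum_right kron_scale_right cscale_sum_right tensor_map_def mult_ac)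
  finally show ?thesis by simp
qed

lemma sum_UNIV_prod: "(\<Sum>p\<in>UNIV. g p) = (\<Sum>i\<in>UNIV. \<Sum>j\<in>UNIV. g (i, j))"
  by (simp add: sum.cartesian_product)

lemma l2_kron: "l2 (kron a b) (kron c d) = l2 a c * l2 b d"
proof -
  let ?g = "\<lambda>i j k l. cnj (a$i$k) * c$i$k * (cnj (b$j$l) * d$j$l)"
  have "(\<Sum>p\<in>UNIV. \<Sum>q\<in>UNIV. cnj (kron a b$p$q) * kron c d$p$q) =
      (\<Sum>i\<in>UNIV. \<Sum>j\<in>UNIV. \<Sum>k\<in>UNIV. \<Sum>l\<in>UNIV. ?g i j k l)"
    by (simp add: sum_UNIV_prod mult_ac)
  also have "\<dots> = (\<Sum>i\<in>UNIV. \<Sum>k\<in>UNIV. \<Sum>j\<in>UNIV. \<Sum>l\<in>UNIV. ?g i j k l)"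
    by (intro sum.cong refl sum.swap)
  also have "\<dots> = (\<Sum>i\<in>UNIV. \<Sum>k\<in>UNIV. cnj (a$i$k) * c$i$k) *
      (\<Sum>j\<in>UNIV. \<Sum>l\<in>UNIV. cnj (b$j$l) * d$j$l)"
    by (simp only: sum_distrib_right) (simp only: sum_distrib_left)
  finally show ?thesis by (simp add: l2_altdef)
qed

section \<open>Quantum adjacency matrices\<close>

lemma mult_map_kron: "mult_map (kron a b) = a ** b"
  by (simp add: mult_map_def matrix_matrix_mult_def vec_eq_iff)

lemma mat_linear_mult_map: "mat_linear mult_map"
  by (rule mat_linearI) (simp_all add: mult_map_def vec_eq_iff sum.distrib sum_distrib_left)

lemma mat_linear_unit_map: "mat_linear unit_map"
  by (rule mat_linearI) (simp_all add: unit_map_def vec_eq_iff algebra_simps)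

text \<open>
  The entries of the adjoint of the multiplication form the tensor \<open>D b\<close> below; adjointness is a
  rearrangement of sums, and the expansion of \<open>D b\<close> in elementary tensors is what makes the axioms
  computable with \<open>tensor_map_kron\<close>.
\<close>

lemma hilbert_adj_mult_map:
  "hilbert_adj mult_map (b::complex^'x^'x) =
     of_nat CARD('x) *\<^sub>m (\<Sum>i\<in>UNIV. \<Sum>j\<in>UNIV. kron (matunit i j) (matunit j i ** b))"
proof -
  define D :: "complex^'x^'x \<Rightarrow> complex^('x \<times> 'x)^('x \<times> 'x)" where
    "D b = (\<chi> p q. if snd p = fst q then of_nat CARD('x) * b$fst p$snd q else 0)" for b
  have adj: "l2 (D b) z = l2 b (mult_map z)" for b z
  proof -
    let ?g = "\<lambda>i k l j. of_nat CARD('x) * cnj (b$i$j) * z$(i, k)$(l, j)"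
    have "(\<Sum>p\<in>UNIV. \<Sum>q\<in>UNIV. cnj (D b$p$q) * z$p$q) =
        (\<Sum>i\<in>UNIV. \<Sum>k\<in>UNIV. \<Sum>l\<in>UNIV. \<Sum>j\<in>UNIV. if k = l then ?g i k l j else 0)"
      by (simp add: sum_UNIV_prod D_def) (intro sum.cong refl, auto)
    also have "\<dots> = (\<Sum>i\<in>UNIV. \<Sum>k\<in>UNIV. \<Sum>j\<in>UNIV. ?g i k k j)"
    proof (rule sum.cong[OF refl], rule sum.cong[OF refl])
      fix i k
      have "(\<Sum>l\<in>UNIV. \<Sum>j\<in>UNIV. if k = l then ?g i k l j else 0) =
          (\<Sum>l\<in>UNIV. if k = l then (\<Sum>j\<in>UNIV. ?g i k l j) else 0)"
        by (intro sum.cong refl) auto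
      then show "(\<Sum>l\<in>UNIV. \<Sum>j\<in>UNIV. if k = l then ?g i k l j else 0) = (\<Sum>j\<in>UNIV. ?g i k k j)"
        by simp
    qed
    also have "\<dots> = (\<Sum>i\<in>UNIV. \<Sum>j\<in>UNIV. \<Sum>k\<in>UNIV. ?g i k k j)"
      by (intro sum.cong refl sum.swap)
    also have "\<dots> = of_nat CARD('x) * (\<Sum>i\<in>UNIV. \<Sum>j\<in>UNIV. cnj (b$i$j) * mult_map z$i$j)"
      by (simp add: sum_distrib_left mult_map_def mult_ac)
    finally show ?thesis by (simp add: l2_altdef)
  qed
  have "D b = of_nat CARD('x) *\<^sub>m (\<Sum>i\<in>UNIV. \<Sum>j\<in>UNIV. kron (matunit i j) (matunit j i ** b))"
  proof -
    have "(\<Sum>i\<in>UNIV. \<Sum>j\<in>UNIV. kron (matunit i j) (matunit j i ** b))$p$q =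
        (if snd p = fst q then b$fst p$snd q else 0)" for p q
    proof -
      have m: "(matunit j i ** b)$k$l = (if k = j then b$i$l else 0)" for i j k l
        by (simp add: matrix_matrix_mult_def if_distrib[of "\<lambda>x. x * _"] cong: if_cong)
      have "(\<Sum>i\<in>UNIV. \<Sum>j\<in>UNIV. kron (matunit i j) (matunit j i ** b))$p$q =
        (\<Sum>i\<in>UNIV. \<Sum>j\<in>UNIV. if fst p = i then (if fst q = j then
           (if snd p = fst q then b$fst p$snd q else 0) else 0) else 0)"
        unfolding sum_nth2 by (intro sum.cong refl) (auto simp: m)
      also have "\<dots> = (\<Sum>i\<in>UNIV. if fst p = i then (\<Sum>j\<in>UNIV. (if fst q = j then
           (if snd p = fst q then b$fst p$snd q else 0) else 0)) else 0)"
        by (intro sum.cong refl) auto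
      finally show ?thesis by simp
    qed
    note entry = this
    show ?thesis
      unfolding vec_eq_iff
      by (intro allI) (simp only: cscale_nth entry D_def vec_lambda_beta, simp)
  qed
  with hilbert_adj_eqI[of D mult_map] adj show ?thesis by simp
qed

lemma hilbert_adj_unit_map: "hilbert_adj unit_map (a::complex^'x^'x) = ntr a *\<^sub>m mat 1"
proof -
  have "hilbert_adj unit_map = (\<lambda>a::complex^'x^'x. ntr a *\<^sub>m mat 1)"
  proof (rule hilbert_adj_eqI)
    fix a :: "complex^'x^'x" and c :: "complex^unit^unit"
    have "l2 a (mat 1) = cnj (ntr a)"
      by (subst cnj_l2[symmetric]) (simp add: l2_def)
    then show "l2 (ntr a *\<^sub>m mat 1) c = l2 a (unit_map c)"
      by (simp add: unit_map_def l2_simps) (simp add: l2_altdef mat_def UNIV_unit)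
  qed
  then show ?thesis by simp
qed

lemma mat_linear_hilbert_adj_unit_map: "mat_linear (hilbert_adj unit_map)"
  by (rule mat_linearI)
     (simp_all add: hilbert_adj_unit_map ntr_add ntr_scale vec_eq_iff algebra_simps)

lemma mat_linear_hilbert_adj_mult_map:
  "mat_linear (hilbert_adj (mult_map :: _ \<Rightarrow> complex^'x^'x))"
proof (rule mat_linearI)
  fix a b :: "complex^'x^'x" and c
  show "hilbert_adj mult_map (a + b) = hilbert_adj mult_map a + hilbert_adj mult_map b"
    by (simp add: hilbert_adj_mult_map matrix_add_ldistrib kron_add_right sum.distrib cscale_add_right)
  show "hilbert_adj mult_map (c *\<^sub>m a) = c *\<^sub>m hilbert_adj mult_map a"
    by (simp add: hilbert_adj_mult_map cscale_mult_right kron_scale_right mult.commute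
        flip: cscale_sum_right)
qed

lemma quantum_adjacency_linear: "quantum_adjacency A \<Longrightarrow> mat_linear A"
  and quantum_adjacency_selfadj: "quantum_adjacency A \<Longrightarrow> l2 (A a) b = l2 a (A b)"
  by (simp_all add: quantum_adjacency_def)

text \<open>
  Insert the formula for \<open>m\<^sup>*\<close> into the axiom \<open>m(A \<otimes> A)m\<^sup>* = A\<close>.
\<close>

lemma quantum_adjacency_schur_idempotent:
  assumes "quantum_adjacency (A :: complex^'x^'x \<Rightarrow> _)"
  shows "A b = of_nat CARD('x) *\<^sub>m
     (\<Sum>i\<in>UNIV. \<Sum>j\<in>UNIV. A (matunit i j) ** A (matunit j i ** b))"
proof -
  have lin: "mat_linear A" and eq: "mult_map \<circ> tensor_map A A \<circ> hilbert_adj mult_map = A"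
    using assms by (simp_all add: quantum_adjacency_def)
  have "A b = mult_map (tensor_map A A (hilbert_adj mult_map b))"
    using fun_cong[OF eq, of b] by simp
  also have "\<dots> = of_nat CARD('x) *\<^sub>m
     (\<Sum>i\<in>UNIV. \<Sum>j\<in>UNIV. A (matunit i j) ** A (matunit j i ** b))"
    by (simp add: hilbert_adj_mult_map mat_lin[OF mat_linear_tensor_map] mat_lin[OF mat_linear_mult_map]
        tensor_map_kron[OF lin lin] mult_map_kron)
  finally show ?thesis .
qed

lemma mat_linear_associator: "mat_linear associator"
  by (rule mat_linearI) (simp_all add: associator_def vec_eq_iff)

lemma mat_linear_right_unitor: "mat_linear right_unitor"
  by (rule mat_linearI) (simp_all add: right_unitor_def vec_eq_iff)

lemma associator_kron: "associator (kron (kron a b) c) = kron a (kron b c)"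
  by (simp add: associator_def vec_eq_iff)

lemma right_unitor_kron: "right_unitor (kron a (c *\<^sub>m mat 1)) = c *\<^sub>m a"
  by (simp add: right_unitor_def vec_eq_iff mat_def)

lemma left_unitor_kron: "left_unitor a = kron (mat 1) a"
  by (simp add: left_unitor_def vec_eq_iff mat_def)

text \<open>
  The axiom with the two units: \<open>m\<^sup>*\<eta>\<close> is the tensor \<open>n \<Sum> e\<^sub>i\<^sub>j \<otimes> e\<^sub>j\<^sub>i\<close>, the middle map turns \<open>e\<^sub>j\<^sub>i\<close>
  into \<open>A e\<^sub>j\<^sub>i\<close>, and \<open>\<eta>\<^sup>*m\<close> pairs it with the argument.
\<close>

lemma quantum_adjacency_symmetric:
  assumes "quantum_adjacency (A :: complex^'x^'x \<Rightarrow> _)"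
  shows "A \<xi> = of_nat CARD('x) *\<^sub>m
     (\<Sum>i\<in>UNIV. \<Sum>j\<in>UNIV. ntr (A (matunit j i) ** \<xi>) *\<^sub>m matunit i j)"
proof -
  have lin: "mat_linear A" and eq: "right_unitor \<circ> tensor_map id (hilbert_adj unit_map \<circ> mult_map)
       \<circ> associator \<circ> tensor_map (tensor_map id A) id
       \<circ> tensor_map (hilbert_adj mult_map \<circ> unit_map) id \<circ> left_unitor = A"
    using assms by (simp_all add: quantum_adjacency_def)
  have unit: "unit_map (mat 1) = mat 1"
    by (simp add: unit_map_def mat_def vec_eq_iff)
  have l1: "mat_linear (hilbert_adj (mult_map :: _ \<Rightarrow> complex^'x^'x) \<circ> unit_map)"
    by (intro mat_linear_comp mat_linear_hilbert_adj_mult_map mat_linear_unit_map)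
  have l2: "mat_linear (hilbert_adj (unit_map :: _ \<Rightarrow> complex^'x^'x) \<circ> mult_map)"
    by (intro mat_linear_comp mat_linear_hilbert_adj_unit_map mat_linear_mult_map)
  have "A \<xi> = right_unitor (tensor_map id (hilbert_adj unit_map \<circ> mult_map)
      (associator (tensor_map (tensor_map id A) id
        (tensor_map (hilbert_adj mult_map \<circ> unit_map) id (left_unitor \<xi>)))))"
    using fun_cong[OF eq, of \<xi>] by simp
  also have "\<dots> = of_nat CARD('x) *\<^sub>m
     (\<Sum>i\<in>UNIV. \<Sum>j\<in>UNIV. ntr (A (matunit j i) ** \<xi>) *\<^sub>m matunit i j)"
    by (simp add: left_unitor_kron tensor_map_kron l1 l2 mat_linear_id lin unit hilbert_adj_mult_map
        kron_scale_left kron_sum_left mat_linear_tensor_map mat_lin[OF mat_linear_tensor_map]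
        mat_lin[OF mat_linear_associator] associator_kron mat_lin[OF mat_linear_right_unitor]
        mult_map_kron hilbert_adj_unit_map right_unitor_kron)
  finally show ?thesis .
qed

text \<open>
  By the formula just proved, the matrix entries of \<open>A \<xi>\<close> are the numbers \<open>n tr (A(e\<^sub>l\<^sub>k) \<xi>)\<close>; by
  self-adjointness they are also \<open>n\<close> times the inner products of \<open>A e\<^sub>k\<^sub>l\<close> with \<open>\<xi>\<close>. As \<open>\<xi>\<close> is arbitrary, this
  gives the claim for matrix units.
\<close>

lemma quantum_adjacency_mat_adj:
  assumes "quantum_adjacency (A :: complex^'x^'x \<Rightarrow> _)"
  shows "A (mat_adj b) = mat_adj (A b)"
proof -
  note lin = quantum_adjacency_linear[OF assms]
  have u: "A (matunit k l) = mat_adj (A (matunit l k))" for k l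
  proof (rule l2_nondegenerate)
    fix \<xi> :: "complex^'x^'x"
    have "l2 (A (matunit k l)) \<xi> = A \<xi>$k$l / of_nat CARD('x)"
      by (simp add: quantum_adjacency_selfadj[OF assms] l2_matunit)
    also have "A \<xi>$k$l = of_nat CARD('x) *
        (\<Sum>i\<in>UNIV. \<Sum>j\<in>UNIV. ntr (A (matunit j i) ** \<xi>) *\<^sub>m matunit i j)$k$l"
      by (subst quantum_adjacency_symmetric[OF assms]) (rule cscale_nth)
    also have "(\<Sum>i\<in>UNIV. \<Sum>j\<in>UNIV. ntr (A (matunit j i) ** \<xi>) *\<^sub>m matunit i j) =
        (\<Sum>i\<in>UNIV. \<Sum>j\<in>UNIV. (\<chi> i j. ntr (A (matunit j i) ** \<xi>))$i$j *\<^sub>m matunit i j)"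
      by simp
    also have "\<dots> = (\<chi> i j. ntr (A (matunit j i) ** \<xi>))"
      by (rule matunit_expand[symmetric])
    finally have "l2 (A (matunit k l)) \<xi> = l2 (mat_adj (A (matunit l k))) \<xi>"
      by (simp add: l2_def)
    from arg_cong[OF this, of cnj]
    show "l2 \<xi> (A (matunit k l)) = l2 \<xi> (mat_adj (A (matunit l k)))"
      by (simp only: cnj_l2)
  qed
  have m: "mat_adj (A (matunit k l)) = A (matunit l k)" for k l
    by (rule u[symmetric])
  have "A (mat_adj b) = A (mat_adj (\<Sum>i\<in>UNIV. \<Sum>j\<in>UNIV. b$i$j *\<^sub>m matunit i j))"
    by (simp flip: matunit_expand)
  also have "\<dots> = mat_adj (A (\<Sum>i\<in>UNIV. \<Sum>j\<in>UNIV. b$i$j *\<^sub>m matunit i j))"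
    by (simp add: mat_adj_sum mat_adj_scale mat_lin[OF lin] m)
  finally show ?thesis by (simp flip: matunit_expand)
qed

subsection \<open>The adjacency matrix as an orthogonal projection\<close>

text \<open>
  The left-hand side is the trace of the operator \<open>T\<close> below. In the basis of matrix units, moving \<open>A\<close> and the
  multiplications to the other side of the inner product turns the trace into \<open>tr (a\<^sup>* c)\<close>, where \<open>c\<close> is
  the sum \<open>n \<Sum> A(e\<^sub>i\<^sub>j) A(e\<^sub>j\<^sub>i b\<^sup>*)\<close>, and Schur idempotence identifies \<open>c\<close> as \<open>A(b\<^sup>*)\<close>.
\<close>

lemma quantum_adjacency_trace_identity:
  assumes A: "quantum_adjacency (A :: complex^'x^'x \<Rightarrow> _)" and f: "onb f"
  shows "(\<Sum>j\<in>UNIV. l2 (a ** A (b ** f j)) (A (f j))) = l2 a (A (mat_adj b))"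
proof -
  note lin = quantum_adjacency_linear[OF A]
  let ?n = "of_nat CARD('x) :: complex"
  define T where "T \<xi> = mat_adj b ** A (mat_adj a ** A \<xi>)" for \<xi>
  have linT: "mat_linear T"
    by (rule mat_linearI) (simp_all add: T_def mat_lin[OF lin] matrix_add_ldistrib cscale_mult_right)
  have moved: "l2 (a ** A (b ** \<xi>)) (A \<xi>) = l2 \<xi> (T \<xi>)" for \<xi>
    unfolding T_def
    by (simp add: l2_mult_left quantum_adjacency_selfadj[OF A, symmetric])
  have s: "complex_of_real (sqrt CARD('x)) * complex_of_real (sqrt CARD('x)) = ?n"
    by (simp flip: of_real_mult)
  have unit: "l2 (matunit i j) (T (matunit i j)) =
      ntr (mat_adj a ** (A (matunit i j) ** A (matunit j i ** mat_adj b)))" for i j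
  proof -
    have "l2 (matunit i j) (T (matunit i j)) =
        ntr (A (matunit j i ** mat_adj b) ** (mat_adj a ** A (matunit i j)))"
      unfolding moved[symmetric]
      by (simp add: l2_def mat_adj_mult quantum_adjacency_mat_adj[OF A, symmetric] matrix_mul_assoc)
    then show ?thesis by (subst (asm) ntr_mult_commute) (simp add: matrix_mul_assoc)
  qed
  have "(\<Sum>j\<in>UNIV. l2 (a ** A (b ** f j)) (A (f j))) =
      (\<Sum>p\<in>UNIV. l2 (complex_of_real (sqrt CARD('x)) *\<^sub>m matunit (fst p) (snd p))
        (T (complex_of_real (sqrt CARD('x)) *\<^sub>m matunit (fst p) (snd p))))"
    unfolding moved by (rule onb_trace_independent[OF f onb_matunit linT])
  also have "\<dots> = ?n * (\<Sum>i\<in>UNIV. \<Sum>j\<in>UNIV. l2 (matunit i j) (T (matunit i j)))"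
    using s by (simp add: sum_UNIV_prod mat_lin[OF linT] l2_simps sum_distrib_left flip: mult.assoc)
  also have "\<dots> = ntr (mat_adj a ** (?n *\<^sub>m
      (\<Sum>i\<in>UNIV. \<Sum>j\<in>UNIV. A (matunit i j) ** A (matunit j i ** mat_adj b))))"
    by (simp add: unit ntr_scale ntr_sum cscale_mult_right mat_mult_sum_right)
  also have "\<dots> = l2 a (A (mat_adj b))"
    by (subst quantum_adjacency_schur_idempotent[OF A, of "mat_adj b"]) (simp add: l2_def)
  finally show ?thesis .
qed

lemma bimodule_span_linear:
  assumes A: "mat_linear A" and "T \<in> bimodule_span A" shows "mat_linear T"
proof -
  obtain r c a b where T: "T = (\<lambda>\<xi>. \<Sum>s<(r::nat). c s *\<^sub>m (a s ** A (b s ** \<xi>)))"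
    using assms(2) unfolding bimodule_span_def by blast
  show ?thesis
  proof (rule mat_linearI)
    fix \<xi> \<zeta> and d
    show "T (\<xi> + \<zeta>) = T \<xi> + T \<zeta>"
      by (simp add: T mat_lin[OF A] matrix_add_ldistrib cscale_add_right sum.distrib)
    show "T (d *\<^sub>m \<xi>) = d *\<^sub>m T \<xi>"
      by (simp add: T mat_lin[OF A] cscale_mult_right cscale_sum_right mult.commute)
  qed
qed

lemma bimodule_spanI:
  assumes "T = (\<lambda>\<xi>. \<Sum>s<(r::nat). c s *\<^sub>m (a s ** A (b s ** \<xi>)))"
  shows "T \<in> bimodule_span A"
  unfolding bimodule_span_def
  by (rule CollectI, rule exI[of _ r], rule exI[of _ c], rule exI[of _ a], rule exI[of _ b], fact)

lemma bimodule_span_self: "A \<in> bimodule_span A"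
proof -
  have "A = (\<lambda>\<xi>. \<Sum>s<(1::nat). 1 *\<^sub>m (mat 1 ** A (mat 1 ** \<xi>)))" by simp
  then show ?thesis by (rule bimodule_spanI)
qed

lemma bimodule_span_add:
  assumes "S \<in> bimodule_span A" "T \<in> bimodule_span A"
  shows "(\<lambda>\<xi>. S \<xi> + T \<xi>) \<in> bimodule_span A"
proof -
  obtain r c a b where S: "S = (\<lambda>\<xi>. \<Sum>s<(r::nat). c s *\<^sub>m (a s ** A (b s ** \<xi>)))"
    using assms(1) by (auto simp: bimodule_span_def)
  obtain r' c' a' b' where T: "T = (\<lambda>\<xi>. \<Sum>s<(r'::nat). c' s *\<^sub>m (a' s ** A (b' s ** \<xi>)))"
    using assms(2) by (auto simp: bimodule_span_def)
  let ?c = "\<lambda>g g' s. if s < r then g s else g' (s - r)"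
  have split: "(\<Sum>s<r + r'. h s) = (\<Sum>s<r. h s) + (\<Sum>s<r'. h (s + r))" for h :: "nat \<Rightarrow> complex^'a^'a"
    by (induct r') (simp_all add: add_ac)
  have "(\<lambda>\<xi>. S \<xi> + T \<xi>) =
      (\<lambda>\<xi>. \<Sum>s<r + r'. (if s < r then c s else c' (s - r)) *\<^sub>m ((if s < r then a s else a' (s - r)) **
        A ((if s < r then b s else b' (s - r)) ** \<xi>)))"
    unfolding S T split by simp
  then show ?thesis by (rule bimodule_spanI)
qed

lemma bimodule_span_scale:
  assumes "T \<in> bimodule_span A" shows "(\<lambda>\<xi>. d *\<^sub>m T \<xi>) \<in> bimodule_span A"
proof -
  obtain r c a b where T: "T = (\<lambda>\<xi>. \<Sum>s<(r::nat). c s *\<^sub>m (a s ** A (b s ** \<xi>)))"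
    using assms(1) by (auto simp: bimodule_span_def)
  have "(\<lambda>\<xi>. d *\<^sub>m T \<xi>) = (\<lambda>\<xi>. \<Sum>s<r. (d * c s) *\<^sub>m (a s ** A (b s ** \<xi>)))"
    by (simp add: T cscale_sum_right)
  then show ?thesis by (rule bimodule_spanI)
qed

text \<open>
  For \<open>T = a A b\<close> the pairing with \<open>rank_one (mat 1) (mat 1)\<close> evaluates \<open>T\<close> at \<open>1\<close>, and the pairing with
  \<open>A\<close> is the trace identity; both equal \<open>l2 a (A (mat_adj b))\<close>.
\<close>

lemma adjacency_projection:
  assumes A: "quantum_adjacency (A :: complex^'x^'x \<Rightarrow> _)" and f: "onb f" and T: "T \<in> bimodule_span A"
  shows "(\<Sum>j\<in>UNIV. l2 (T (f j)) (rank_one (mat 1) (mat 1) (f j) - A (f j))) = 0"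
proof -
  note lin = quantum_adjacency_linear[OF A]
  have one: "(\<Sum>j\<in>UNIV. l2 (f j) (mat 1) *\<^sub>m f j) = mat 1"
    by (rule onb_expand[OF f, symmetric])
  have gen: "(\<Sum>j\<in>UNIV. l2 (a ** A (b ** f j)) (rank_one (mat 1) (mat 1) (f j) - A (f j))) = 0" for a b
  proof -
    have "(\<Sum>j\<in>UNIV. l2 (a ** A (b ** f j)) (rank_one (mat 1) (mat 1) (f j))) =
        l2 (a ** A (b ** (\<Sum>j\<in>UNIV. l2 (f j) (mat 1) *\<^sub>m f j))) (mat 1)"
      by (simp add: rank_one_def mat_lin[OF lin] mat_mult_sum_right cscale_mult_right l2_simps cnj_l2)
    also have "\<dots> = l2 (a ** A b) (mat 1)" by (simp add: one)
    also have "\<dots> = l2 a (A (mat_adj b))"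
      by (simp add: quantum_adjacency_mat_adj[OF A])
         (simp add: l2_def mat_adj_mult ntr_mult_commute[of "mat_adj a"])
    finally show ?thesis
      by (simp add: l2_diff_right sum_subtractf quantum_adjacency_trace_identity[OF A f])
  qed
  obtain r c a b where T: "T = (\<lambda>\<xi>. \<Sum>s<(r::nat). c s *\<^sub>m (a s ** A (b s ** \<xi>)))"
    using assms(3) by (auto simp: bimodule_span_def)
  have "(\<Sum>j\<in>UNIV. l2 (T (f j)) (rank_one (mat 1) (mat 1) (f j) - A (f j))) =
    (\<Sum>s<r. cnj (c s) * (\<Sum>j\<in>UNIV. l2 (a s ** A (b s ** f j)) (rank_one (mat 1) (mat 1) (f j) - A (f j))))"
    by (simp add: T l2_sum_left l2_scale_left sum_distrib_left) (rule sum.swap)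
  then show ?thesis by (simp add: gen)
qed

subsection \<open>Coordinates of the pseudo-graph\<close>

text \<open>
  The decomposition of \<open>T\<close> along the basis provides a value. It is unique because any decomposition
  determines the entries of the tensor from the values of \<open>T\<close> on matrix units.
\<close>

lemma Psi_onb:
  assumes f: "onb (f :: 'i::finite \<Rightarrow> complex^'x^'x)" and T: "mat_linear T"
  shows "Psi T = (\<Sum>j\<in>UNIV. kron (mat_adj (f j)) (T (f j)))"
  unfolding Psi_def
proof (rule the_equality)
  obtain h where h: "bij_betw h {..<CARD('i)} (UNIV :: 'i set)"
    using ex_bij_betw_nat_finite[of "UNIV :: 'i set"] by (auto simp: lessThan_atLeast0)
  have re: "(\<Sum>s<CARD('i). g (h s)) = (\<Sum>j\<in>UNIV. g j)" for g :: "'i \<Rightarrow> complex^'m^'m"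
    by (rule sum.reindex_bij_betw[OF h])
  have "T \<xi> = (\<Sum>s<CARD('i). rank_one (f (h s)) (T (f (h s))) \<xi>)" for \<xi>
  proof -
    have "T \<xi> = T (\<Sum>j\<in>UNIV. l2 (f j) \<xi> *\<^sub>m f j)" by (simp flip: onb_expand[OF f])
    also have "\<dots> = (\<Sum>j\<in>UNIV. rank_one (f j) (T (f j)) \<xi>)"
      by (simp add: mat_lin[OF T] rank_one_def)
    finally show ?thesis by (simp only: re[of "\<lambda>j. rank_one (f j) (T (f j)) \<xi>"])
  qed
  moreover have "(\<Sum>j\<in>UNIV. kron (mat_adj (f j)) (T (f j))) =
      (\<Sum>s<CARD('i). kron (mat_adj (f (h s))) (T (f (h s))))"
    unfolding re[of "\<lambda>j. kron (mat_adj (f j)) (T (f j))"] ..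
  ultimately show ex: "\<exists>(r::nat) x y. T = (\<lambda>\<xi>. \<Sum>s<r. rank_one (x s) (y s) \<xi>) \<and>
      (\<Sum>j\<in>UNIV. kron (mat_adj (f j)) (T (f j))) = (\<Sum>s<r. kron (mat_adj (x s)) (y s))"
    by (intro exI[of _ "CARD('i)"] exI[of _ "\<lambda>s. f (h s)"] exI[of _ "\<lambda>s. T (f (h s))"] conjI ext)
  have entries: "z = (\<chi> p q. of_nat CARD('x) * T (matunit (fst q) (fst p))$snd p$snd q)"
    if dec: "\<exists>(r::nat) x y. T = (\<lambda>\<xi>. \<Sum>s<r. rank_one (x s) (y s) \<xi>) \<and>
      z = (\<Sum>s<r. kron (mat_adj (x s)) (y s))" for z
  proof -
    obtain r x y where T: "T = (\<lambda>\<xi>. \<Sum>s<(r::nat). rank_one (x s) (y s) \<xi>)"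
      and z: "z = (\<Sum>s<r. kron (mat_adj (x s)) (y s))" using dec by blast
    have "l2 (x s) (matunit i j) = cnj (x s$i$j) / of_nat CARD('x)" for s i j
      by (subst cnj_l2[symmetric]) (simp add: l2_matunit)
    then show ?thesis
      by (simp add: z T vec_eq_iff rank_one_def sum_distrib_left)
  qed
  show "z = (\<Sum>j\<in>UNIV. kron (mat_adj (f j)) (T (f j)))"
    if "\<exists>(r::nat) x y. T = (\<lambda>\<xi>. \<Sum>s<r. rank_one (x s) (y s) \<xi>) \<and>
      z = (\<Sum>s<r. kron (mat_adj (x s)) (y s))" for z
    using entries[OF that] entries[OF ex] by simp
qed

lemma partial_map_onb:
  assumes f: "onb f"
  shows "mat_linear (partial_map f)" "partial_map f (mat_adj (f j)) = f j"
proof -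
  define D where "D b = (\<Sum>j\<in>UNIV. l2 (mat_adj (f j)) b *\<^sub>m f j)" for b
  have lin: "mat_linear D"
    by (rule mat_linearI)
       (simp_all add: D_def l2_add_right l2_scale_right sum.distrib vec_eq_iff distrib_right
       sum_distrib_left mult.assoc)
  have D: "D (mat_adj (f j)) = f j" for j
  proof -
    have "D (mat_adj (f j)) = (\<Sum>i\<in>UNIV. if j = i then f i else 0)"
      unfolding D_def l2_mat_adj onb_inner[OF f] by (intro sum.cong refl) auto
    then show ?thesis by simp
  qed
  have "partial_map f = D"
    unfolding partial_map_def
  proof (rule the_equality)
    fix E assume E: "mat_linear E \<and> (\<forall>j. E (mat_adj (f j)) = f j)"
    show "E = D"
    proof
      fix b show "E b = D b"
        using E by (subst (1 2) onb_expand[OF onb_mat_adj[OF f], of b]) (simp add: mat_lin lin D)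
    qed
  qed (use lin D in blast)
  then show "mat_linear (partial_map f)" "partial_map f (mat_adj (f j)) = f j"
    using lin D by simp_all
qed

text \<open>
  Since \<open>\<partial>\<close> undoes the adjoints introduced by \<open>\<Psi>\<close>, the operator \<open>T\<close> becomes the tensor
  \<open>\<Sum>\<^sub>j f\<^sub>j \<otimes> T f\<^sub>j\<close>, whose coordinates are the matrix entries of \<open>T\<close> with rows and columns exchanged.
\<close>

lemma pseudo_graph_coords:
  assumes f: "onb f" and A: "mat_linear A"
  shows "coords2 f ` U_tilde f A = (\<lambda>T. \<chi> p. l2 (f (snd p)) (T (f (fst p)))) ` bimodule_span A"
proof -
  have "coords2 f (tensor_map (partial_map f) id (Psi T)) = (\<chi> p. l2 (f (snd p)) (T (f (fst p))))"
    if "T \<in> bimodule_span A" for T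
  proof -
    have "(\<Sum>j\<in>UNIV. (if i = j then 1 else 0) * l2 d (T (f j))) = l2 d (T (f i))" for d i
    proof -
      have "(\<Sum>j\<in>UNIV. (if i = j then 1 else 0) * l2 d (T (f j))) =
        (\<Sum>j\<in>UNIV. if i = j then l2 d (T (f j)) else 0)" by (intro sum.cong refl) auto
      then show ?thesis by simp
    qed
    then show ?thesis
      by (simp add: Psi_onb[OF f bimodule_span_linear[OF A that]] mat_lin[OF mat_linear_tensor_map]
        tensor_map_kron[OF partial_map_onb(1)[OF f] mat_linear_id] partial_map_onb(2)[OF f]
        coords2_def vec_eq_iff l2_sum_right l2_kron onb_inner[OF f])
  qed
  then show ?thesis
    unfolding U_tilde_def image_image by (intro image_cong refl)
qed

section \<open>Operators on a complex Hilbert space\<close>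

instance complex_hilbert \<subseteq> banach ..

lemma scaleC_one [simp]: "1 *\<^sub>C (x::'k::complex_hilbert) = x"
  using scaleC_of_real[of 1 x] by simp

lemma scaleC_zero_left [simp]: "0 *\<^sub>C (x::'k::complex_hilbert) = 0"
  using scaleC_of_real[of 0 x] by simp

lemma scaleC_zero_right [simp]: "c *\<^sub>C (0::'k::complex_hilbert) = 0"
  using scaleC_add_right[of c 0 "0::'k"] by simp

lemma scaleC_sum_left: "sum g S *\<^sub>C (x::'k::complex_hilbert) = (\<Sum>s\<in>S. g s *\<^sub>C x)"
  by (induct S rule: infinite_finite_induct) (simp_all add: scaleC_add_left)

lemma cinner_add_left: "cinner (x + y) (z::'k::complex_hilbert) = cinner x z + cinner y z"
  by (subst (1 2 3) cinner_commute) (simp add: cinner_add_right)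

lemma cinner_scaleC_left: "cinner (c *\<^sub>C x) (y::'k::complex_hilbert) = cnj c * cinner x y"
  by (subst (1 2) cinner_commute) (simp add: cinner_scaleC_right)

lemma cinner_ext:
  assumes "\<And>z. cinner z x = cinner z (y::'k::complex_hilbert)" shows "x = y"
proof -
  have "inner z x = inner z y" for z
    by (simp add: inner_eq_Re_cinner assms)
  then have "inner (x - y) (x - y) = 0" by (simp add: inner_diff_right)
  then show ?thesis by simp
qed

lemma norm_scaleC: "norm (c *\<^sub>C (x::'k::complex_hilbert)) = cmod c * norm x"
proof -
  have n: "(norm y)\<^sup>2 = Re (cinner y y)" for y :: 'k
    by (simp add: power2_norm_eq_inner inner_eq_Re_cinner)
  have "Re (c * (cnj c * z)) = (cmod c)\<^sup>2 * Re z" for z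
    unfolding cmod_power2 by (simp add: power2_eq_square algebra_simps)
  then have "(norm (c *\<^sub>C x))\<^sup>2 = (cmod c)\<^sup>2 * (norm x)\<^sup>2"
    by (simp only: n cinner_scaleC_left cinner_scaleC_right)
  then have "(norm (c *\<^sub>C x))\<^sup>2 = (cmod c * norm x)\<^sup>2" by (simp add: power_mult_distrib)
  then show ?thesis by (rule power2_eq_imp_eq) simp_all
qed

lemma scaleC_scaleR: "c *\<^sub>C r *\<^sub>R (x::'k::complex_hilbert) = r *\<^sub>R c *\<^sub>C x"
  by (simp flip: scaleC_of_real add: scaleC_scaleC mult.commute)

lemma bounded_linear_scaleC: "bounded_linear (\<lambda>x::'k::complex_hilbert. c *\<^sub>C x)"
  by (rule bounded_linear_intro[where K = "cmod c"])
     (simp_all add: scaleC_add_right scaleC_scaleR norm_scaleC)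

lemma op_scale_apply [simp]: "blinfun_apply (op_scale c T) x = c *\<^sub>C blinfun_apply T x"
  unfolding op_scale_def
  by (subst bounded_linear_Blinfun_apply)
     (auto intro: bounded_linear_compose[OF bounded_linear_scaleC] blinfun.bounded_linear_right)

lemma op_scale_add_right: "op_scale c (S + T) = op_scale c S + op_scale c T"
  and op_scale_add_left: "op_scale (c + d) T = op_scale c T + op_scale d T"
  and op_scale_op_scale [simp]: "op_scale c (op_scale d T) = op_scale (c * d) T"
  and op_scale_one [simp]: "op_scale 1 T = T"
  and op_scale_zero_left [simp]: "op_scale 0 T = 0"
  and op_scale_zero_right [simp]: "op_scale c 0 = 0"
  and op_scale_of_real: "op_scale (complex_of_real r) T = r *\<^sub>R T"
  by (rule blinfun_eqI, simp add: blinfun.add_left blinfun.scaleR_left scaleC_add_left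
      scaleC_add_right scaleC_scaleC scaleC_of_real)+

lemma op_scale_sum_right: "op_scale c (sum g S) = (\<Sum>s\<in>S. op_scale c (g s))"
  by (induct S rule: infinite_finite_induct) (simp_all add: op_scale_add_right)

lemma op_scale_sum_left: "op_scale (sum g S) T = (\<Sum>s\<in>S. op_scale (g s) T)"
  by (induct S rule: infinite_finite_induct) (simp_all add: op_scale_add_left)

lemma op_scale_minus: "op_scale (- c) T = - op_scale c T"
  using op_scale_add_left[of "- c" c T] by (simp add: eq_neg_iff_add_eq_0)

lemma norm_op_scale_le: "norm (op_scale c T) \<le> cmod c * norm T"
proof (rule norm_blinfun_bound)
  fix x show "norm (blinfun_apply (op_scale c T) x) \<le> cmod c * norm T * norm x"
    using mult_left_mono[OF norm_blinfun[of T x], of "cmod c"] by (simp add: norm_scaleC mult.assoc)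
qed simp

lemma norm_op_scale: "norm (op_scale c T) = cmod c * norm T"
proof (cases "c = 0")
  case False
  have "cmod c * norm T = cmod c * norm (op_scale (inverse c) (op_scale c T))" using False by simp
  also have "\<dots> \<le> cmod c * (cmod (inverse c) * norm (op_scale c T))"
    by (intro mult_left_mono norm_op_scale_le) simp
  also have "\<dots> = norm (op_scale c T)" using False by (simp add: norm_inverse)
  finally show ?thesis using norm_op_scale_le[of c T] by simp
qed simp

lemmas comp_sum_left = bounded_bilinear.sum_left[OF bounded_bilinear_blinfun_compose]
  and comp_sum_right = bounded_bilinear.sum_right[OF bounded_bilinear_blinfun_compose]
  and comp_add_left = bounded_bilinear.add_left[OF bounded_bilinear_blinfun_compose]
  and comp_add_right = bounded_bilinear.add_right[OF bounded_bilinear_blinfun_compose]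
  and comp_diff_left = bounded_bilinear.diff_left[OF bounded_bilinear_blinfun_compose]
  and comp_minus_left = bounded_bilinear.minus_left[OF bounded_bilinear_blinfun_compose]
  and comp_minus_right = bounded_bilinear.minus_right[OF bounded_bilinear_blinfun_compose]
  and comp_diff_right = bounded_bilinear.diff_right[OF bounded_bilinear_blinfun_compose]

lemma comp_id [simp]: "T o\<^sub>L id_blinfun = T" "id_blinfun o\<^sub>L T = T"
  by (rule blinfun_eqI, simp)+

lemma comp_assoc: "(S o\<^sub>L T) o\<^sub>L R = S o\<^sub>L (T o\<^sub>L R)"
  by (rule blinfun_eqI) simp

lemma op_scale_comp_left: "op_scale c S o\<^sub>L T = op_scale c (S o\<^sub>L T)"
  by (rule blinfun_eqI) simp

lemma bounded_opsD: "T \<in> bounded_ops \<Longrightarrow> blinfun_apply T (c *\<^sub>C x) = c *\<^sub>C blinfun_apply T x"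
  by (simp add: bounded_ops_def)

lemma op_scale_comp_right:
  "S \<in> bounded_ops \<Longrightarrow> S o\<^sub>L op_scale c T = op_scale c (S o\<^sub>L T)"
  by (rule blinfun_eqI) (simp add: bounded_opsD)

lemma op_adj_eqI: assumes "is_op_adj S T" shows "op_adj T = S"
  unfolding op_adj_def
proof (rule the_equality)
  show "is_op_adj S T" by fact
next
  fix R assume "is_op_adj R T"
  with assms have *: "cinner (blinfun_apply R x) y = cinner (blinfun_apply S x) y" for x y
    by (simp add: is_op_adj_def)
  have "cinner y (blinfun_apply R x) = cinner y (blinfun_apply S x)" for x y
    unfolding cinner_commute[of y] * ..
  then have "blinfun_apply R x = blinfun_apply S x" for x by (rule cinner_ext)
  then show "R = S" by (rule blinfun_eqI)
qed

lemma commutantI: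
  "T \<in> bounded_ops \<Longrightarrow> (\<And>S. S \<in> M \<Longrightarrow> T o\<^sub>L S = S o\<^sub>L T) \<Longrightarrow> T \<in> commutant M"
  by (simp add: commutant_def)

lemma commutantD: "T \<in> commutant M \<Longrightarrow> S \<in> M \<Longrightarrow> T o\<^sub>L S = S o\<^sub>L T"
  and commutant_bounded: "T \<in> commutant M \<Longrightarrow> T \<in> bounded_ops"
  by (simp_all add: commutant_def)

text \<open>
  A von Neumann algebra is a commutant, hence norm closed; this keeps limits of represented elements
  in the algebra.
\<close>

lemma closed_commutant: "closed (commutant (M :: 'k::complex_hilbert operator set))"
proof -
  have cB: "closed {T :: 'k operator. blinfun_apply T (c *\<^sub>C x) = c *\<^sub>C blinfun_apply T x}" for c x
  proof (rule closed_Collect_eq)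
    show "continuous_on UNIV (\<lambda>T :: 'k operator. blinfun_apply T (c *\<^sub>C x))"
      by (intro linear_continuous_on blinfun.bounded_linear_left)
    show "continuous_on UNIV (\<lambda>T :: 'k operator. c *\<^sub>C blinfun_apply T x)"
      by (intro linear_continuous_on bounded_linear_compose[OF bounded_linear_scaleC]
          blinfun.bounded_linear_left)
  qed
  have cC: "closed {T :: 'k operator. T o\<^sub>L S = S o\<^sub>L T}" for S
    by (intro closed_Collect_eq linear_continuous_on bounded_linear_intros
        bounded_bilinear.bounded_linear_left[OF bounded_bilinear_blinfun_compose]
        bounded_bilinear.bounded_linear_right[OF bounded_bilinear_blinfun_compose])
  have "commutant M = (\<Inter>c. \<Inter>x. {T. blinfun_apply T (c *\<^sub>C x) = c *\<^sub>C blinfun_apply T x}) \<inter>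
      (\<Inter>S\<in>M. {T. T o\<^sub>L S = S o\<^sub>L T})"
    by (auto simp: commutant_def bounded_ops_def)
  then show ?thesis by (auto intro!: closed_Int closed_INT cB cC)
qed

locale tracial_vn =
  fixes N :: "'k::complex_hilbert operator set" and \<tau> :: "'k operator \<Rightarrow> complex"
  assumes vn: "von_neumann_algebra N" and tr: "faithful_trace N \<tau>"
begin

lemma bdd: "T \<in> N \<Longrightarrow> T \<in> bounded_ops"
  using vn by (auto simp: von_neumann_algebra_def)

lemma N_bicommutant: "commutant (commutant N) = N"
  using vn by (simp add: von_neumann_algebra_def)

lemma adj_is_adj: assumes "T \<in> N" shows "is_op_adj (op_adj T) T"
  and adj_closed [intro, simp]: "op_adj T \<in> N"
proof -
  obtain S where "S \<in> N" "is_op_adj S T" using vn assms by (auto simp: von_neumann_algebra_def)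
  then show "is_op_adj (op_adj T) T" "op_adj T \<in> N" by (simp_all add: op_adj_eqI)
qed

lemma cinner_adj:
  assumes "T \<in> N"
  shows "cinner (blinfun_apply (op_adj T) x) y = cinner x (blinfun_apply T y)"
    and "cinner (blinfun_apply T x) y = cinner x (blinfun_apply (op_adj T) y)"
proof -
  show *: "cinner (blinfun_apply (op_adj T) x) y = cinner x (blinfun_apply T y)" for x y
    using adj_is_adj[OF assms] by (simp add: is_op_adj_def)
  show "cinner (blinfun_apply T x) y = cinner x (blinfun_apply (op_adj T) y)"
    by (subst (1 2) cinner_commute) (simp add: *)
qed

lemma N_closed_ops [intro, simp]:
  shows "0 \<in> N" "id_blinfun \<in> N"
    and "S \<in> N \<Longrightarrow> T \<in> N \<Longrightarrow> S + T \<in> N"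
    and "S \<in> N \<Longrightarrow> op_scale c S \<in> N"
    and "S \<in> N \<Longrightarrow> T \<in> N \<Longrightarrow> S o\<^sub>L T \<in> N"
proof -
  let ?C = "commutant (commutant N)"
  have C: "commutant N \<subseteq> bounded_ops" by (auto dest: commutant_bounded)
  have "0 \<in> ?C" by (rule commutantI) (simp_all add: bounded_ops_def)
  moreover have "id_blinfun \<in> ?C" by (rule commutantI) (simp_all add: bounded_ops_def)
  moreover have "S + T \<in> ?C" if "S \<in> ?C" "T \<in> ?C" for S T
    using that by (intro commutantI)
      (auto simp: comp_add_left comp_add_right commutantD bounded_ops_def scaleC_add_right
        blinfun.add_left bounded_opsD[OF commutant_bounded])
  moreover have "op_scale c S \<in> ?C" if "S \<in> ?C" for S
  proof (rule commutantI)
    show "op_scale c S \<in> bounded_ops"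
      by (simp add: bounded_ops_def bounded_opsD[OF commutant_bounded[OF that]] scaleC_scaleC mult.commute)
    fix R assume "R \<in> commutant N"
    then show "op_scale c S o\<^sub>L R = R o\<^sub>L op_scale c S"
      using commutantD[OF that] C by (auto simp: op_scale_comp_left op_scale_comp_right)
  qed
  moreover have "S o\<^sub>L T \<in> ?C" if S: "S \<in> ?C" and T: "T \<in> ?C" for S T
  proof (rule commutantI)
    show "S o\<^sub>L T \<in> bounded_ops"
      by (simp add: bounded_ops_def bounded_opsD[OF commutant_bounded[OF S]]
          bounded_opsD[OF commutant_bounded[OF T]])
    fix R assume R: "R \<in> commutant N"
    have "S o\<^sub>L T o\<^sub>L R = S o\<^sub>L (R o\<^sub>L T)" by (simp add: comp_assoc commutantD[OF T R])
    also have "\<dots> = R o\<^sub>L S o\<^sub>L T" by (simp add: commutantD[OF S R] flip: comp_assoc)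
    finally show "S o\<^sub>L T o\<^sub>L R = R o\<^sub>L (S o\<^sub>L T)" by (simp add: comp_assoc)
  qed
  ultimately show "0 \<in> N" "id_blinfun \<in> N" "S \<in> N \<Longrightarrow> T \<in> N \<Longrightarrow> S + T \<in> N"
    "S \<in> N \<Longrightarrow> op_scale c S \<in> N" "S \<in> N \<Longrightarrow> T \<in> N \<Longrightarrow> S o\<^sub>L T \<in> N"
    unfolding N_bicommutant by blast+
qed

lemma N_sum [intro, simp]: "(\<And>s. s \<in> I \<Longrightarrow> g s \<in> N) \<Longrightarrow> sum g I \<in> N"
  by (induct I rule: infinite_finite_induct) auto

lemma N_uminus [intro, simp]: "T \<in> N \<Longrightarrow> - T \<in> N"
  using N_closed_ops(4)[of T "-1"] by (simp add: op_scale_minus)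

lemma N_diff [intro, simp]: "S \<in> N \<Longrightarrow> T \<in> N \<Longrightarrow> S - T \<in> N"
  using N_closed_ops(3)[of S "- T"] by simp

lemma closed_N: "closed N"
  using closed_commutant[of "commutant N"] by (simp add: N_bicommutant)

lemma adj_id [simp]: "op_adj (id_blinfun :: 'k operator) = id_blinfun"
  by (rule op_adj_eqI) (simp add: is_op_adj_def)

lemma adj_adj [simp]: "T \<in> N \<Longrightarrow> op_adj (op_adj T) = T"
  by (rule op_adj_eqI) (simp add: is_op_adj_def cinner_adj)

lemma adj_add: "S \<in> N \<Longrightarrow> T \<in> N \<Longrightarrow> op_adj (S + T) = op_adj S + op_adj T"
  by (rule op_adj_eqI)
     (simp add: is_op_adj_def cinner_adj blinfun.add_left cinner_add_left cinner_add_right)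

lemma adj_scale: "T \<in> N \<Longrightarrow> op_adj (op_scale c T) = op_scale (cnj c) (op_adj T)"
  by (rule op_adj_eqI)
     (simp add: is_op_adj_def cinner_adj cinner_scaleC_left cinner_scaleC_right)

lemma adj_comp: "S \<in> N \<Longrightarrow> T \<in> N \<Longrightarrow> op_adj (S o\<^sub>L T) = op_adj T o\<^sub>L op_adj S"
  by (rule op_adj_eqI) (simp add: is_op_adj_def cinner_adj)

lemma adj_zero [simp]: "op_adj (0 :: 'k operator) = 0"
  using adj_scale[of 0 0] by simp

lemma adj_sum: "(\<And>s. s \<in> I \<Longrightarrow> g s \<in> N) \<Longrightarrow> op_adj (sum g I) = (\<Sum>s\<in>I. op_adj (g s))"
  by (induct I rule: infinite_finite_induct) (simp_all add: adj_add)

lemma adj_diff: "S \<in> N \<Longrightarrow> T \<in> N \<Longrightarrow> op_adj (S - T) = op_adj S - op_adj T"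
  using adj_add[of S "op_scale (-1) T"] adj_scale[of T "-1"] by (simp add: op_scale_minus)

lemma norm_adj_comp: assumes "T \<in> N" shows "norm (op_adj T o\<^sub>L T) = (norm T)\<^sup>2"
  and norm_adj: "norm (op_adj T) = norm T"
proof -
  have sq: "(norm T)\<^sup>2 \<le> norm (op_adj T o\<^sub>L T)" if T: "T \<in> N" for T
  proof -
    have "norm T \<le> sqrt (norm (op_adj T o\<^sub>L T))"
    proof (rule norm_blinfun_bound)
      fix x
      have "(norm (blinfun_apply T x))\<^sup>2 = inner x (blinfun_apply (op_adj T o\<^sub>L T) x)"
        by (simp add: power2_norm_eq_inner inner_eq_Re_cinner cinner_adj(2)[OF T])
      also have "\<dots> \<le> norm x * norm (blinfun_apply (op_adj T o\<^sub>L T) x)" by (rule norm_cauchy_schwarz)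
      also have "\<dots> \<le> norm x * (norm (op_adj T o\<^sub>L T) * norm x)"
        by (intro mult_left_mono norm_blinfun norm_ge_zero)
      also have "\<dots> = (sqrt (norm (op_adj T o\<^sub>L T)) * norm x)\<^sup>2"
        by (simp add: power_mult_distrib power2_eq_square)
      finally show "norm (blinfun_apply T x) \<le> sqrt (norm (op_adj T o\<^sub>L T)) * norm x"
        by (rule power2_le_imp_le) simp
    qed simp
    then have "(norm T)\<^sup>2 \<le> (sqrt (norm (op_adj T o\<^sub>L T)))\<^sup>2" by (rule power_mono) simp
    then show ?thesis by simp
  qed
  have le: "norm T \<le> norm (op_adj T)" if T: "T \<in> N" for T
  proof (cases "norm T = 0")
    case False
    have "norm T * norm T \<le> norm (op_adj T) * norm T"
      using sq[OF T] norm_blinfun_compose[of "op_adj T" T] by (simp add: power2_eq_square)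
    with False show ?thesis by (simp add: mult_le_cancel_right)
  qed simp
  show n: "norm (op_adj T) = norm T"
    using le[OF assms] le[OF adj_closed[OF assms]] assms by simp
  have "norm (op_adj T o\<^sub>L T) \<le> (norm T)\<^sup>2"
    using norm_blinfun_compose[of "op_adj T" T] n by (simp add: power2_eq_square)
  with sq[OF assms] show "norm (op_adj T o\<^sub>L T) = (norm T)\<^sup>2" by simp
qed

lemma trace_add: "S \<in> N \<Longrightarrow> T \<in> N \<Longrightarrow> \<tau> (S + T) = \<tau> S + \<tau> T"
  and trace_scale: "T \<in> N \<Longrightarrow> \<tau> (op_scale c T) = c * \<tau> T"
  and trace_pos: "T \<in> N \<Longrightarrow> \<tau> (op_adj T o\<^sub>L T) \<in> \<real>\<^sub>\<ge>\<^sub>0"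
  and trace_comm: "S \<in> N \<Longrightarrow> T \<in> N \<Longrightarrow> \<tau> (S o\<^sub>L T) = \<tau> (T o\<^sub>L S)"
  and trace_faithful: "T \<in> N \<Longrightarrow> \<tau> (op_adj T o\<^sub>L T) = 0 \<Longrightarrow> T = 0"
  using tr by (auto simp: faithful_trace_def)

lemma trace_zero [simp]: "\<tau> 0 = 0"
  using trace_scale[of 0 0] by simp

lemma trace_sum: "(\<And>s. s \<in> I \<Longrightarrow> g s \<in> N) \<Longrightarrow> \<tau> (sum g I) = (\<Sum>s\<in>I. \<tau> (g s))"
  by (induct I rule: infinite_finite_induct) (simp_all add: trace_add)

lemma trace_faithful_sum:
  assumes "finite I" and S: "\<And>s. s \<in> I \<Longrightarrow> S s \<in> N"
    and z: "(\<Sum>s\<in>I. \<tau> (op_adj (S s) o\<^sub>L S s)) = 0" and s: "s \<in> I"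
  shows "S s = 0"
proof (rule trace_faithful[OF S[OF s]])
  let ?t = "\<lambda>s. \<tau> (op_adj (S s) o\<^sub>L S s)"
  have nn: "0 \<le> Re (?t s)" "Im (?t s) = 0" if "s \<in> I" for s
    using trace_pos[OF S[OF that]] by (simp_all add: complex_nonneg_Reals_iff)
  have "(\<Sum>s\<in>I. Re (?t s)) = 0" using arg_cong[OF z, of Re] by simp
  then have "\<forall>s\<in>I. Re (?t s) = 0"
    by (subst (asm) sum_nonneg_eq_0_iff) (fact assms(1), fact nn(1))
  then have "Re (?t s) = 0" using s by (rule bspec)
  with nn(2)[OF s] show "?t s = 0" by (simp add: complex_eq_iff)
qed

lemma trace_expand:
  fixes S :: "'p \<Rightarrow> 'k operator"
  assumes "\<And>p. S p \<in> N"
  shows "\<tau> (op_adj (\<Sum>p\<in>I. op_scale (\<beta> p) (S p)) o\<^sub>L (\<Sum>p\<in>I. op_scale (\<beta> p) (S p))) =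
    (\<Sum>p\<in>I. \<Sum>q\<in>I. cnj (\<beta> p) * \<beta> q * \<tau> (op_adj (S p) o\<^sub>L S q))"
  by (simp add: adj_sum adj_scale assms comp_sum_left comp_sum_right op_scale_comp_left
      op_scale_comp_right bdd trace_sum trace_scale) (rule sum.swap)

end

section \<open>Orthogonal projections and perfect strategies\<close>

definition cdot :: "complex^'n \<Rightarrow> complex^'n \<Rightarrow> complex" where
  "cdot v w = (\<Sum>p\<in>UNIV. cnj (v$p) * w$p)"

definition csubspace :: "(complex^'n) set \<Rightarrow> bool" where
  "csubspace W \<longleftrightarrow> 0 \<in> W \<and> (\<forall>v\<in>W. \<forall>w\<in>W. v + w \<in> W) \<and> (\<forall>c. \<forall>v\<in>W. c *s v \<in> W)"

lemma cdot_add_right: "cdot v (w + w') = cdot v w + cdot v w'"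
  by (simp add: cdot_def sum.distrib distrib_left)

lemma cdot_diff_right: "cdot v (w - w') = cdot v w - cdot v w'"
  by (simp add: cdot_def sum_subtractf right_diff_distrib)

lemma cdot_scale_right: "cdot v (c *s w) = c * cdot v w"
  by (simp add: cdot_def sum_distrib_left mult.left_commute)

lemma cdot_scale_left: "cdot (c *s v) w = cnj c * cdot v w"
  by (simp add: cdot_def sum_distrib_left mult.assoc)

lemma cnj_cdot: "cnj (cdot v w) = cdot w v"
  by (simp add: cdot_def mult.commute)

lemma inner_eq_Re_cdot: "inner v w = Re (cdot v w)"
  by (simp add: cdot_def inner_vec_def inner_complex_def)

lemma cdot_self_eq_0: assumes "cdot v v = 0" shows "v = 0"
proof -
  have "inner v v = 0" unfolding inner_eq_Re_cdot assms by simp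
  then show ?thesis by simp
qed

lemma cdot_matrix: "cdot (a *v v) w = cdot v (mat_adj a *v w)"
proof -
  have "cdot (a *v v) w = (\<Sum>i\<in>UNIV. \<Sum>j\<in>UNIV. cnj (a$i$j) * cnj (v$j) * w$i)"
    by (simp add: cdot_def matrix_vector_mult_def sum_distrib_right)
  also have "\<dots> = (\<Sum>j\<in>UNIV. \<Sum>i\<in>UNIV. cnj (a$i$j) * cnj (v$j) * w$i)"
    by (rule sum.swap)
  also have "\<dots> = cdot v (mat_adj a *v w)"
    by (simp add: cdot_def matrix_vector_mult_def sum_distrib_left mult_ac)
  finally show ?thesis .
qed

lemma cdot_axis: "cdot (axis i 1) w = w$i"
proof -
  have "cdot (axis i 1) w = (\<Sum>p\<in>UNIV. if p = i then w$p else 0)"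
    unfolding cdot_def by (intro sum.cong refl) (simp add: axis_def)
  then show ?thesis by simp
qed

text \<open>
  The orthogonal component for the real inner product will do: real orthogonality to \<open>w\<close> and to
  \<open>\<i> w\<close> together is complex orthogonality to \<open>w\<close>.
\<close>

lemma orthogonal_component_exists:
  assumes W: "csubspace W"
  shows "\<exists>y\<in>W. \<forall>w\<in>W. cdot w (x - y) = 0"
proof -
  have "c *\<^sub>R v = complex_of_real c *s v" for c and v :: "complex^'a"
    by (simp add: vec_eq_iff) (simp add: scaleR_conv_of_real)
  then have "subspace W" using W by (auto simp: subspace_def csubspace_def)
  then have span: "span W = W" by (rule span_eq_iff[THEN iffD2])
  obtain y z where y: "y \<in> W" and z: "\<And>w. w \<in> W \<Longrightarrow> orthogonal z w" and x: "x = y + z"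
    using orthogonal_subspace_decomp_exists[of W x] unfolding span by blast
  have "cdot w z = 0" if w: "w \<in> W" for w
  proof -
    have iw: "\<i> *s w \<in> W" using W w by (simp add: csubspace_def)
    have re: "Re (cdot v z) = 0" if "v \<in> W" for v
      using z[OF that] unfolding orthogonal_def by (subst (asm) inner_commute) (simp only: inner_eq_Re_cdot)
    have "Re (cdot w z) = 0" by (rule re[OF w])
    moreover have "Re (cdot (\<i> *s w) z) = 0" by (rule re[OF iw])
    then have "Im (cdot w z) = 0" by (simp add: cdot_scale_left)
    ultimately show ?thesis by (simp add: complex_eq_iff)
  qed
  then show ?thesis using y x by (intro bexI[of _ y]) auto
qed

text \<open>
  Uniqueness of the orthogonal component makes \<open>p\<close> linear.
\<close>

lemma projection_matrix_exists:
  assumes W: "csubspace (W :: (complex^'n) set)"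
  shows "\<exists>P. mat_adj P = P \<and> P ** P = P \<and> range ((*v) P) = W"
proof -
  have add: "\<And>v w. v \<in> W \<Longrightarrow> w \<in> W \<Longrightarrow> v + w \<in> W" and scale: "\<And>c v. v \<in> W \<Longrightarrow> c *s v \<in> W"
    using W by (auto simp: csubspace_def)
  have diff: "v - w \<in> W" if "v \<in> W" "w \<in> W" for v w
    using add[OF that(1) scale[OF that(2), of "-1"]] by simp
  have "\<forall>x. \<exists>y. y \<in> W \<and> (\<forall>w\<in>W. cdot w (x - y) = 0)"
    using orthogonal_component_exists[OF W] by blast
  from choice[OF this] obtain p where p: "\<And>x. p x \<in> W"
    and orth: "\<And>x w. w \<in> W \<Longrightarrow> cdot w (x - p x) = 0"
    by blast
  have uniq: "p x = y" if y: "y \<in> W" "\<And>w. w \<in> W \<Longrightarrow> cdot w (x - y) = 0" for x y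
  proof -
    have d: "p x - y \<in> W" using diff p y by blast
    have "cdot (p x - y) (p x - y) = cdot (p x - y) (x - y) - cdot (p x - y) (x - p x)"
      by (simp add: cdot_diff_right)
    then have "cdot (p x - y) (p x - y) = 0" using orth[OF d] y(2)[OF d] by simp
    then have "p x - y = 0" by (rule cdot_self_eq_0)
    then show ?thesis by simp
  qed
  have "p (x + y) = p x + p y" for x y
  proof (rule uniq)
    fix w assume w: "w \<in> W"
    have "cdot w (x + y - (p x + p y)) = cdot w (x - p x) + cdot w (y - p y)"
      by (simp add: cdot_diff_right cdot_add_right)
    then show "cdot w (x + y - (p x + p y)) = 0" using orth[OF w] by simp
  qed (simp add: add p)
  moreover have "p (c *s x) = c *s p x" for c x
  proof (rule uniq)
    fix w assume w: "w \<in> W"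
    have "cdot w (c *s x - c *s p x) = c * cdot w (x - p x)"
      by (simp add: cdot_diff_right cdot_scale_right right_diff_distrib)
    then show "cdot w (c *s x - c *s p x) = 0" using orth[OF w] by simp
  qed (simp add: scale p)
  ultimately have "Vector_Spaces.linear (*s) (*s) p" by (simp add: Vector_Spaces.linear_iff vec.vector_space_axioms)
  then have P: "matrix p *v x = p x" for x by (rule matrix_works)
  have fix_W: "p w = w" if "w \<in> W" for w
    by (rule uniq[OF that]) (simp add: cdot_def)
  have self_adj: "cdot x (p y) = cdot (p x) y" for x y
  proof -
    have "cdot (p y) (x - p x) = 0" "cdot (p x) (y - p y) = 0" using orth p by blast+
    then have "cdot (p y) x = cdot (p y) (p x)" and e: "cdot (p x) y = cdot (p x) (p y)"
      by (simp_all add: cdot_diff_right)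
    from arg_cong[OF this(1), of cnj] have "cdot x (p y) = cdot (p x) (p y)"
      by (simp only: cnj_cdot)
    with e show ?thesis by simp
  qed
  have herm: "p (axis j 1)$i = cnj (p (axis i 1)$j)" for i j
  proof -
    have "p (axis j 1)$i = cdot (p (axis i 1)) (axis j 1)"
      by (simp only: cdot_axis flip: self_adj)
    also have "\<dots> = cnj (cdot (axis j 1) (p (axis i 1)))" by (simp only: cnj_cdot)
    finally show ?thesis by (simp only: cdot_axis)
  qed
  have "mat_adj (matrix p) = matrix p"
    unfolding vec_eq_iff
    by (intro allI) (simp only: mat_adj_nth matrix_def vec_lambda_beta herm[symmetric])
  moreover have "matrix p ** matrix p = matrix p"
    unfolding matrix_eq by (simp add: P fix_W p flip: matrix_vector_mul_assoc)
  moreover have "range ((*v) (matrix p)) = W"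
  proof
    show "range ((*v) (matrix p)) \<subseteq> W" using P p by auto
    show "W \<subseteq> range ((*v) (matrix p))"
    proof
      fix w assume "w \<in> W"
      then have "w = matrix p *v w" by (simp add: P fix_W)
      then show "w \<in> range ((*v) (matrix p))" by (rule range_eqI)
    qed
  qed
  ultimately show ?thesis by blast
qed

text \<open>
  If \<open>P\<close> and \<open>R\<close> are projections with the same range, then \<open>P R = R\<close> and \<open>R P = P\<close>, and taking adjoints
  gives \<open>P = R\<close>; so the definite description denotes.
\<close>

lemma proj_onto:
  assumes W: "csubspace W"
  shows proj_onto_selfadj: "mat_adj (proj_onto W) = proj_onto W"
    and proj_onto_fixes: "w \<in> W \<Longrightarrow> proj_onto W *v w = w"
    and proj_onto_orthogonal: "(\<And>w. w \<in> W \<Longrightarrow> cdot w x = 0) \<Longrightarrow> proj_onto W *v x = 0"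
proof -
  let ?Q = "\<lambda>P. mat_adj P = P \<and> P ** P = P \<and> range ((*v) P) = W"
  have fixes_range: "P *v w = w" if P: "?Q P" and w: "w \<in> W" for P w
  proof -
    obtain v where "w = P *v v" using P w by blast
    then show ?thesis using P by (simp add: matrix_vector_mul_assoc)
  qed
  have comp: "P ** R = R" if "?Q P" "?Q R" for P R
    unfolding matrix_eq
  proof
    fix x
    have "R *v x \<in> W" using that(2) by blast
    then show "P ** R *v x = R *v x" using fixes_range[OF that(1)] by (simp flip: matrix_vector_mul_assoc)
  qed
  have uniq: "P = R" if P: "?Q P" and R: "?Q R" for P R
  proof -
    have "P ** R = mat_adj (R ** P)" using P R by (simp add: mat_adj_mult)
    then show ?thesis using comp[OF P R] comp[OF R P] P by simp
  qed
  obtain P where P: "?Q P" using projection_matrix_exists[OF W] by blast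
  have Q: "?Q (proj_onto W)"
    unfolding proj_onto_def by (rule theI[of ?Q, OF P]) (rule uniq[OF _ P])
  then show "mat_adj (proj_onto W) = proj_onto W" by blast
  show "w \<in> W \<Longrightarrow> proj_onto W *v w = w" by (rule fixes_range[OF Q])
  assume x: "\<And>w. w \<in> W \<Longrightarrow> cdot w x = 0"
  have W': "proj_onto W *v v \<in> W" for v using Q by blast
  have "cdot (proj_onto W *v x) (proj_onto W *v x) = cdot (proj_onto W *v (proj_onto W *v x)) x"
    using Q by (simp add: cdot_matrix)
  also have "\<dots> = 0" by (rule x[OF W'])
  finally show "proj_onto W *v x = 0" by (rule cdot_self_eq_0)
qed

text \<open>
  The strategy is tested on the rank-one matrix \<open>\<zeta>\<zeta>\<^sup>*\<close>.
\<close>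

lemma perfect_strategy_orthogonal:
  assumes perf: "perfect_strategy \<Gamma> W\<^sub>1 W\<^sub>2" and W: "csubspace W\<^sub>1" "csubspace W\<^sub>2"
    and \<zeta>: "\<zeta> \<in> W\<^sub>1" and \<eta>: "\<And>w. w \<in> W\<^sub>2 \<Longrightarrow> cdot w \<eta> = 0"
  shows "cdot \<eta> (\<Gamma> (\<chi> p q. \<zeta>$p * cnj (\<zeta>$q)) *v \<eta>) = 0"
proof -
  define \<omega> where "\<omega> = (\<chi> p q. \<zeta>$p * cnj (\<zeta>$q))"
  let ?P = "proj_onto W\<^sub>1" and ?R = "proj_onto W\<^sub>2"
  have apply_\<omega>: "\<omega> *v v = cdot \<zeta> v *s \<zeta>" for v
    by (simp add: \<omega>_def cdot_def matrix_vector_mult_def vec_eq_iff sum_distrib_left mult_ac)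
  have psd: "psd \<omega>"
    unfolding psd_def
  proof
    fix v
    have "(\<Sum>p\<in>UNIV. \<Sum>q\<in>UNIV. cnj (v$p) * \<omega>$p$q * v$q) = cdot v (\<omega> *v v)"
      by (simp add: cdot_def matrix_vector_mult_def sum_distrib_left mult.assoc)
    also have "\<dots> = cdot \<zeta> v * cnj (cdot \<zeta> v)" by (simp add: apply_\<omega> cdot_scale_right cnj_cdot)
    also have "\<dots> = complex_of_real ((cmod (cdot \<zeta> v))\<^sup>2)" by (rule complex_norm_square[symmetric])
    finally show "(\<Sum>p\<in>UNIV. \<Sum>q\<in>UNIV. cnj (v$p) * \<omega>$p$q * v$q) \<in> \<real>\<^sub>\<ge>\<^sub>0" by simp
  qed
  have "\<omega> = ?P ** \<omega> ** ?P"
    unfolding matrix_eq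
  proof
    fix v
    have "cdot \<zeta> (?P *v v) = cdot \<zeta> v"
      using cdot_matrix[of ?P \<zeta> v] by (simp add: proj_onto_fixes[OF W(1) \<zeta>] proj_onto_selfadj[OF W(1)])
    then show "\<omega> *v v = ?P ** \<omega> ** ?P *v v"
      by (simp add: apply_\<omega> vec.scale proj_onto_fixes[OF W(1) \<zeta>] flip: matrix_vector_mul_assoc)
  qed
  then have "\<Gamma> \<omega> = ?R ** \<Gamma> \<omega> ** ?R" using perf psd unfolding perfect_strategy_def by blast
  then have "\<Gamma> \<omega> *v \<eta> = ?R ** \<Gamma> \<omega> ** ?R *v \<eta>" by simp
  also have "\<dots> = 0"
    by (simp add: proj_onto_orthogonal[OF W(2) \<eta>] flip: matrix_vector_mul_assoc)
  finally show ?thesis unfolding \<omega>_def by (simp add: cdot_def)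
qed

lemma lift_bimat_entry:
  fixes t :: "'i::finite \<Rightarrow> 'i \<Rightarrow> 'i \<Rightarrow> 'i \<Rightarrow> 'i \<Rightarrow> 'i \<Rightarrow> 'i \<Rightarrow> 'i \<Rightarrow> complex"
  shows "lift_bimat (\<lambda>i i' j j'. \<Sum>k\<in>UNIV. \<Sum>k'\<in>UNIV. \<Sum>l\<in>UNIV. \<Sum>l'\<in>UNIV.
       t i i' j j' k k' l l' *\<^sub>m kron (matunit k k') (matunit l l')) \<omega>$p$q =
     (\<Sum>r\<in>UNIV. \<Sum>s\<in>UNIV. \<omega>$r$s *
        t (fst r) (fst s) (snd r) (snd s) (fst p) (fst q) (snd p) (snd q))"
proof -
  have delta: "(\<Sum>k\<in>UNIV. \<Sum>k'\<in>UNIV. \<Sum>l\<in>UNIV. \<Sum>l'\<in>UNIV.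
       g k k' l l' *\<^sub>m kron (matunit k k') (matunit l l'))$p$q = g (fst p) (fst q) (snd p) (snd q)"
    for g :: "'i \<Rightarrow> 'i \<Rightarrow> 'i \<Rightarrow> 'i \<Rightarrow> complex"
  proof -
    have "(\<Sum>k\<in>UNIV. \<Sum>k'\<in>UNIV. \<Sum>l\<in>UNIV. \<Sum>l'\<in>UNIV.
       g k k' l l' *\<^sub>m kron (matunit k k') (matunit l l'))$p$q =
      (\<Sum>k\<in>UNIV. \<Sum>k'\<in>UNIV. \<Sum>l\<in>UNIV. \<Sum>l'\<in>UNIV.
        if snd q = l' then (if snd p = l then (if fst q = k' then (if fst p = k then
          g k k' l l' else 0) else 0) else 0) else 0)"
      unfolding sum_nth2 by (intro sum.cong refl) simp
    also have "\<dots> = (\<Sum>k\<in>UNIV. \<Sum>k'\<in>UNIV. \<Sum>l\<in>UNIV.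
        if snd p = l then (if fst q = k' then (if fst p = k then
          g k k' l (snd q) else 0) else 0) else 0)"
      by simp
    also have "\<dots> = (\<Sum>k\<in>UNIV. \<Sum>k'\<in>UNIV.
        if fst q = k' then (if fst p = k then g k k' (snd p) (snd q) else 0) else 0)"
      by simp
    also have "\<dots> = g (fst p) (fst q) (snd p) (snd q)" by simp
    finally show ?thesis .
  qed
  have "lift_bimat (\<lambda>i i' j j'. \<Sum>k\<in>UNIV. \<Sum>k'\<in>UNIV. \<Sum>l\<in>UNIV. \<Sum>l'\<in>UNIV.
       t i i' j j' k k' l l' *\<^sub>m kron (matunit k k') (matunit l l')) \<omega>$p$q =
      (\<Sum>i\<in>UNIV. \<Sum>i'\<in>UNIV. \<Sum>j\<in>UNIV. \<Sum>j'\<in>UNIV. \<omega>$(i, j)$(i', j') *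
        t i i' j j' (fst p) (fst q) (snd p) (snd q))"
    unfolding lift_bimat_def by (simp only: sum_nth2 cscale_nth delta[unfolded sum_nth2 cscale_nth])
  also have "\<dots> = (\<Sum>i\<in>UNIV. \<Sum>j\<in>UNIV. \<Sum>i'\<in>UNIV. \<Sum>j'\<in>UNIV. \<omega>$(i, j)$(i', j') *
        t i i' j j' (fst p) (fst q) (snd p) (snd q))"
    by (rule sum.cong[OF refl], rule sum.swap)
  finally show ?thesis by (simp add: sum_UNIV_prod)
qed

context tracial_vn
begin

text \<open>
  The quadratic form of the output at \<open>\<eta>\<close> is a Gram expression \<open>\<tau>(B\<^sup>* B)\<close>, where \<open>B\<close> is the sum in
  the conclusion; it vanishes for a perfect strategy, and the trace is faithful.
\<close>

lemma perfect_strategy_annihilates: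
  fixes S :: "'i::finite \<Rightarrow> 'i \<Rightarrow> 'i \<Rightarrow> 'i \<Rightarrow> 'k operator"
  assumes perf: "perfect_strategy (lift_bimat (\<lambda>i i' j j'. \<Sum>k\<in>UNIV. \<Sum>k'\<in>UNIV. \<Sum>l\<in>UNIV. \<Sum>l'\<in>UNIV.
       \<tau> (op_adj (S k i l j) o\<^sub>L S k' i' l' j') *\<^sub>m kron (matunit k k') (matunit l l'))) W\<^sub>1 W\<^sub>2"
    and W: "csubspace W\<^sub>1" "csubspace W\<^sub>2"
    and S: "\<And>k i l j. S k i l j \<in> N"
    and \<zeta>: "\<zeta> \<in> W\<^sub>1" and \<eta>: "\<And>w. w \<in> W\<^sub>2 \<Longrightarrow> cdot w \<eta> = 0"
  shows "(\<Sum>k\<in>UNIV. \<Sum>l\<in>UNIV. \<Sum>i\<in>UNIV. \<Sum>j\<in>UNIV.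
       op_scale (\<eta>$(k, l) * cnj (\<zeta>$(i, j))) (S k i l j)) = 0"
proof -
  define \<beta> where "\<beta> P = \<eta>$fst P * cnj (\<zeta>$snd P)" for P :: "('i \<times> 'i) \<times> ('i \<times> 'i)"
  define V where "V P = S (fst (fst P)) (fst (snd P)) (snd (fst P)) (snd (snd P))"
    for P :: "('i \<times> 'i) \<times> ('i \<times> 'i)"
  define B where "B = (\<Sum>P\<in>UNIV. op_scale (\<beta> P) (V P))"
  have V: "V P \<in> N" for P by (simp add: V_def S)
  have pairs: "(\<Sum>P\<in>UNIV. h P) = (\<Sum>p\<in>UNIV. \<Sum>r\<in>UNIV. h (p, r))"
    for h :: "('i \<times> 'i) \<times> ('i \<times> 'i) \<Rightarrow> complex"
    by (rule sum_UNIV_prod)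
  have "\<tau> (op_adj B o\<^sub>L B) = (\<Sum>P\<in>UNIV. \<Sum>Q\<in>UNIV. cnj (\<beta> P) * \<beta> Q * \<tau> (op_adj (V P) o\<^sub>L V Q))"
    unfolding B_def by (rule trace_expand) (rule V)
  also have "\<dots> = (\<Sum>p\<in>UNIV. \<Sum>r\<in>UNIV. \<Sum>q\<in>UNIV. \<Sum>s\<in>UNIV. cnj (\<eta>$p) * (\<zeta>$r * cnj (\<zeta>$s) *
      \<tau> (op_adj (V (p, r)) o\<^sub>L V (q, s))) * \<eta>$q)"
    unfolding pairs by (simp add: \<beta>_def mult_ac)
  also have "\<dots> = (\<Sum>p\<in>UNIV. \<Sum>q\<in>UNIV. \<Sum>r\<in>UNIV. \<Sum>s\<in>UNIV. cnj (\<eta>$p) * (\<zeta>$r * cnj (\<zeta>$s) *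
      \<tau> (op_adj (V (p, r)) o\<^sub>L V (q, s))) * \<eta>$q)"
    by (rule sum.cong[OF refl], rule sum.swap)
  also have "\<dots> = cdot \<eta> (lift_bimat (\<lambda>i i' j j'. \<Sum>k\<in>UNIV. \<Sum>k'\<in>UNIV. \<Sum>l\<in>UNIV. \<Sum>l'\<in>UNIV.
       \<tau> (op_adj (S k i l j) o\<^sub>L S k' i' l' j') *\<^sub>m kron (matunit k k') (matunit l l'))
      (\<chi> p q. \<zeta>$p * cnj (\<zeta>$q)) *v \<eta>)"
    unfolding cdot_def matrix_vector_mult_def
    by (simp only: vec_lambda_beta lift_bimat_entry sum_distrib_left sum_distrib_right V_def fst_conv
        snd_conv mult.assoc)
  also have "\<dots> = 0" by (rule perfect_strategy_orthogonal[OF perf W \<zeta> \<eta>])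
  finally have "B = 0" using trace_faithful[of B] V unfolding B_def by blast
  then show ?thesis
    by (simp add: B_def sum_UNIV_prod \<beta>_def V_def)
qed

end

section \<open>Unitary matrices over a tracial von Neumann algebra\<close>

lemma sum_swap_pairs:
  "(\<Sum>a\<in>UNIV. \<Sum>b\<in>UNIV. \<Sum>c\<in>UNIV. \<Sum>d\<in>UNIV. g (a::'a::finite) (b::'b::finite) (c::'c::finite) (d::'d::finite)) =
   (\<Sum>c\<in>UNIV. \<Sum>d\<in>UNIV. \<Sum>a\<in>UNIV. \<Sum>b\<in>UNIV. g a b c d)"
proof -
  have "(\<Sum>p\<in>UNIV. \<Sum>q\<in>UNIV. g (fst p) (snd p) (fst q) (snd q)) =
      (\<Sum>q\<in>UNIV. \<Sum>p\<in>UNIV. g (fst p) (snd p) (fst q) (snd q))"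
    by (rule sum.swap)
  then show ?thesis by (simp add: sum_UNIV_prod)
qed

lemma sum_delta_op:
  fixes i :: "'i::finite"
  shows "(\<Sum>j\<in>UNIV. op_scale (g j) (if i = j then T j else 0)) = op_scale (g i) (T i)"
    and "(\<Sum>j\<in>UNIV. op_scale (g j) (if j = i then T j else 0)) = op_scale (g i) (T i)"
proof -
  have "(\<Sum>j\<in>UNIV. op_scale (g j) (if i = j then T j else 0)) =
      (\<Sum>j\<in>UNIV. if i = j then op_scale (g j) (T j) else 0)"
    by (intro sum.cong refl) simp
  then show "(\<Sum>j\<in>UNIV. op_scale (g j) (if i = j then T j else 0)) = op_scale (g i) (T i)" by simp
  then show "(\<Sum>j\<in>UNIV. op_scale (g j) (if j = i then T j else 0)) = op_scale (g i) (T i)"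
    by (simp add: eq_commute)
qed

locale bi_unitary_vn = tracial_vn N \<tau> for N :: "'k::complex_hilbert operator set" and \<tau> +
  fixes u :: "'i::finite \<Rightarrow> 'i \<Rightarrow> 'k operator"
  assumes uN [simp]: "\<And>i j. u i j \<in> N" and bi: "bi_unitary u"
begin

lemma columns: "(\<Sum>k\<in>UNIV. op_adj (u k i) o\<^sub>L u k j) = (if i = j then id_blinfun else 0)"
  and columns': "(\<Sum>k\<in>UNIV. u k i o\<^sub>L op_adj (u k j)) = (if i = j then id_blinfun else 0)"
  using bi by (simp_all add: bi_unitary_def unitary_entries_def)

lemma bdd_u [simp]: "u i j \<in> bounded_ops" "op_adj (u i j) \<in> bounded_ops"
  by (simp_all add: bdd)

text \<open>
  A vector fixed by a unitary is fixed by its adjoint.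
\<close>

lemma fixed_vector_adj:
  assumes c: "\<And>k. (\<Sum>i\<in>UNIV. op_scale (c i) (u k i)) = op_scale (c k) id_blinfun"
  shows "(\<Sum>k\<in>UNIV. op_scale (c k) (op_adj (u k j))) = op_scale (c j) id_blinfun"
proof -
  have "(\<Sum>k\<in>UNIV. op_scale (c k) (op_adj (u k j))) =
      (\<Sum>k\<in>UNIV. op_adj (u k j) o\<^sub>L (\<Sum>i\<in>UNIV. op_scale (c i) (u k i)))"
    by (simp add: c op_scale_comp_right)
  also have "\<dots> = (\<Sum>i\<in>UNIV. op_scale (c i) (\<Sum>k\<in>UNIV. op_adj (u k j) o\<^sub>L u k i))"
    by (simp add: comp_sum_right op_scale_comp_right op_scale_sum_right) (rule sum.swap)
  also have "\<dots> = op_scale (c j) id_blinfun"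
    unfolding columns by (rule sum_delta_op)
  finally show ?thesis .
qed

lemma fixed_vector_cnj:
  assumes c: "\<And>k. (\<Sum>i\<in>UNIV. op_scale (c i) (u k i)) = op_scale (c k) id_blinfun"
  shows "(\<Sum>k\<in>UNIV. op_scale (cnj (c k)) (u k j)) = op_scale (cnj (c j)) id_blinfun"
    and "(\<Sum>i\<in>UNIV. op_scale (cnj (c i)) (op_adj (u k i))) = op_scale (cnj (c k)) id_blinfun"
proof -
  show "(\<Sum>k\<in>UNIV. op_scale (cnj (c k)) (u k j)) = op_scale (cnj (c j)) id_blinfun"
    using arg_cong[OF fixed_vector_adj[OF c, of j], of op_adj] by (simp add: adj_sum adj_scale)
  show "(\<Sum>i\<in>UNIV. op_scale (cnj (c i)) (op_adj (u k i))) = op_scale (cnj (c k)) id_blinfun"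
    using arg_cong[OF c[of k], of op_adj] by (simp add: adj_sum adj_scale)
qed

text \<open>
  By traciality, these numbers are the traces both of the operators \<open>u\<^bsub>k,i\<^esub> u\<^bsub>l,j\<^esub>\<^sup>*\<close>, which occur for
  \<open>\<Gamma>\<close>, and of the operators \<open>u\<^bsub>l,j\<^esub>\<^sup>* u\<^bsub>k,i\<^esub>\<close>, which occur for \<open>\<Gamma>~\<close>.
\<close>

definition gram :: "'i \<Rightarrow> 'i \<Rightarrow> 'i \<Rightarrow> 'i \<Rightarrow> complex" where
  "gram k i l j = \<tau> (u k i o\<^sub>L op_adj (u l j))"

text \<open>
  The entries of \<open>U (a \<otimes> 1) U\<^sup>*\<close>.
\<close>

definition conj_mat :: "('i \<Rightarrow> 'i \<Rightarrow> complex) \<Rightarrow> 'i \<Rightarrow> 'i \<Rightarrow> 'k operator" where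
  "conj_mat a k l = (\<Sum>i\<in>UNIV. \<Sum>j\<in>UNIV. op_scale (a i j) (u k i o\<^sub>L op_adj (u l j)))"

lemma conj_mat_N [simp]: "conj_mat a k l \<in> N"
  by (simp add: conj_mat_def)

lemma trace_conj_mat: "\<tau> (conj_mat a k l) = (\<Sum>i\<in>UNIV. \<Sum>j\<in>UNIV. a i j * gram k i l j)"
  by (simp add: conj_mat_def gram_def trace_sum trace_scale)

lemma adj_conj_mat:
  assumes a: "\<And>i j. cnj (a i j) = a j i"
  shows "op_adj (conj_mat a k l) = conj_mat a l k"
  by (simp add: conj_mat_def adj_sum adj_scale adj_comp a) (rule sum.swap)

text \<open>
  For Hermitian \<open>a\<close> this says that conjugation preserves the Hilbert-Schmidt norm. Unitarity of \<open>U\<close> removes the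
  sum over \<open>k\<close>, and unitarity of its transpose removes the sum over \<open>l\<close>. The two sums meet the entries of \<open>U\<close> in
  different orders, which is why both unitarities enter.
\<close>

lemma conj_mat_square:
  "(\<Sum>k\<in>UNIV. \<Sum>l\<in>UNIV. conj_mat a l k o\<^sub>L conj_mat a k l) =
     op_scale (\<Sum>i\<in>UNIV. \<Sum>j\<in>UNIV. a j i * a i j) id_blinfun"
proof -
  define Y where "Y l j = (\<Sum>i\<in>UNIV. op_scale (a i j) (u l i))" for l j
  define Z where "Z l i = (\<Sum>j\<in>UNIV. op_scale (a i j) (op_adj (u l j)))" for l i
  have YN [simp]: "Y l j \<in> bounded_ops" for l j by (simp add: Y_def bdd)
  have left: "conj_mat a l k = (\<Sum>j\<in>UNIV. Y l j o\<^sub>L op_adj (u k j))" for k l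
    by (simp add: conj_mat_def Y_def comp_sum_left op_scale_comp_left) (rule sum.swap)
  have right: "conj_mat a k l = (\<Sum>i\<in>UNIV. u k i o\<^sub>L Z l i)" for k l
    by (simp add: conj_mat_def Z_def comp_sum_right op_scale_comp_right)
  have inner: "(\<Sum>k\<in>UNIV. conj_mat a l k o\<^sub>L conj_mat a k l) = (\<Sum>j\<in>UNIV. Y l j o\<^sub>L Z l j)" for l
  proof -
    have "(\<Sum>k\<in>UNIV. conj_mat a l k o\<^sub>L conj_mat a k l) =
        (\<Sum>k\<in>UNIV. \<Sum>i\<in>UNIV. \<Sum>j\<in>UNIV. Y l j o\<^sub>L ((op_adj (u k j) o\<^sub>L u k i) o\<^sub>L Z l i))"
      by (simp add: left[of l] right[of _ l] comp_sum_left comp_sum_right comp_assoc)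
    also have "\<dots> = (\<Sum>i\<in>UNIV. \<Sum>j\<in>UNIV. \<Sum>k\<in>UNIV. Y l j o\<^sub>L ((op_adj (u k j) o\<^sub>L u k i) o\<^sub>L Z l i))"
      by (subst sum.swap) (rule sum.cong[OF refl], rule sum.swap)
    also have "\<dots> = (\<Sum>i\<in>UNIV. \<Sum>j\<in>UNIV. Y l j o\<^sub>L ((if j = i then id_blinfun else 0) o\<^sub>L Z l i))"
      by (simp only: comp_sum_left[symmetric] comp_sum_right[symmetric] columns)
    also have "\<dots> = (\<Sum>i\<in>UNIV. \<Sum>j\<in>UNIV. if j = i then Y l j o\<^sub>L Z l i else 0)"
      by (intro sum.cong refl) simp
    finally show ?thesis by simp
  qed
  have "(\<Sum>k\<in>UNIV. \<Sum>l\<in>UNIV. conj_mat a l k o\<^sub>L conj_mat a k l) =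
      (\<Sum>l\<in>UNIV. \<Sum>j\<in>UNIV. Y l j o\<^sub>L Z l j)"
    by (subst sum.swap) (simp only: inner)
  also have "\<dots> = (\<Sum>l\<in>UNIV. \<Sum>j\<in>UNIV. \<Sum>i\<in>UNIV. \<Sum>m\<in>UNIV.
      op_scale (a i j * a j m) (u l i o\<^sub>L op_adj (u l m)))"
  proof (rule sum.cong[OF refl], rule sum.cong[OF refl])
    fix l j
    have "Y l j o\<^sub>L Z l j = (\<Sum>m\<in>UNIV. \<Sum>i\<in>UNIV. op_scale (a i j * a j m) (u l i o\<^sub>L op_adj (u l m)))"
      by (simp add: Y_def Z_def comp_sum_left comp_sum_right op_scale_comp_left op_scale_comp_right)
    then show "Y l j o\<^sub>L Z l j = (\<Sum>i\<in>UNIV. \<Sum>m\<in>UNIV. op_scale (a i j * a j m) (u l i o\<^sub>L op_adj (u l m)))"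
      by (subst sum.swap)
  qed
  also have "\<dots> = (\<Sum>i\<in>UNIV. \<Sum>m\<in>UNIV. \<Sum>l\<in>UNIV. \<Sum>j\<in>UNIV.
      op_scale (a i j * a j m) (u l i o\<^sub>L op_adj (u l m)))"
    by (rule sum_swap_pairs)
  also have "\<dots> = (\<Sum>i\<in>UNIV. \<Sum>m\<in>UNIV. \<Sum>j\<in>UNIV. \<Sum>l\<in>UNIV.
      op_scale (a i j * a j m) (u l i o\<^sub>L op_adj (u l m)))"
    by (rule sum.cong[OF refl], rule sum.cong[OF refl], rule sum.swap)
  also have "\<dots> = (\<Sum>i\<in>UNIV. \<Sum>m\<in>UNIV. op_scale (\<Sum>j\<in>UNIV. a i j * a j m) (if i = m then id_blinfun else 0))"
    by (simp only: op_scale_sum_right[symmetric] op_scale_sum_left columns')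
  also have "\<dots> = (\<Sum>i\<in>UNIV. op_scale (\<Sum>j\<in>UNIV. a i j * a j i) id_blinfun)"
    by (simp only: sum_delta_op)
  also have "\<dots> = op_scale (\<Sum>i\<in>UNIV. \<Sum>j\<in>UNIV. a j i * a i j) id_blinfun"
    by (simp add: op_scale_sum_left mult.commute)
  finally show ?thesis .
qed

text \<open>
  The comparison of lengths. Here \<open>c\<close> is a vector fixed by \<open>U\<close>, and \<open>c i * cnj (c j)\<close> are the entries of
  \<open>e = c c\<^sup>*\<close>. The hypotheses \<open>proj\<close> say that \<open>a\<close> and \<open>b\<close> are orthogonal to \<open>e - a\<close> and \<open>e - b\<close>, respectively,
  \<open>fwd\<close> that \<open>U a U\<^sup>*\<close> is orthogonal to \<open>e - b\<close>, and \<open>bwd\<close> that \<open>U\<^sup>* b U\<close> is orthogonal to \<open>e - a\<close>. The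
  inner product \<open>X\<close> of \<open>U a U\<^sup>*\<close> with \<open>b\<close> is then computed in two ways, as the squared norm of \<open>a\<close> and as
  that of \<open>b\<close>; hence the distance from \<open>U a U\<^sup>*\<close> to \<open>b\<close> is zero.
\<close>

lemma conjugation_eqI:
  fixes a b :: "'i \<Rightarrow> 'i \<Rightarrow> complex" and c :: "'i \<Rightarrow> complex"
  assumes c: "\<And>k. (\<Sum>i\<in>UNIV. op_scale (c i) (u k i)) = op_scale (c k) id_blinfun"
    and herm: "\<And>i j. cnj (a i j) = a j i" "\<And>i j. cnj (b i j) = b j i"
    and proj: "(\<Sum>i\<in>UNIV. \<Sum>j\<in>UNIV. a j i * a i j) = (\<Sum>i\<in>UNIV. \<Sum>j\<in>UNIV. a j i * (c i * cnj (c j)))"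
      "(\<Sum>i\<in>UNIV. \<Sum>j\<in>UNIV. b j i * b i j) = (\<Sum>i\<in>UNIV. \<Sum>j\<in>UNIV. b j i * (c i * cnj (c j)))"
    and fwd: "(\<Sum>k\<in>UNIV. \<Sum>l\<in>UNIV. \<Sum>i\<in>UNIV. \<Sum>j\<in>UNIV.
        op_scale ((c l * cnj (c k) - b l k) * a i j) (u k i o\<^sub>L op_adj (u l j))) = 0"
    and bwd: "(\<Sum>i\<in>UNIV. \<Sum>j\<in>UNIV. \<Sum>k\<in>UNIV. \<Sum>l\<in>UNIV.
        op_scale ((c j * cnj (c i) - a j i) * b k l) (op_adj (u k i) o\<^sub>L u l j)) = 0"
  shows "conj_mat a k l = op_scale (b k l) id_blinfun"
proof -
  let ?ta = "\<Sum>i\<in>UNIV. \<Sum>j\<in>UNIV. a j i * a i j" and ?tb = "\<Sum>i\<in>UNIV. \<Sum>j\<in>UNIV. b j i * b i j"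
  define \<tau>1 where "\<tau>1 = \<tau> id_blinfun"
  define X where "X = (\<Sum>k\<in>UNIV. \<Sum>l\<in>UNIV. \<Sum>i\<in>UNIV. \<Sum>j\<in>UNIV. b l k * a i j * gram k i l j)"
  \<comment> \<open>Both conjugations, by the adjoint of \<open>U\<close> and by \<open>U\<close>, fix \<open>e\<close>; its pairings under the trace are these sums.\<close>
  have gram1: "(\<Sum>k\<in>UNIV. \<Sum>l\<in>UNIV. c l * cnj (c k) * gram k i l j) = c j * cnj (c i) * \<tau>1" for i j
  proof -
    have "\<tau> ((\<Sum>k\<in>UNIV. op_scale (cnj (c k)) (u k i)) o\<^sub>L (\<Sum>l\<in>UNIV. op_scale (c l) (op_adj (u l j)))) =
        (\<Sum>l\<in>UNIV. \<Sum>k\<in>UNIV. cnj (c k) * c l * gram k i l j)"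
      by (simp add: comp_sum_left comp_sum_right op_scale_comp_left op_scale_comp_right trace_sum
          trace_scale gram_def)
    then show ?thesis
      by (subst sum.swap)
         (simp add: fixed_vector_cnj(1)[OF c] fixed_vector_adj[OF c] op_scale_comp_left trace_scale \<tau>1_def mult_ac)
  qed
  have gram2: "(\<Sum>i\<in>UNIV. \<Sum>j\<in>UNIV. c i * cnj (c j) * gram k i l j) = c k * cnj (c l) * \<tau>1" for k l
  proof -
    have "\<tau> ((\<Sum>i\<in>UNIV. op_scale (c i) (u k i)) o\<^sub>L (\<Sum>j\<in>UNIV. op_scale (cnj (c j)) (op_adj (u l j)))) =
        (\<Sum>j\<in>UNIV. \<Sum>i\<in>UNIV. c i * cnj (c j) * gram k i l j)"
      by (simp add: comp_sum_left comp_sum_right op_scale_comp_left op_scale_comp_right trace_sum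
          trace_scale gram_def)
    then show ?thesis
      by (subst sum.swap)
         (simp add: c fixed_vector_cnj(2)[OF c] op_scale_comp_left trace_scale \<tau>1_def mult_ac)
  qed
  have Xa: "X = ?ta * \<tau>1"
  proof -
    have "(\<Sum>k\<in>UNIV. \<Sum>l\<in>UNIV. \<Sum>i\<in>UNIV. \<Sum>j\<in>UNIV. (c l * cnj (c k) - b l k) * a i j * gram k i l j) = 0"
      using arg_cong[OF fwd, of \<tau>] by (simp add: trace_sum trace_scale gram_def)
    then have "X = (\<Sum>k\<in>UNIV. \<Sum>l\<in>UNIV. \<Sum>i\<in>UNIV. \<Sum>j\<in>UNIV. c l * cnj (c k) * a i j * gram k i l j)"
      by (simp add: X_def left_diff_distrib sum_subtractf)
    also have "\<dots> = (\<Sum>i\<in>UNIV. \<Sum>j\<in>UNIV. \<Sum>k\<in>UNIV. \<Sum>l\<in>UNIV. c l * cnj (c k) * a i j * gram k i l j)"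
      by (rule sum_swap_pairs)
    also have "\<dots> = (\<Sum>i\<in>UNIV. \<Sum>j\<in>UNIV. a i j * (\<Sum>k\<in>UNIV. \<Sum>l\<in>UNIV. c l * cnj (c k) * gram k i l j))"
      by (simp add: sum_distrib_left mult_ac)
    also have "\<dots> = (\<Sum>i\<in>UNIV. \<Sum>j\<in>UNIV. a i j * (c j * cnj (c i))) * \<tau>1"
      unfolding gram1 by (simp add: sum_distrib_left mult_ac)
    also have "\<dots> = ?ta * \<tau>1" unfolding proj by (subst sum.swap) (rule refl)
    finally show ?thesis .
  qed
  have Xb: "X = ?tb * \<tau>1"
  proof -
    have "\<tau> (op_adj (u k i) o\<^sub>L u l j) = gram l j k i" for i j k l
      by (simp add: gram_def trace_comm)
    then have "(\<Sum>i\<in>UNIV. \<Sum>j\<in>UNIV. \<Sum>k\<in>UNIV. \<Sum>l\<in>UNIV. (c j * cnj (c i) - a j i) * b k l * gram l j k i) = 0"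
      using arg_cong[OF bwd, of \<tau>] by (simp add: trace_sum trace_scale)
    then have "(\<Sum>i\<in>UNIV. \<Sum>j\<in>UNIV. \<Sum>k\<in>UNIV. \<Sum>l\<in>UNIV. a j i * b k l * gram l j k i) =
        (\<Sum>i\<in>UNIV. \<Sum>j\<in>UNIV. \<Sum>k\<in>UNIV. \<Sum>l\<in>UNIV. c j * cnj (c i) * b k l * gram l j k i)"
      by (simp add: left_diff_distrib sum_subtractf)
    moreover have "(\<Sum>i\<in>UNIV. \<Sum>j\<in>UNIV. \<Sum>k\<in>UNIV. \<Sum>l\<in>UNIV. h j i * b k l * gram l j k i) =
        (\<Sum>k\<in>UNIV. \<Sum>l\<in>UNIV. b l k * (\<Sum>i\<in>UNIV. \<Sum>j\<in>UNIV. h i j * gram k i l j))" for h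
    proof -
      have "(\<Sum>i\<in>UNIV. \<Sum>j\<in>UNIV. \<Sum>k\<in>UNIV. \<Sum>l\<in>UNIV. h j i * b k l * gram l j k i) =
          (\<Sum>k\<in>UNIV. \<Sum>l\<in>UNIV. \<Sum>i\<in>UNIV. \<Sum>j\<in>UNIV. h j i * b k l * gram l j k i)"
        by (rule sum_swap_pairs)
      also have "\<dots> = (\<Sum>l\<in>UNIV. \<Sum>k\<in>UNIV. \<Sum>j\<in>UNIV. \<Sum>i\<in>UNIV. h j i * b k l * gram l j k i)"
        by (subst sum.swap) (rule sum.cong[OF refl], rule sum.cong[OF refl], rule sum.swap)
      finally show ?thesis by (simp add: sum_distrib_left mult_ac)
    qed
    ultimately have "(\<Sum>k\<in>UNIV. \<Sum>l\<in>UNIV. b l k * (\<Sum>i\<in>UNIV. \<Sum>j\<in>UNIV. a i j * gram k i l j)) =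
        (\<Sum>k\<in>UNIV. \<Sum>l\<in>UNIV. b l k * (\<Sum>i\<in>UNIV. \<Sum>j\<in>UNIV. c i * cnj (c j) * gram k i l j))"
      by simp
    then have "X = (\<Sum>k\<in>UNIV. \<Sum>l\<in>UNIV. b l k * (c k * cnj (c l) * \<tau>1))"
      unfolding gram2 by (simp add: X_def sum_distrib_left mult.assoc)
    also have "\<dots> = ?tb * \<tau>1" unfolding proj by (simp add: sum_distrib_left mult_ac)
    finally show ?thesis .
  qed
  define D where "D p = conj_mat a (fst p) (snd p) - op_scale (b (fst p) (snd p)) id_blinfun" for p
  have D_sq: "\<tau> (op_adj (D (k, l)) o\<^sub>L D (k, l)) = \<tau> (conj_mat a l k o\<^sub>L conj_mat a k l) -
      b k l * \<tau> (conj_mat a l k) - b l k * \<tau> (conj_mat a k l) + b l k * b k l * \<tau>1" for k l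
  proof -
    have minus: "\<tau> (S - T) = \<tau> S - \<tau> T" if "S \<in> N" "T \<in> N" for S T
      using trace_add[of "S - T" T] that by simp
    show ?thesis
      by (simp add: D_def adj_diff adj_conj_mat herm adj_scale comp_diff_left comp_diff_right
        op_scale_comp_left op_scale_comp_right bdd minus trace_add trace_scale \<tau>1_def algebra_simps)
  qed
  have "(\<Sum>p\<in>UNIV. \<tau> (op_adj (D p) o\<^sub>L D p)) =
     (\<Sum>k\<in>UNIV. \<Sum>l\<in>UNIV. \<tau> (conj_mat a l k o\<^sub>L conj_mat a k l)) -
     (\<Sum>k\<in>UNIV. \<Sum>l\<in>UNIV. b k l * \<tau> (conj_mat a l k)) -
     (\<Sum>k\<in>UNIV. \<Sum>l\<in>UNIV. b l k * \<tau> (conj_mat a k l)) +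
     (\<Sum>k\<in>UNIV. \<Sum>l\<in>UNIV. b l k * b k l * \<tau>1)"
    by (simp only: sum_UNIV_prod D_sq sum.distrib sum_subtractf)
  also have "(\<Sum>k\<in>UNIV. \<Sum>l\<in>UNIV. b k l * \<tau> (conj_mat a l k)) =
     (\<Sum>k\<in>UNIV. \<Sum>l\<in>UNIV. b l k * \<tau> (conj_mat a k l))"
    by (rule sum.swap)
  also have "(\<Sum>k\<in>UNIV. \<Sum>l\<in>UNIV. b l k * \<tau> (conj_mat a k l)) = X"
    by (simp add: X_def trace_conj_mat sum_distrib_left mult.assoc)
  also have "(\<Sum>k\<in>UNIV. \<Sum>l\<in>UNIV. \<tau> (conj_mat a l k o\<^sub>L conj_mat a k l)) = ?ta * \<tau>1"
    using arg_cong[OF conj_mat_square[of a], of \<tau>] by (simp add: trace_sum trace_scale \<tau>1_def)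
  also have "(\<Sum>k\<in>UNIV. \<Sum>l\<in>UNIV. b l k * b k l * \<tau>1) = ?tb * \<tau>1"
    by (simp add: sum_distrib_right)
  also have "?ta * \<tau>1 - X - X + ?tb * \<tau>1 = 0" unfolding Xa[symmetric] Xb[symmetric] by simp
  finally have "D (k, l) = 0"
    by (intro trace_faithful_sum[where I = UNIV and S = D]) (simp_all add: D_def)
  then show ?thesis by (simp add: D_def)
qed

text \<open>
  Multiply \<open>U a U\<^sup>* = b\<close> by \<open>U\<close> from the right.
\<close>

lemma intertwines:
  assumes "\<And>k l. conj_mat a k l = op_scale (b k l) id_blinfun"
  shows "(\<Sum>i\<in>UNIV. op_scale (a i m) (u k i)) = (\<Sum>l\<in>UNIV. op_scale (b k l) (u l m))"
proof -
  have "(\<Sum>l\<in>UNIV. op_scale (b k l) (u l m)) = (\<Sum>l\<in>UNIV. conj_mat a k l o\<^sub>L u l m)"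
    by (simp add: assms op_scale_comp_left)
  also have "\<dots> = (\<Sum>l\<in>UNIV. \<Sum>i\<in>UNIV. \<Sum>j\<in>UNIV. op_scale (a i j) (u k i o\<^sub>L (op_adj (u l j) o\<^sub>L u l m)))"
    by (simp add: conj_mat_def comp_sum_left op_scale_comp_left comp_assoc)
  also have "\<dots> = (\<Sum>i\<in>UNIV. \<Sum>j\<in>UNIV. \<Sum>l\<in>UNIV. op_scale (a i j) (u k i o\<^sub>L (op_adj (u l j) o\<^sub>L u l m)))"
    by (subst sum.swap) (rule sum.cong[OF refl], rule sum.swap)
  also have "\<dots> = (\<Sum>i\<in>UNIV. \<Sum>j\<in>UNIV. op_scale (a i j) (u k i o\<^sub>L (if j = m then id_blinfun else 0)))"
    by (simp only: op_scale_sum_right[symmetric] comp_sum_right[symmetric] columns)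
  also have "\<dots> = (\<Sum>i\<in>UNIV. \<Sum>j\<in>UNIV. op_scale (a i j) (if j = m then u k i else 0))"
    by (intro sum.cong refl) simp
  finally show ?thesis by (simp add: sum_delta_op)
qed

end

section \<open>Tracial states on universal C*-algebras\<close>

lemma poly_mapping_monomials:
  "(a :: 'b \<Rightarrow>\<^sub>0 'c::comm_monoid_add) =
     (\<Sum>w\<in>Poly_Mapping.keys a. Poly_Mapping.single w (Poly_Mapping.lookup a w))"
proof (rule poly_mapping_eqI)
  fix v
  have "Poly_Mapping.lookup (\<Sum>w\<in>Poly_Mapping.keys a. Poly_Mapping.single w (Poly_Mapping.lookup a w)) v =
      (\<Sum>w\<in>Poly_Mapping.keys a. if w = v then Poly_Mapping.lookup a w else 0)"
    unfolding lookup_sum by (intro sum.cong refl) (simp add: lookup_single when_def)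
  also have "\<dots> = Poly_Mapping.lookup a v" by (simp add: in_keys_iff)
  finally show "Poly_Mapping.lookup a v =
      Poly_Mapping.lookup (\<Sum>w\<in>Poly_Mapping.keys a. Poly_Mapping.single w (Poly_Mapping.lookup a w)) v" ..
qed

lemma univ_norm_upper:
  assumes "cstar_seminorm q" "\<And>r. r \<in> R \<Longrightarrow> q r = 0"
  shows "ennreal (q a) \<le> univ_norm R a"
  unfolding univ_norm_def by (rule SUP_upper) (use assms in auto)

lemma univ_norm_zero: "univ_norm (R :: 'g free_alg set) 0 = 0"
proof -
  have "q 0 = 0" if "cstar_seminorm q" for q :: "'g free_alg \<Rightarrow> real"
  proof -
    have "q (fconst 0 * 0) = cmod 0 * q 0" using that unfolding cstar_seminorm_def by blast
    then show ?thesis by simp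
  qed
  then have "ennreal (q 0) \<le> 0" if "q \<in> {q. cstar_seminorm q \<and> (\<forall>r\<in>R. q r = 0)}" for q
    using that by force
  then have "univ_norm R 0 \<le> 0"
    unfolding univ_norm_def by (rule SUP_least)
  then show ?thesis by simp
qed

locale represented_generators = tracial_vn N \<tau> for N :: "'k::complex_hilbert operator set" and \<tau> +
  fixes G :: "'g \<Rightarrow> 'k operator"
  assumes GN [simp]: "\<And>g. G g \<in> N"
begin

definition letter_op :: "'g \<times> bool \<Rightarrow> 'k operator" where
  "letter_op l = (if snd l then op_adj (G (fst l)) else G (fst l))"

definition word_op :: "('g \<times> bool) word \<Rightarrow> 'k operator" where
  "word_op w = foldr (\<lambda>l T. letter_op l o\<^sub>L T) (letters w) id_blinfun"

definition rep :: "'g free_alg \<Rightarrow> 'k operator" where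
  "rep a = (\<Sum>w\<in>Poly_Mapping.keys a. op_scale (Poly_Mapping.lookup a w) (word_op w))"

lemma letter_op_N [simp]: "letter_op l \<in> N"
  by (simp add: letter_op_def)

lemma word_op_N [simp]: "word_op w \<in> N"
proof -
  have "foldr (\<lambda>l T. letter_op l o\<^sub>L T) ls id_blinfun \<in> N" for ls
    by (induct ls) simp_all
  then show ?thesis by (simp add: word_op_def)
qed

lemma word_op_zero: "word_op 0 = id_blinfun"
  by (simp add: word_op_def zero_word_def)

lemma word_op_plus: "word_op (v + w) = word_op v o\<^sub>L word_op w"
proof -
  have "foldr (\<lambda>l T. letter_op l o\<^sub>L T) ls S = foldr (\<lambda>l T. letter_op l o\<^sub>L T) ls id_blinfun o\<^sub>L S" for ls S
    by (induct ls) (simp_all add: comp_assoc)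
  from this[of "letters v" "word_op w"] show ?thesis
    by (simp add: word_op_def plus_word_def)
qed

lemma word_op_star: "word_op (word_star w) = op_adj (word_op w)"
proof -
  let ?s = "\<lambda>(g, s). (g, \<not> s)"
  let ?F = "\<lambda>ls. foldr (\<lambda>l T. letter_op l o\<^sub>L T) ls id_blinfun"
  have app: "?F (ks @ [l]) = ?F ks o\<^sub>L letter_op l" for ks l
    using word_op_plus[of "Word ks" "Word [l]"] by (simp add: word_op_def plus_word_def)
  have N: "?F ls \<in> N" for ls by (induct ls) simp_all
  have star: "letter_op (?s l) = op_adj (letter_op l)" for l
    by (cases l) (simp add: letter_op_def)
  have "?F (rev (map ?s ls)) = op_adj (?F ls)" for ls
    by (induct ls) (simp_all add: app adj_comp N star del: foldr_append)
  then show ?thesis by (simp add: word_op_def word_star_def)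
qed

lemma rep_superset:
  assumes "finite S" "Poly_Mapping.keys a \<subseteq> S"
  shows "rep a = (\<Sum>w\<in>S. op_scale (Poly_Mapping.lookup a w) (word_op w))"
  unfolding rep_def using assms by (intro sum.mono_neutral_left) (auto simp: in_keys_iff)

lemma rep_N [simp]: "rep a \<in> N"
  by (simp add: rep_def)

lemma rep_zero [simp]: "rep 0 = 0"
  by (simp add: rep_def)

lemma rep_add: "rep (a + b) = rep a + rep b"
proof -
  let ?S = "Poly_Mapping.keys a \<union> Poly_Mapping.keys b"
  have "rep (a + b) = (\<Sum>w\<in>?S. op_scale (Poly_Mapping.lookup (a + b) w) (word_op w))"
    by (rule rep_superset) (simp_all add: keys_add)
  also have "\<dots> = (\<Sum>w\<in>?S. op_scale (Poly_Mapping.lookup a w) (word_op w)) +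
      (\<Sum>w\<in>?S. op_scale (Poly_Mapping.lookup b w) (word_op w))"
    by (simp add: lookup_add op_scale_add_left sum.distrib)
  also have "\<dots> = rep a + rep b"
    by (subst (1 2) rep_superset[of ?S]) simp_all
  finally show ?thesis .
qed

lemma rep_diff: "rep (a - b) = rep a - rep b"
  using rep_add[of "a - b" b] by simp

lemma rep_sum: "rep (sum g S) = (\<Sum>s\<in>S. rep (g s))"
  by (induct S rule: infinite_finite_induct) (simp_all add: rep_add)

lemma rep_single: "rep (Poly_Mapping.single w c) = op_scale c (word_op w)"
  by (subst rep_superset[of "{w}"]) simp_all

lemma rep_mult: "rep (a * b) = rep a o\<^sub>L rep b"
proof -
  have "rep (a * b) = rep ((\<Sum>v\<in>Poly_Mapping.keys a. Poly_Mapping.single v (Poly_Mapping.lookup a v)) *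
      (\<Sum>w\<in>Poly_Mapping.keys b. Poly_Mapping.single w (Poly_Mapping.lookup b w)))"
    by (simp flip: poly_mapping_monomials)
  also have "\<dots> = (\<Sum>v\<in>Poly_Mapping.keys a. \<Sum>w\<in>Poly_Mapping.keys b.
      op_scale (Poly_Mapping.lookup a v * Poly_Mapping.lookup b w) (word_op v o\<^sub>L word_op w))"
    by (simp add: sum_product mult_single rep_sum rep_single word_op_plus)
  also have "\<dots> = (\<Sum>v\<in>Poly_Mapping.keys a. \<Sum>w\<in>Poly_Mapping.keys b.
      op_scale (Poly_Mapping.lookup a v) (word_op v) o\<^sub>L op_scale (Poly_Mapping.lookup b w) (word_op w))"
    by (simp add: op_scale_comp_left op_scale_comp_right bdd)
  also have "\<dots> = rep a o\<^sub>L rep b"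
    unfolding rep_def by (simp only: comp_sum_left comp_sum_right) (rule sum.swap)
  finally show ?thesis .
qed

lemma rep_fconst: "rep (fconst c) = op_scale c id_blinfun"
  by (simp add: fconst_def rep_single word_op_zero)

lemma rep_one [simp]: "rep 1 = id_blinfun"
  using rep_fconst[of 1] by (simp add: fconst_def)

lemma rep_fconst_mult: "rep (fconst c * a) = op_scale c (rep a)"
  by (simp add: rep_mult rep_fconst op_scale_comp_left)

lemma rep_fgen: "rep (fgen g) = G g"
  by (simp add: fgen_def rep_single word_op_def letter_op_def)

lemma rep_fstar: "rep (fstar a) = op_adj (rep a)"
  by (simp add: fstar_def rep_sum rep_single word_op_star) (simp add: rep_def adj_sum adj_scale)

lemma cstar_seminorm_rep: "cstar_seminorm (\<lambda>a. norm (rep a))"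
  unfolding cstar_seminorm_def
  by (simp add: rep_add norm_triangle_ineq rep_fconst_mult norm_op_scale rep_fconst op_scale_comp_left rep_mult norm_blinfun_compose
      rep_fstar norm_adj_comp)

text \<open>
  The operator norm of the representation is one of the seminorms below the universal norm, so universal
  Cauchy sequences have norm convergent images.
\<close>

lemma univ_Cauchy_limit:
  assumes R: "\<forall>r\<in>R. rep r = 0" and x: "univ_Cauchy R x"
  obtains L where "L \<in> N" "(\<lambda>n. rep (x n)) \<longlonglongrightarrow> L"
proof -
  have le: "ennreal (norm (rep a)) \<le> univ_norm R a" for a
    by (rule univ_norm_upper[OF cstar_seminorm_rep]) (simp add: R)
  have "Cauchy (\<lambda>n. rep (x n))"
  proof (rule CauchyI)
    fix e :: real assume e: "0 < e"
    with x have "\<exists>M. \<forall>m\<ge>M. \<forall>n\<ge>M. univ_norm R (x m - x n) < ennreal e"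
      by (simp add: univ_Cauchy_def)
    then obtain M where M: "\<And>m n. m \<ge> M \<Longrightarrow> n \<ge> M \<Longrightarrow> univ_norm R (x m - x n) < ennreal e"
      by blast
    have "norm (rep (x m) - rep (x n)) < e" if "m \<ge> M" "n \<ge> M" for m n
    proof -
      have "ennreal (norm (rep (x m - x n))) < ennreal e"
        using le M[OF that] by (rule le_less_trans)
      then show ?thesis by (simp add: rep_diff ennreal_less_iff)
    qed
    then show "\<exists>M. \<forall>m\<ge>M. \<forall>n\<ge>M. norm (rep (x m) - rep (x n)) < e" by blast
  qed
  then have "convergent (\<lambda>n. rep (x n))" by (rule Cauchy_convergent)
  then obtain L where L: "(\<lambda>n. rep (x n)) \<longlonglongrightarrow> L" by (auto simp: convergent_def)
  have "L \<in> N" by (rule closed_sequentially[OF closed_N _ L]) simp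
  then show ?thesis using L by (rule that)
qed

lemma univ_class_limit:
  assumes R: "\<forall>r\<in>R. rep r = 0" and y: "y \<in> univ_class R x"
    and x: "(\<lambda>n. rep (x n)) \<longlonglongrightarrow> L"
  shows "(\<lambda>n. rep (y n)) \<longlonglongrightarrow> L"
proof -
  have le: "ennreal (norm (rep a)) \<le> univ_norm R a" for a
    by (rule univ_norm_upper[OF cstar_seminorm_rep]) (simp add: R)
  have up: "(\<lambda>n. univ_norm R (x n - y n)) \<longlonglongrightarrow> 0" using y by (simp add: univ_class_def)
  have lo: "\<forall>\<^sub>F n in sequentially. 0 \<le> ennreal (norm (rep (x n - y n)))"
    and hi: "\<forall>\<^sub>F n in sequentially. ennreal (norm (rep (x n - y n))) \<le> univ_norm R (x n - y n)"
    by (simp_all add: le)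
  have "(\<lambda>n. ennreal (norm (rep (x n - y n)))) \<longlonglongrightarrow> ennreal 0"
    unfolding ennreal_0 by (rule tendsto_sandwich[OF lo hi tendsto_const up])
  then have "(\<lambda>n. norm (rep (x n - y n))) \<longlonglongrightarrow> 0"
    by (subst (asm) tendsto_ennreal_iff) simp_all
  then have "(\<lambda>n. rep (x n) - rep (y n)) \<longlonglongrightarrow> 0"
    unfolding rep_diff by (rule tendsto_norm_zero_cancel)
  from tendsto_diff[OF x this] show ?thesis by simp
qed

lemma univ_class_self: "x \<in> univ_class R x"
  by (simp add: univ_class_def univ_norm_zero)

text \<open>
  The extension of the representation to the completion. It is given by a choice because the operations of
  the universal algebra are unions of classes; \<open>lim_op_eqI\<close> evaluates it on any nonempty set of sequences with a
  common limit.
\<close>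

definition lim_op :: "(nat \<Rightarrow> 'g free_alg) set \<Rightarrow> 'k operator" where
  "lim_op X = lim (\<lambda>n. rep ((SOME y. y \<in> X) n))"

lemma lim_op_eqI:
  assumes "X \<noteq> {}" "\<And>y. y \<in> X \<Longrightarrow> (\<lambda>n. rep (y n)) \<longlonglongrightarrow> L"
  shows "lim_op X = L"
proof -
  have "(SOME y. y \<in> X) \<in> X" using assms(1) by (simp add: some_in_eq)
  then show ?thesis unfolding lim_op_def by (intro limI assms(2))
qed

lemma bounded_linear_op_scale: "bounded_linear (op_scale c :: 'k operator \<Rightarrow> _)"
proof (rule bounded_linear_intro[where K = "cmod c"])
  show "op_scale c (r *\<^sub>R T) = r *\<^sub>R op_scale c T" for r and T :: "'k operator"
    unfolding op_scale_of_real[symmetric] by (simp add: mult.commute)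
qed (simp_all add: op_scale_add_right norm_op_scale)

lemmas tendsto_op_scale = bounded_linear.tendsto[OF bounded_linear_op_scale]

lemma tendsto_op_adj:
  assumes "\<And>n. s n \<in> N" "L \<in> N" "s \<longlonglongrightarrow> L"
  shows "(\<lambda>n. op_adj (s n)) \<longlonglongrightarrow> op_adj L"
proof -
  have eq: "norm (op_adj (s n) - op_adj L) = norm (s n - L)" for n
    using norm_adj[of "s n - L"] assms(1,2) by (simp add: adj_diff)
  have "(\<lambda>n. norm (s n - L)) \<longlonglongrightarrow> 0"
    by (intro tendsto_norm_zero LIM_zero assms(3))
  then have "(\<lambda>n. op_adj (s n) - op_adj L) \<longlonglongrightarrow> 0"
    unfolding eq[symmetric] by (rule tendsto_norm_zero_cancel)
  then show ?thesis by (rule LIM_zero_cancel)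
qed

text \<open>
  The map \<open>lim_op\<close> is a unital *-homomorphism from the universal algebra to \<open>N\<close>. Limits are formed in \<open>N\<close>
  before the trace is applied, so every property of the state is the corresponding property of the
  trace.
\<close>

lemma tracial_state_exists:
  assumes R: "\<forall>r\<in>R. rep r = 0" and one: "\<tau> id_blinfun = 1"
  shows "tracial_state (universal_cstar R) (\<lambda>X. \<tau> (lim_op X))"
proof -
  let ?B = "universal_cstar R"
  have carrier: "X \<noteq> {} \<and> lim_op X \<in> N \<and> (\<forall>y\<in>X. (\<lambda>n. rep (y n)) \<longlonglongrightarrow> lim_op X)"
    if X: "X \<in> alg_carrier ?B" for X
  proof -
    obtain x where x: "univ_Cauchy R x" and X: "X = univ_class R x"
      using X by (auto simp: universal_cstar_def)
    obtain L where L: "L \<in> N" "(\<lambda>n. rep (x n)) \<longlonglongrightarrow> L" by (rule univ_Cauchy_limit[OF R x])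
    have lim: "\<forall>y\<in>X. (\<lambda>n. rep (y n)) \<longlonglongrightarrow> L"
      using univ_class_limit[OF R _ L(2)] unfolding X by blast
    have ne: "X \<noteq> {}" using univ_class_self unfolding X by blast
    then have "lim_op X = L" using lim by (intro lim_op_eqI) auto
    then show ?thesis using L(1) lim ne by simp
  qed
  have unary: "lim_op (\<Union>x\<in>X. univ_class R (h x)) = L"
    if "X \<noteq> {}" "\<And>x. x \<in> X \<Longrightarrow> (\<lambda>n. rep (h x n)) \<longlonglongrightarrow> L"
    for X :: "(nat \<Rightarrow> 'g free_alg) set" and h L
  proof (rule lim_op_eqI)
    show "(\<Union>x\<in>X. univ_class R (h x)) \<noteq> {}" using that(1) univ_class_self by blast
    fix z assume "z \<in> (\<Union>x\<in>X. univ_class R (h x))"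
    then show "(\<lambda>n. rep (z n)) \<longlonglongrightarrow> L" using univ_class_limit[OF R _ that(2)] by blast
  qed
  have binary: "lim_op (\<Union>x\<in>X. \<Union>y\<in>Y. univ_class R (h x y)) = L"
    if "X \<noteq> {}" "Y \<noteq> {}" "\<And>x y. x \<in> X \<Longrightarrow> y \<in> Y \<Longrightarrow> (\<lambda>n. rep (h x y n)) \<longlonglongrightarrow> L"
    for X Y :: "(nat \<Rightarrow> 'g free_alg) set" and h L
  proof (rule lim_op_eqI)
    show "(\<Union>x\<in>X. \<Union>y\<in>Y. univ_class R (h x y)) \<noteq> {}" using that(1,2) univ_class_self by blast
    fix z assume "z \<in> (\<Union>x\<in>X. \<Union>y\<in>Y. univ_class R (h x y))"
    then show "(\<lambda>n. rep (z n)) \<longlonglongrightarrow> L" using univ_class_limit[OF R _ that(3)] by blast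
  qed
  have add: "lim_op (alg_add ?B X Y) = lim_op X + lim_op Y"
    and mult: "lim_op (alg_mult ?B X Y) = lim_op X o\<^sub>L lim_op Y"
    if "X \<in> alg_carrier ?B" "Y \<in> alg_carrier ?B" for X Y
    using carrier[OF that(1)] carrier[OF that(2)]
    by (auto simp: universal_cstar_def rep_add rep_mult intro!: binary tendsto_add
        bounded_bilinear.tendsto[OF bounded_bilinear_blinfun_compose])
  have scale: "lim_op (alg_scale ?B c X) = op_scale c (lim_op X)"
    and star: "lim_op (alg_star ?B X) = op_adj (lim_op X)"
    and star_mult: "lim_op (alg_mult ?B (alg_star ?B X) X) = op_adj (lim_op X) o\<^sub>L lim_op X"
    if X: "X \<in> alg_carrier ?B" for X c
  proof -
    note c = carrier[OF X]
    show "lim_op (alg_scale ?B c X) = op_scale c (lim_op X)"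
      using c by (auto simp: universal_cstar_def rep_fconst_mult intro!: unary tendsto_op_scale)
    show "lim_op (alg_star ?B X) = op_adj (lim_op X)"
      using c by (auto simp: universal_cstar_def rep_fstar intro!: unary tendsto_op_adj)
    have ne: "alg_star ?B X \<noteq> {}"
    proof -
      obtain x where "x \<in> X" using c by blast
      then have "(\<lambda>n. fstar (x n)) \<in> alg_star ?B X"
        by (auto simp: universal_cstar_def intro: univ_class_self)
      then show ?thesis by blast
    qed
    have lim: "(\<lambda>n. rep (z n)) \<longlonglongrightarrow> op_adj (lim_op X)" if z: "z \<in> alg_star ?B X" for z
    proof -
      obtain x where x: "x \<in> X" "z \<in> univ_class R (\<lambda>n. fstar (x n))"
        using z by (auto simp: universal_cstar_def)
      have "(\<lambda>n. rep (fstar (x n))) \<longlonglongrightarrow> op_adj (lim_op X)"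
        unfolding rep_fstar using c x(1) by (intro tendsto_op_adj) auto
      then show ?thesis by (rule univ_class_limit[OF R x(2)])
    qed
    have "alg_mult ?B (alg_star ?B X) X = (\<Union>x\<in>alg_star ?B X. \<Union>y\<in>X. univ_class R (\<lambda>n. x n * y n))"
      by (simp add: universal_cstar_def)
    then show "lim_op (alg_mult ?B (alg_star ?B X) X) = op_adj (lim_op X) o\<^sub>L lim_op X"
      using c ne lim by (auto simp: rep_mult intro!: binary
          bounded_bilinear.tendsto[OF bounded_bilinear_blinfun_compose])
  qed
  have "lim_op (alg_one ?B) = id_blinfun"
  proof (rule lim_op_eqI)
    show "alg_one ?B \<noteq> {}" using univ_class_self by (auto simp: universal_cstar_def)
    fix y assume "y \<in> alg_one ?B"
    then have y: "y \<in> univ_class R (\<lambda>n. 1)" by (simp add: universal_cstar_def)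
    show "(\<lambda>n. rep (y n)) \<longlonglongrightarrow> id_blinfun" by (rule univ_class_limit[OF R y]) simp_all
  qed
  moreover have "lim_op X \<in> N" if "X \<in> alg_carrier ?B" for X
    using carrier[OF that] by blast
  ultimately show ?thesis
    unfolding tracial_state_def
    by (simp add: add mult scale star_mult trace_add trace_scale trace_pos one) (simp add: trace_comm)
qed

end

section \<open>Matrices with entries in a Hilbert space\<close>

lemma tens_vec_nth [simp]: "tens_vec a \<xi>$x$y = a$x$y *\<^sub>C \<xi>"
  by (simp add: tens_vec_def)

lemma coeff_tens_vec: "coeff a (tens_vec b \<xi>) = l2 a b *\<^sub>C \<xi>"
  by (simp add: coeff_def scaleC_scaleC l2_altdef sum_divide_distrib scaleC_sum_left)

lemma coeff_add: "coeff a (v + w) = coeff a v + coeff a w"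
  by (simp add: coeff_def scaleC_add_right sum.distrib)

lemma tens_vec_add: "tens_vec a (\<xi> + \<zeta>) = tens_vec a \<xi> + tens_vec a \<zeta>"
  by (simp add: vec_eq_iff scaleC_add_right)

lemma matrix_op_add: "matrix_op f u (v + w) = matrix_op f u v + matrix_op f u w"
  by (simp add: matrix_op_def coeff_add blinfun.add_right tens_vec_add sum.distrib)

lemma amplify_add: "amplify A (v + w) = amplify A v + amplify A w"
  by (simp add: amplify_def tens_vec_add sum.distrib)

lemma matrix_op_sum: "finite I \<Longrightarrow> I \<noteq> {} \<Longrightarrow> matrix_op f u (sum g I) = (\<Sum>s\<in>I. matrix_op f u (g s))"
  by (induct I rule: finite_ne_induct) (simp_all add: matrix_op_add)

lemma amplify_sum: "finite I \<Longrightarrow> I \<noteq> {} \<Longrightarrow> amplify A (sum g I) = (\<Sum>s\<in>I. amplify A (g s))"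
  by (induct I rule: finite_ne_induct) (simp_all add: amplify_add)

lemma tens_vec_matunit_expand:
  "v = (\<Sum>x\<in>UNIV. \<Sum>y\<in>UNIV. tens_vec (matunit x y) (v$x$y))"
proof -
  have "(\<Sum>x\<in>UNIV. \<Sum>y\<in>UNIV. tens_vec (matunit x y) (v$x$y))$k$l = v$k$l" for k l
  proof -
    have "(\<Sum>x\<in>UNIV. \<Sum>y\<in>UNIV. tens_vec (matunit x y) (v$x$y))$k$l =
        (\<Sum>x\<in>UNIV. \<Sum>y\<in>UNIV. if l = y then (if k = x then v$x$y else 0) else 0)"
      unfolding sum_component by (intro sum.cong refl) simp
    then show ?thesis by simp
  qed
  then show ?thesis by (simp add: vec_eq_iff)
qed

lemma amplify_tens_vec:
  assumes "mat_linear A" shows "amplify A (tens_vec a \<xi>) = tens_vec (A a) \<xi>"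
proof -
  have "tens_vec (A a) \<xi> = tens_vec (A (\<Sum>x\<in>UNIV. \<Sum>y\<in>UNIV. a$x$y *\<^sub>m matunit x y)) \<xi>"
    by (simp flip: matunit_expand)
  also have "\<dots> = amplify A (tens_vec a \<xi>)"
    by (simp add: mat_lin[OF assms] amplify_def vec_eq_iff scaleC_scaleC scaleC_sum_left mult.commute)
  finally show ?thesis ..
qed

section \<open>Unitarily implemented homomorphisms\<close>

locale implemented_hom = bi_unitary_vn N \<tau> u
  for N :: "'k::complex_hilbert operator set" and \<tau> and u :: "'i::finite \<Rightarrow> 'i \<Rightarrow> 'k operator" +
  fixes f :: "'i \<Rightarrow> complex^'x^'x" and \<rho> :: "complex^'x^'x \<Rightarrow> ('k operator)^'x^'x"
  assumes f: "onb f" and hom: "star_hom_into N \<rho>" and tp: "trace_preserving \<rho>"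
    and impl: "unitary_implementation f u \<rho>"
begin

lemma hom_N [simp]: "\<rho> a$x$y \<in> N"
  and hom_mult: "\<rho> (a ** b)$x$y = (\<Sum>z\<in>UNIV. \<rho> a$x$z o\<^sub>L \<rho> b$z$y)"
  and hom_adj: "\<rho> (mat_adj a)$x$y = op_adj (\<rho> a$y$x)"
  using hom by (auto simp: star_hom_into_def)

text \<open>
  The column of \<open>\<rho> b\<close> selected by the unit matrix is all that survives in \<open>\<rho>(b)(1 \<otimes> \<xi>)\<close>, so \<open>U\<close>
  determines every entry of \<open>\<rho> b\<close>.
\<close>

lemma hom_apply: "matrix_op f u (tens_vec b \<xi>)$x$y = blinfun_apply (\<rho> b$x$y) \<xi>"
proof -
  have "(mat 1 :: complex^'x^'x)$z$y *\<^sub>C \<xi> = (if z = y then \<xi> else 0)" for z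
    by (simp add: mat_def)
  then have "left_mult_op (\<rho> b) (tens_vec (mat 1) \<xi>)$x$y =
      (\<Sum>z\<in>UNIV. if z = y then blinfun_apply (\<rho> b$x$z) \<xi> else 0)"
    by (simp add: left_mult_op_def if_distrib[of "blinfun_apply _"] blinfun.zero_right cong: if_cong)
  then show ?thesis using impl by (simp add: unitary_implementation_def)
qed

lemma hom_entry:
  "\<rho> b$x$y = (\<Sum>i\<in>UNIV. \<Sum>j\<in>UNIV. op_scale (l2 (f i) b * f j$x$y) (u j i))"
proof (rule blinfun_eqI)
  fix \<xi>
  show "blinfun_apply (\<rho> b$x$y) \<xi> =
      blinfun_apply (\<Sum>i\<in>UNIV. \<Sum>j\<in>UNIV. op_scale (l2 (f i) b * f j$x$y) (u j i)) \<xi>"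
    by (simp add: hom_apply[symmetric] matrix_op_def coeff_tens_vec blinfun.sum_left
        bounded_opsD[OF bdd_u(1)] scaleC_scaleC mult.commute)
qed

text \<open>
  Pairing \<open>hom_entry\<close> with the basis element \<open>f k\<close> isolates one row of \<open>U\<close>.
\<close>

lemma hom_coefficient:
  "(\<Sum>x\<in>UNIV. \<Sum>y\<in>UNIV. op_scale (cnj (f k$x$y) / of_nat CARD('x)) (\<rho> b$x$y)) =
     (\<Sum>i\<in>UNIV. op_scale (l2 (f i) b) (u k i))"
proof -
  let ?n = "of_nat CARD('x) :: complex"
  have "(\<Sum>x\<in>UNIV. \<Sum>y\<in>UNIV. op_scale (cnj (f k$x$y) / ?n) (\<rho> b$x$y)) =
      (\<Sum>x\<in>UNIV. \<Sum>y\<in>UNIV. \<Sum>i\<in>UNIV. \<Sum>j\<in>UNIV.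
         op_scale (l2 (f i) b * (cnj (f k$x$y) * f j$x$y / ?n)) (u j i))"
    by (simp add: hom_entry op_scale_sum_right mult_ac)
  also have "\<dots> = (\<Sum>i\<in>UNIV. \<Sum>j\<in>UNIV. \<Sum>x\<in>UNIV. \<Sum>y\<in>UNIV.
         op_scale (l2 (f i) b * (cnj (f k$x$y) * f j$x$y / ?n)) (u j i))"
    by (rule sum_swap_pairs)
  also have "\<dots> = (\<Sum>i\<in>UNIV. \<Sum>j\<in>UNIV. op_scale (l2 (f i) b * l2 (f k) (f j)) (u j i))"
    by (simp only: op_scale_sum_left[symmetric] l2_altdef sum_divide_distrib sum_distrib_left)
  also have "\<dots> = (\<Sum>i\<in>UNIV. \<Sum>j\<in>UNIV. if k = j then op_scale (l2 (f i) b) (u j i) else 0)"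
    by (intro sum.cong refl) (simp add: onb_inner[OF f])
  finally show ?thesis by simp
qed

text \<open>
  \<open>T = 1 - \<rho>(1)\<close> is a projection, so its diagonal entries are sums of terms \<open>T\<^sub>z\<^sub>x\<^sup>* T\<^sub>z\<^sub>x\<close>. Since
  \<open>\<rho>\<close> preserves the trace, the diagonal sums to zero, and faithfulness of \<open>\<tau>\<close> makes every entry vanish.
\<close>

lemma hom_unital: "\<rho> (mat 1)$x$y = (if x = y then id_blinfun else 0)"
proof -
  define T where "T p = (if fst p = snd p then id_blinfun else 0) - \<rho> (mat 1)$fst p$snd p" for p
  have TN: "T p \<in> N" for p by (simp add: T_def)
  have adj: "op_adj (T (z, x)) = T (x, z)" for x z
    using hom_adj[of "mat 1" x z] by (simp add: T_def adj_diff)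
  have sq: "(\<Sum>z\<in>UNIV. op_adj (T (z, x)) o\<^sub>L T (z, x)) = T (x, x)" for x
  proof -
    have "op_adj (T (z, x)) o\<^sub>L T (z, x) = (if z = x then id_blinfun - \<rho> (mat 1)$x$z - \<rho> (mat 1)$z$x else 0) +
        (\<rho> (mat 1)$x$z o\<^sub>L \<rho> (mat 1)$z$x)" for z
      unfolding adj by (cases "z = x") (simp_all add: T_def comp_diff_left comp_diff_right comp_minus_left comp_minus_right)
    then have "(\<Sum>z\<in>UNIV. op_adj (T (z, x)) o\<^sub>L T (z, x)) =
        id_blinfun - \<rho> (mat 1)$x$x - \<rho> (mat 1)$x$x + \<rho> (mat 1 ** mat 1)$x$x"
      by (simp add: sum.distrib hom_mult[of "mat 1" "mat 1"] del: matrix_mul_lid matrix_mul_rid)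
    then show ?thesis by (simp add: T_def)
  qed
  have diag: "(\<Sum>x\<in>UNIV. T (x, x)) = 0"
  proof -
    have "(1 / of_nat CARD('x)) *\<^sub>R (\<Sum>x\<in>UNIV. \<rho> (mat 1)$x$x) = op_scale (ntr (mat 1 :: complex^'x^'x)) id_blinfun"
      using tp by (simp add: trace_preserving_def)
    also have "ntr (mat 1 :: complex^'x^'x) = 1" by (simp add: ntr_def trace_def mat_def)
    finally have "real CARD('x) *\<^sub>R ((1 / of_nat CARD('x)) *\<^sub>R (\<Sum>x\<in>UNIV. \<rho> (mat 1)$x$x)) =
        real CARD('x) *\<^sub>R id_blinfun" by simp
    then have "(\<Sum>x\<in>UNIV. \<rho> (mat 1)$x$x) = real CARD('x) *\<^sub>R id_blinfun" by simp
    then show ?thesis by (simp add: T_def sum_subtractf sum_constant_scaleR)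
  qed
  have "(\<Sum>p\<in>UNIV. \<tau> (op_adj (T p) o\<^sub>L T p)) = (\<Sum>z\<in>UNIV. \<Sum>x\<in>UNIV. \<tau> (op_adj (T (z, x)) o\<^sub>L T (z, x)))"
    by (rule sum_UNIV_prod)
  also have "\<dots> = (\<Sum>x\<in>UNIV. \<Sum>z\<in>UNIV. \<tau> (op_adj (T (z, x)) o\<^sub>L T (z, x)))"
    by (rule sum.swap)
  also have "\<dots> = \<tau> (\<Sum>x\<in>UNIV. T (x, x))"
    by (simp only: trace_sum TN sq[symmetric] N_closed_ops adj_closed N_sum)
  also have "\<dots> = 0" by (simp add: diag)
  finally have "T (x, y) = 0"
    by (intro trace_faithful_sum[where I = UNIV and S = T]) (simp_all add: TN)
  then show ?thesis by (simp add: T_def)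
qed

lemma fixes_unit:
  "(\<Sum>i\<in>UNIV. op_scale (l2 (f i) (mat 1)) (u k i)) = op_scale (l2 (f k) (mat 1)) id_blinfun"
proof -
  have "(\<Sum>i\<in>UNIV. op_scale (l2 (f i) (mat 1)) (u k i)) =
      (\<Sum>x\<in>UNIV. \<Sum>y\<in>UNIV. op_scale (cnj (f k$x$y) * (mat 1 :: complex^'x^'x)$x$y / of_nat CARD('x)) id_blinfun)"
    unfolding hom_coefficient[symmetric] hom_unital by (intro sum.cong refl) (simp add: mat_def)
  also have "\<dots> = op_scale (l2 (f k) (mat 1)) id_blinfun"
    by (simp only: l2_altdef sum_divide_distrib op_scale_sum_left)
  finally show ?thesis .
qed

text \<open>
  The relation \<open>U A\<^sub>1 = A\<^sub>2 U\<close> in coordinates turns into \<open>(A\<^sub>2 \<otimes> id) \<circ> \<rho> = \<rho> \<circ> A\<^sub>1\<close>. In this form it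
  yields both the operator identity, by \<open>hom_apply\<close>, and the relators of the universal algebra.
\<close>

lemma hom_intertwines:
  assumes lin: "mat_linear A\<^sub>1" "mat_linear A\<^sub>2"
    and comm: "\<And>m k. (\<Sum>i\<in>UNIV. op_scale (l2 (f i) (A\<^sub>1 (f m))) (u k i)) =
        (\<Sum>l\<in>UNIV. op_scale (l2 (f k) (A\<^sub>2 (f l))) (u l m))"
  shows "(\<Sum>z\<in>UNIV. \<Sum>w\<in>UNIV. op_scale (A\<^sub>2 (matunit z w)$x$y) (\<rho> b$z$w)) = \<rho> (A\<^sub>1 b)$x$y"
proof -
  let ?a = "\<lambda>i m. l2 (f i) (A\<^sub>1 (f m))" and ?b = "\<lambda>k l. l2 (f k) (A\<^sub>2 (f l))"
  have A2: "A\<^sub>2 (f j)$x$y = (\<Sum>z\<in>UNIV. \<Sum>w\<in>UNIV. A\<^sub>2 (matunit z w)$x$y * f j$z$w)" for j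
  proof -
    have "A\<^sub>2 (f j) = A\<^sub>2 (\<Sum>z\<in>UNIV. \<Sum>w\<in>UNIV. f j$z$w *\<^sub>m matunit z w)"
      by (simp flip: matunit_expand)
    then show ?thesis by (simp add: mat_lin[OF lin(2)] mult.commute)
  qed
  have A2': "A\<^sub>2 (f j)$x$y = (\<Sum>k\<in>UNIV. ?b k j * f k$x$y)" for j
    by (subst onb_expand[OF f, of "A\<^sub>2 (f j)"]) simp
  have A1: "l2 (f i) (A\<^sub>1 b) = (\<Sum>m\<in>UNIV. l2 (f m) b * ?a i m)" for i
  proof -
    have "A\<^sub>1 b = A\<^sub>1 (\<Sum>m\<in>UNIV. l2 (f m) b *\<^sub>m f m)" by (simp flip: onb_expand[OF f])
    then show ?thesis by (simp add: mat_lin[OF lin(1)] l2_sum_right l2_scale_right)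
  qed
  have "(\<Sum>z\<in>UNIV. \<Sum>w\<in>UNIV. op_scale (A\<^sub>2 (matunit z w)$x$y) (\<rho> b$z$w)) =
      (\<Sum>z\<in>UNIV. \<Sum>w\<in>UNIV. \<Sum>i\<in>UNIV. \<Sum>j\<in>UNIV.
        op_scale (l2 (f i) b * (A\<^sub>2 (matunit z w)$x$y * f j$z$w)) (u j i))"
    by (simp add: hom_entry op_scale_sum_right mult_ac)
  also have "\<dots> = (\<Sum>i\<in>UNIV. \<Sum>j\<in>UNIV. \<Sum>z\<in>UNIV. \<Sum>w\<in>UNIV.
        op_scale (l2 (f i) b * (A\<^sub>2 (matunit z w)$x$y * f j$z$w)) (u j i))"
    by (rule sum_swap_pairs)
  also have "\<dots> = (\<Sum>i\<in>UNIV. \<Sum>j\<in>UNIV. op_scale (l2 (f i) b * A\<^sub>2 (f j)$x$y) (u j i))"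
    by (simp only: op_scale_sum_left[symmetric] A2 sum_distrib_left)
  also have "\<dots> = (\<Sum>i\<in>UNIV. \<Sum>j\<in>UNIV. \<Sum>k\<in>UNIV. op_scale (l2 (f i) b * f k$x$y) (op_scale (?b k j) (u j i)))"
    by (simp add: A2' sum_distrib_left op_scale_sum_left mult_ac)
  also have "\<dots> = (\<Sum>i\<in>UNIV. \<Sum>k\<in>UNIV. \<Sum>j\<in>UNIV. op_scale (l2 (f i) b * f k$x$y) (op_scale (?b k j) (u j i)))"
    by (rule sum.cong[OF refl], rule sum.swap)
  also have "\<dots> = (\<Sum>m\<in>UNIV. \<Sum>k\<in>UNIV. \<Sum>i\<in>UNIV. op_scale (l2 (f m) b * f k$x$y) (op_scale (?a i m) (u k i)))"
    by (simp only: op_scale_sum_right[symmetric] comm)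
  also have "\<dots> = (\<Sum>m\<in>UNIV. \<Sum>i\<in>UNIV. \<Sum>k\<in>UNIV. op_scale (l2 (f m) b * ?a i m * f k$x$y) (u k i))"
    by (rule sum.cong[OF refl], subst sum.swap) (simp add: mult_ac)
  also have "\<dots> = (\<Sum>i\<in>UNIV. \<Sum>k\<in>UNIV. \<Sum>m\<in>UNIV. op_scale (l2 (f m) b * ?a i m * f k$x$y) (u k i))"
    by (subst sum.swap) (rule sum.cong[OF refl], rule sum.swap)
  also have "\<dots> = \<rho> (A\<^sub>1 b)$x$y"
    by (simp only: hom_entry A1 sum_distrib_right op_scale_sum_left)
  finally show ?thesis .
qed

text \<open>
  Every vector is a sum of elementary tensors, on which the claim is the relation for \<open>\<rho>\<close> applied to
  \<open>\<xi>\<close>.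
\<close>

lemma operators_intertwine:
  assumes lin: "mat_linear A\<^sub>1" "mat_linear A\<^sub>2"
    and hom_comm: "\<And>b x y. (\<Sum>z\<in>UNIV. \<Sum>w\<in>UNIV. op_scale (A\<^sub>2 (matunit z w)$x$y) (\<rho> b$z$w)) = \<rho> (A\<^sub>1 b)$x$y"
  shows "matrix_op f u \<circ> amplify A\<^sub>1 = amplify A\<^sub>2 \<circ> matrix_op f u"
proof
  fix v :: "'k^'x^'x"
  have elem: "matrix_op f u (amplify A\<^sub>1 (tens_vec b \<xi>)) = amplify A\<^sub>2 (matrix_op f u (tens_vec b \<xi>))" for b \<xi>
  proof -
    have "blinfun_apply (\<rho> (A\<^sub>1 b)$x$y) \<xi> =
        (\<Sum>z\<in>UNIV. \<Sum>w\<in>UNIV. A\<^sub>2 (matunit z w)$x$y *\<^sub>C blinfun_apply (\<rho> b$z$w) \<xi>)" for x y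
      by (simp add: hom_comm[symmetric] blinfun.sum_left)
    then show ?thesis
      by (simp add: vec_eq_iff amplify_tens_vec[OF lin(1)] hom_apply)
         (simp add: amplify_def hom_apply)
  qed
  have "matrix_op f u (amplify A\<^sub>1 (\<Sum>x\<in>UNIV. \<Sum>y\<in>UNIV. tens_vec (matunit x y) (v$x$y))) =
      amplify A\<^sub>2 (matrix_op f u (\<Sum>x\<in>UNIV. \<Sum>y\<in>UNIV. tens_vec (matunit x y) (v$x$y)))"
    by (simp add: matrix_op_sum amplify_sum elem)
  then show "(matrix_op f u \<circ> amplify A\<^sub>1) v = (amplify A\<^sub>2 \<circ> matrix_op f u) v"
    by (simp flip: tens_vec_matunit_expand)
qed

sublocale rep: represented_generators N \<tau> "\<lambda>p. u (fst p) (snd p)"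
  by unfold_locales simp

lemma rep_rho0: "rep.rep (rho0 f b$x$y) = \<rho> b$x$y"
  by (simp add: rho0_def rep.rep_sum rep.rep_fconst_mult rep.rep_fgen hom_entry)

lemma qc_isomorphic_of_intertwining:
  assumes hom_comm: "\<And>b x y. (\<Sum>z\<in>UNIV. \<Sum>w\<in>UNIV. op_scale (A\<^sub>2 (matunit z w)$x$y) (\<rho> b$z$w)) = \<rho> (A\<^sub>1 b)$x$y"
    and one: "\<tau> id_blinfun = 1"
  shows "qc_isomorphic f A\<^sub>1 A\<^sub>2"
proof -
  have mult: "rep.rep ((rho0 f (a ** b) - rho0 f a ** rho0 f b)$x$y) = 0" for a b x y
    by (simp add: rep.rep_diff rep_rho0 matrix_matrix_mult_def[of "rho0 f a"] rep.rep_sum rep.rep_mult hom_mult)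
  have star: "rep.rep (rho0 f (mat_adj a)$x$y - fstar (rho0 f a$y$x)) = 0" for a x y
    by (simp add: rep.rep_diff rep.rep_fstar rep_rho0 hom_adj)
  have unit: "rep.rep ((rho0 f (mat 1) - mat 1)$x$y) = 0" for x y
    by (simp add: rep.rep_diff rep_rho0 hom_unital) (simp add: mat_def)
  have inter: "rep.rep ((map_left A\<^sub>2 (rho0 f a) - rho0 f (A\<^sub>1 a))$x$y) = 0" for a x y
    by (simp add: rep.rep_diff rep_rho0 map_left_def rep.rep_sum rep.rep_fconst_mult hom_comm)
  have trace: "rep.rep (fconst (1 / of_nat CARD('x)) * trace (rho0 f a) - fconst (ntr a)) = 0" for a
  proof -
    have "op_scale (1 / of_nat CARD('x)) (\<Sum>x\<in>UNIV. \<rho> a$x$x) = op_scale (ntr a) id_blinfun"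
      using tp op_scale_of_real[of "1 / of_nat CARD('x)" "\<Sum>x\<in>UNIV. \<rho> a$x$x"]
      by (simp add: trace_preserving_def)
    then show ?thesis
      by (simp add: rep.rep_diff rep.rep_fconst_mult trace_def rep.rep_sum rep_rho0 rep.rep_fconst)
  qed
  have "\<forall>r\<in>iso_relators f A\<^sub>1 A\<^sub>2. rep.rep r = 0"
    unfolding iso_relators_def using mult star unit inter trace by blast
  from rep.tracial_state_exists[OF this one] show ?thesis
    unfolding qc_isomorphic_def by blast
qed

end

section \<open>The correlation of a bi-unitary\<close>

context bi_unitary_vn
begin

text \<open>
  Cycling \<open>u\<^bsub>l,j\<^esub>\<close> to the front exhibits the Gram form; for \<open>\<Gamma>~\<close> the factors already are in the right
  order.
\<close>

lemma Gamma_gram: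
  "Gamma \<tau> u = lift_bimat (\<lambda>i i' j j'. \<Sum>k\<in>UNIV. \<Sum>k'\<in>UNIV. \<Sum>l\<in>UNIV. \<Sum>l'\<in>UNIV.
     \<tau> (op_adj (u k i o\<^sub>L op_adj (u l j)) o\<^sub>L (u k' i' o\<^sub>L op_adj (u l' j')))
       *\<^sub>m kron (matunit k k') (matunit l l'))"
proof -
  have "\<tau> (op_adj (u k i) o\<^sub>L u k' i' o\<^sub>L op_adj (u l' j') o\<^sub>L u l j) =
      \<tau> (op_adj (u k i o\<^sub>L op_adj (u l j)) o\<^sub>L (u k' i' o\<^sub>L op_adj (u l' j')))" for i i' j j' k k' l l'
    by (subst trace_comm) (simp_all add: adj_comp comp_assoc)
  then show ?thesis by (simp add: Gamma_def)
qed

lemma Gamma_tilde_gram: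
  "Gamma_tilde \<tau> u = lift_bimat (\<lambda>k k' l l'. \<Sum>i\<in>UNIV. \<Sum>i'\<in>UNIV. \<Sum>j\<in>UNIV. \<Sum>j'\<in>UNIV.
     \<tau> (op_adj (op_adj (u k i) o\<^sub>L u l j) o\<^sub>L (op_adj (u k' i') o\<^sub>L u l' j'))
       *\<^sub>m kron (matunit i i') (matunit j j'))"
  by (simp add: Gamma_tilde_def adj_comp comp_assoc)

text \<open>
  Preservation of the trace at \<open>\<epsilon>\<^bsub>i,i\<^esub> \<otimes> \<epsilon>\<^bsub>i,i\<^esub>\<close>: by unitarity of \<open>U\<close> and of its transpose, the output has trace
  \<open>\<tau>(1)\<close>.
\<close>

lemma trace_one:
  assumes "quantum_channel (Gamma \<tau> u)"
  shows "\<tau> id_blinfun = 1"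
proof -
  fix i :: 'i
  let ?\<omega> = "matunit (i, i) (i, i) :: 'i bimat"
  have entry: "Gamma \<tau> u ?\<omega>$p$p = \<tau> (u (snd p) i o\<^sub>L (op_adj (u (fst p) i) o\<^sub>L u (fst p) i) o\<^sub>L op_adj (u (snd p) i))" for p
  proof -
    have "Gamma \<tau> u ?\<omega>$p$p = (\<Sum>r\<in>UNIV. \<Sum>s\<in>UNIV. ?\<omega>$r$s *
      \<tau> (op_adj (u (fst p) (fst r) o\<^sub>L op_adj (u (snd p) (snd r))) o\<^sub>L (u (fst p) (fst s) o\<^sub>L op_adj (u (snd p) (snd s)))))"
      unfolding Gamma_gram by (rule lift_bimat_entry)
    also have "\<dots> = (\<Sum>r\<in>UNIV. \<Sum>s\<in>UNIV. if s = (i, i) then (if r = (i, i) then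
      \<tau> (op_adj (u (fst p) (fst r) o\<^sub>L op_adj (u (snd p) (snd r))) o\<^sub>L (u (fst p) (fst s) o\<^sub>L op_adj (u (snd p) (snd s)))) else 0) else 0)"
      by (intro sum.cong refl) simp
    finally show ?thesis by (simp add: adj_comp comp_assoc)
  qed
  have "trace (Gamma \<tau> u ?\<omega>) = (\<Sum>l\<in>UNIV. \<Sum>k\<in>UNIV. \<tau> (u l i o\<^sub>L (op_adj (u k i) o\<^sub>L u k i) o\<^sub>L op_adj (u l i)))"
    unfolding trace_def entry sum_UNIV_prod by (subst sum.swap) simp
  also have "\<dots> = \<tau> (\<Sum>l\<in>UNIV. u l i o\<^sub>L (\<Sum>k\<in>UNIV. op_adj (u k i) o\<^sub>L u k i) o\<^sub>L op_adj (u l i))"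
    by (simp add: trace_sum comp_sum_left comp_sum_right)
  also have "\<dots> = \<tau> id_blinfun" by (simp add: columns columns')
  finally have "\<tau> id_blinfun = trace ?\<omega>"
    using assms by (simp add: quantum_channel_def)
  also have "trace ?\<omega> = 1" by (simp add: trace_def)
  finally show ?thesis .
qed

end

lemma csubspace_pseudo_graph:
  "csubspace ((\<lambda>T. \<chi> p. l2 (f (snd p)) (T (f (fst p)))) ` bimodule_span A)"
  (is "csubspace (?c ` _)")
  unfolding csubspace_def
proof (intro conjI ballI allI)
  show "0 \<in> ?c ` bimodule_span A"
    by (rule image_eqI[OF _ bimodule_span_scale[OF bimodule_span_self, of 0]]) (simp add: vec_eq_iff)
  show "v + w \<in> ?c ` bimodule_span A" if vw: "v \<in> ?c ` bimodule_span A" "w \<in> ?c ` bimodule_span A" for v w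
  proof -
    obtain S T where "S \<in> bimodule_span A" "T \<in> bimodule_span A" "v = ?c S" "w = ?c T"
      using vw by blast
    then show ?thesis
      by (intro image_eqI[OF _ bimodule_span_add[of S A T]]) (simp_all add: vec_eq_iff l2_add_right)
  qed
  show "d *s v \<in> ?c ` bimodule_span A" if v: "v \<in> ?c ` bimodule_span A" for d v
  proof -
    obtain S where "S \<in> bimodule_span A" "v = ?c S" using v by blast
    then show ?thesis
      by (intro image_eqI[OF _ bimodule_span_scale[of S A d]]) (simp_all add: vec_eq_iff l2_scale_right)
  qed
qed

theorem theorem8p14:
  fixes A\<^sub>1 A\<^sub>2 :: "complex^'x^'x \<Rightarrow> complex^'x^'x"
    and f :: "'i::finite \<Rightarrow> complex^'x^'x"
    and N :: "'k::complex_hilbert operator set"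
    and \<tau> :: "'k operator \<Rightarrow> complex"
    and u :: "'i \<Rightarrow> 'i \<Rightarrow> 'k operator"
    and \<rho> :: "complex^'x^'x \<Rightarrow> ('k operator)^'x^'x"
  assumes "quantum_adjacency A\<^sub>1" and "quantum_adjacency A\<^sub>2"
    and "onb f"
    and "von_neumann_algebra N" and "faithful_trace N \<tau>"
    and "\<And>i j. u i j \<in> N" and "bi_unitary u"
    and "implements_qc_pseudo_iso TYPE('h::complex_hilbert) \<tau> u
           (coords2 f ` U_tilde f A\<^sub>1) (coords2 f ` U_tilde f A\<^sub>2)"
    and "star_hom_into N \<rho>" and "trace_preserving \<rho>"
    and "unitary_implementation f u \<rho>"
  shows "matrix_op f u \<circ> amplify A\<^sub>1 = amplify A\<^sub>2 \<circ> matrix_op f u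
         \<and> qc_isomorphic f A\<^sub>1 A\<^sub>2"
proof -
  interpret implemented_hom N \<tau> u f \<rho>
    using assms by unfold_locales auto
  note f = assms(3)
  note lin = assms(1,2)[THEN quantum_adjacency_linear]
  define c where "c i = l2 (f i) (mat 1)" for i
  define mat_of where "mat_of A i j = l2 (f i) (A (f j))" for A i j
  define W where "W A = (\<lambda>T. \<chi> p. l2 (f (snd p)) (T (f (fst p)))) ` bimodule_span A" for A
  \<comment> \<open>In \<open>L\<^sup>2 \<otimes> L\<^sup>2\<close> the operator with matrix entries (l, j) is the vector with coordinates (j, l);
      \<open>rest A\<close> is the vector of \<open>e - A\<close>, and \<open>vec_of A\<close> that of \<open>A\<close>.\<close>
  define rest where "rest A = (\<chi> p. c (snd p) * cnj (c (fst p)) - mat_of A (snd p) (fst p))"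
    for A :: "complex^'x^'x \<Rightarrow> complex^'x^'x"
  define vec_of where "vec_of A = (\<chi> p. mat_of A (snd p) (fst p))"
    for A :: "complex^'x^'x \<Rightarrow> complex^'x^'x"
  have W_eq: "coords2 f ` U_tilde f A = W A" if "mat_linear A" for A
    unfolding W_def by (rule pseudo_graph_coords[OF f that])
  have sub: "csubspace (W A)" for A
    unfolding W_def by (rule csubspace_pseudo_graph)
  have in_W: "vec_of A \<in> W A" for A
    unfolding W_def vec_of_def mat_of_def by (rule image_eqI[OF _ bimodule_span_self]) simp
  \<comment> \<open>Orthogonality in coordinates is Hilbert-Schmidt orthogonality, by Parseval.\<close>
  have orth: "cdot w (rest A) = 0" if A: "quantum_adjacency A" and w: "w \<in> W A" for A w
  proof -
    obtain T where T: "T \<in> bimodule_span A" and w: "w = (\<chi> p. l2 (f (snd p)) (T (f (fst p))))"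
      using w by (auto simp: W_def)
    have rest: "rest A$(j, l) = l2 (f l) (rank_one (mat 1) (mat 1) (f j) - A (f j))" for j l
      by (simp add: rest_def mat_of_def c_def rank_one_def l2_diff_right l2_scale_right cnj_l2 mult.commute)
    have "cdot w (rest A) = (\<Sum>j\<in>UNIV. \<Sum>l\<in>UNIV. l2 (T (f j)) (f l) *
        l2 (f l) (rank_one (mat 1) (mat 1) (f j) - A (f j)))"
      by (simp add: cdot_def sum_UNIV_prod w cnj_l2 rest)
    also have "\<dots> = (\<Sum>j\<in>UNIV. l2 (T (f j)) (rank_one (mat 1) (mat 1) (f j) - A (f j)))"
      by (simp only: onb_parseval[OF f, symmetric])
    also have "\<dots> = 0" by (rule adjacency_projection[OF A f T])
    finally show ?thesis .
  qed
  have herm: "cnj (mat_of A i j) = mat_of A j i" if "quantum_adjacency A" for A i j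
    by (simp add: mat_of_def cnj_l2 quantum_adjacency_selfadj[OF that])
  have proj: "(\<Sum>i\<in>UNIV. \<Sum>j\<in>UNIV. mat_of A j i * mat_of A i j) =
      (\<Sum>i\<in>UNIV. \<Sum>j\<in>UNIV. mat_of A j i * (c i * cnj (c j)))" if A: "quantum_adjacency A" for A
  proof -
    have "0 = cdot (vec_of A) (rest A)" using orth[OF A in_W] by simp
    also have "\<dots> = (\<Sum>j\<in>UNIV. \<Sum>i\<in>UNIV. mat_of A j i * (c i * cnj (c j) - mat_of A i j))"
      by (simp add: cdot_def sum_UNIV_prod vec_of_def rest_def herm[OF A])
    also have "\<dots> = (\<Sum>i\<in>UNIV. \<Sum>j\<in>UNIV. mat_of A j i * (c i * cnj (c j))) -
        (\<Sum>i\<in>UNIV. \<Sum>j\<in>UNIV. mat_of A j i * mat_of A i j)"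
      by (subst sum.swap) (simp add: right_diff_distrib sum_subtractf)
    finally show ?thesis by simp
  qed
  have perf: "perfect_strategy (Gamma \<tau> u) (W A\<^sub>1) (W A\<^sub>2)" "perfect_strategy (Gamma_tilde \<tau> u) (W A\<^sub>2) (W A\<^sub>1)"
    and chan: "quantum_channel (Gamma \<tau> u)"
    using assms(8) lin
    by (auto simp: implements_qc_pseudo_iso_def W_eq Q_qc_bic_def qns_bicorrelation_def qns_correlation_def)
  have fwd: "(\<Sum>k\<in>UNIV. \<Sum>l\<in>UNIV. \<Sum>i\<in>UNIV. \<Sum>j\<in>UNIV.
      op_scale ((c l * cnj (c k) - mat_of A\<^sub>2 l k) * mat_of A\<^sub>1 i j) (u k i o\<^sub>L op_adj (u l j))) = 0"
    using perfect_strategy_annihilates[OF perf(1)[unfolded Gamma_gram] sub sub _ in_W orth[OF assms(2)]]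
    by (simp add: rest_def vec_of_def herm assms(1))
  have bwd: "(\<Sum>i\<in>UNIV. \<Sum>j\<in>UNIV. \<Sum>k\<in>UNIV. \<Sum>l\<in>UNIV.
      op_scale ((c j * cnj (c i) - mat_of A\<^sub>1 j i) * mat_of A\<^sub>2 k l) (op_adj (u k i) o\<^sub>L u l j)) = 0"
    using perfect_strategy_annihilates[where S = "\<lambda>i k j l. op_adj (u k i) o\<^sub>L u l j",
        OF perf(2)[unfolded Gamma_tilde_gram] sub sub _ in_W orth[OF assms(1)]]
    by (simp add: rest_def vec_of_def herm assms(2))
  have conj: "conj_mat (mat_of A\<^sub>1) k l = op_scale (mat_of A\<^sub>2 k l) id_blinfun" for k l
    by (rule conjugation_eqI[OF _ herm herm proj proj fwd bwd])
       (simp_all add: assms(1,2) c_def fixes_unit)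
  have comm: "(\<Sum>z\<in>UNIV. \<Sum>w\<in>UNIV. op_scale (A\<^sub>2 (matunit z w)$x$y) (\<rho> b$z$w)) = \<rho> (A\<^sub>1 b)$x$y" for b x y
    by (rule hom_intertwines[OF lin]) (rule intertwines[OF conj, unfolded mat_of_def])
  show ?thesis
    using operators_intertwine[OF lin comm] qc_isomorphic_of_intertwining[OF comm trace_one[OF chan]] by blast
qed

end
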